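(* Let $X$ be a Lévy process in $\mathbb{R}^d$, $d\in\mathbb{N}$, let $\lambda>0$, and let $X^\lambda$ be the $\lambda$-subprocess of $X$. Then all three inequalities $h_1(X^\lambda)<1$, $h_2(X^\lambda)<1$ and $h_3(X^\lambda)<1$ hold if and only if $\{0\}$ is polar for $X$.
   Context: The $\lambda$-subprocess $X^\lambda$ of $X$ is $X$ killed at an independent exponential time with parameter $\lambda$ (after its lifetime it stays in a cemetery state outside $\mathbb{R}^d$). For a Hunt process $W$ with state space $\mathbb{R}^d$ and lifetime $\zeta$, let $T_B=\inf\{t>0: W_t\in B\}$ for Borel $B\subseteq\mathbb{R}^d$ ($\inf\emptyset=\infty$), $\tau_B=T_{\mathbb{R}^d\setminus B}$, and $$h_1(W)=\sup_{t>0}\inf_{r>0}\sup_{x\in\mathbb{R}^d}\mathbb{P}^x(\tau_{B(x,r)}>t),\qquad h_2(W)=\sup_{r>0}\inf_{t>0}\sup_{x\in\mathbb{R}^d}\mathbb{P}^x(\tau_{B(x,r)}<t),$$ $$h_3(W)=\sup_{u>0}\inf_{r>0}\sup_{|x-y|\ge u}\mathbb{P}^y(T_{B(x,r)}<\zeta).$$ Here $B(x,r)$ is the open Euclidean ball and $\mathbb{P}^x$ is the law of the process started at $x$. A Borel set $B$ is polar for $X$ if $\mathbb{P}^x(T_B=\infty)=1$ for all $x\in\mathbb{R}^d$. *)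

theory Defs
  imports "HOL-Probability.Probability"
begin

text \<open>
  A path with killing is a map from times to \<open>'a option\<close>, where \<open>None\<close> is the cemetery
  state; only its values at times \<open>t \<ge> 0\<close> matter.

  A process with state space \<open>'a\<close> is given by a probability space \<open>M\<close> and, for every starting
  point \<open>x\<close>, a random path \<open>W x\<close> on \<open>M\<close> whose law is the law of the process started at \<open>x\<close>.
  So the probability under the law started at \<open>x\<close> that the path lies in \<open>A\<close> is the
  \<open>M\<close>-probability that \<open>W x \<omega> \<in> A\<close>.
\<close>

type_synonym 'a path = "real \<Rightarrow> 'a option"

definition hitting_time :: "'a set \<Rightarrow> 'a path \<Rightarrow> ereal" where
  "hitting_time B w = Inf {ereal t | t. t > 0 \<and> w t \<in> Some ` B}"

text \<open>The cemetery does not belong to \<open>- B\<close>: a path killed before leaving \<open>B\<close> has exit time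
  \<open>\<infinity>\<close>.\<close>

definition exit_time :: "'a set \<Rightarrow> 'a path \<Rightarrow> ereal" where
  "exit_time B w = hitting_time (- B) w"

definition lifetime :: "'a path \<Rightarrow> ereal" where
  "lifetime w = Inf {ereal t | t. t \<ge> 0 \<and> w t = None}"

text \<open>
  The hitting time of a Borel set by a right-continuous process is in general measurable only
  with respect to the completed sigma-algebra, and \<^const>\<open>emeasure\<close> is 0 on non-measurable sets.
  Probabilities are therefore taken in the completion.
\<close>

definition path_prob ::
  "'w measure \<Rightarrow> ('a \<Rightarrow> 'w \<Rightarrow> 'a path) \<Rightarrow> 'a \<Rightarrow> ('a path \<Rightarrow> bool) \<Rightarrow> ennreal" where
  "path_prob M W x Q = emeasure (completion M) {\<omega> \<in> space M. Q (W x \<omega>)}"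

definition h1 :: "'w measure \<Rightarrow> ('a::euclidean_space \<Rightarrow> 'w \<Rightarrow> 'a path) \<Rightarrow> ennreal" where
  "h1 M W = (SUP t\<in>{0<..}. INF r\<in>{0<..}. SUP x.
     path_prob M W x (\<lambda>w. exit_time (ball x r) w > ereal t))"

definition h2 :: "'w measure \<Rightarrow> ('a::euclidean_space \<Rightarrow> 'w \<Rightarrow> 'a path) \<Rightarrow> ennreal" where
  "h2 M W = (SUP r\<in>{0<..}. INF t\<in>{0<..}. SUP x.
     path_prob M W x (\<lambda>w. exit_time (ball x r) w < ereal t))"

definition h3 :: "'w measure \<Rightarrow> ('a::euclidean_space \<Rightarrow> 'w \<Rightarrow> 'a path) \<Rightarrow> ennreal" where
  "h3 M W = (SUP u\<in>{0<..}. INF r\<in>{0<..}. SUP (x, y)\<in>{(x, y). norm (x - y) \<ge> u}.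
     path_prob M W y (\<lambda>w. hitting_time (ball x r) w < lifetime w))"

definition polar ::
  "'w measure \<Rightarrow> ('a::euclidean_space \<Rightarrow> 'w \<Rightarrow> 'a path) \<Rightarrow> 'a set \<Rightarrow> bool" where
  "polar M W B \<longleftrightarrow> B \<in> sets borel \<and> (\<forall>x. path_prob M W x (\<lambda>w. hitting_time B w = \<infinity>) = 1)"

definition cadlag :: "(real \<Rightarrow> 'a::euclidean_space) \<Rightarrow> bool" where
  "cadlag f \<longleftrightarrow> (\<forall>t\<ge>0. (f \<longlongrightarrow> f t) (at_right t)) \<and> (\<forall>t>0. \<exists>l. (f \<longlongrightarrow> l) (at_left t))"

definition levy_process :: "'w measure \<Rightarrow> (real \<Rightarrow> 'w \<Rightarrow> 'a::euclidean_space) \<Rightarrow> bool" where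
  "levy_process M X \<longleftrightarrow>
     prob_space M \<and>
     (\<forall>t\<ge>0. X t \<in> borel_measurable M) \<and>
     (AE \<omega> in M. X 0 \<omega> = 0) \<and>
     (\<forall>(n::nat) (t::nat \<Rightarrow> real). 0 \<le> t 0 \<and> (\<forall>i<n. t i < t (Suc i)) \<longrightarrow>
        prob_space.indep_vars M (\<lambda>_. borel) (\<lambda>i \<omega>. X (t (Suc i)) \<omega> - X (t i) \<omega>) {..<n}) \<and>
     (\<forall>s\<ge>0. \<forall>t\<ge>0. distr M borel (\<lambda>\<omega>. X (s + t) \<omega> - X s \<omega>) = distr M borel (X t)) \<and>
     (AE \<omega> in M. cadlag (\<lambda>t. X t \<omega>))"

text \<open>A Levy process started at \<open>x\<close> is the translate \<open>x + X\<close>; its lifetime is infinite.\<close>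

definition levy_path :: "(real \<Rightarrow> 'w \<Rightarrow> 'a::euclidean_space) \<Rightarrow> 'a \<Rightarrow> 'w \<Rightarrow> 'a path" where
  "levy_path X x \<omega> = (\<lambda>t. Some (x + X t \<omega>))"

text \<open>
  Killing at rate \<open>q\<close>: the second coordinate of the product space is the exponentially
  distributed killing time, independent of the first coordinate by construction.
\<close>

definition kill_space :: "real \<Rightarrow> 'w measure \<Rightarrow> ('w \<times> real) measure" where
  "kill_space q M = M \<Otimes>\<^sub>M density lborel (\<lambda>s. ennreal (exponential_density q s))"

definition kill_path :: "('a \<Rightarrow> 'w \<Rightarrow> 'a path) \<Rightarrow> 'a \<Rightarrow> 'w \<times> real \<Rightarrow> 'a path" where
  "kill_path W x = (\<lambda>(\<omega>, s) t. if t < s then W x \<omega> t else None)"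

end

theory Submission
  imports Defs
begin

text \<open>
  The quantity \<^const>\<open>h2\<close> is always below 1, since paths are right-continuous at time 0. If \<open>{0}\<close> is
  polar, then no \<open>X t\<close> with \<open>t > 0\<close> has atoms, which bounds \<^const>\<open>h1\<close>. For \<^const>\<open>h3\<close>, a path that comes
  arbitrarily close to \<open>x\<close> hits \<open>x\<close> or has the left limit \<open>x\<close> at a jump. The latter is excluded:
  a cadlag path jumps from or to only countably many points, so only countably many points are
  touched by a jump with positive probability, and by the Markov property at a small time \<open>h\<close> the
  point \<open>x - X h\<close> avoids them. Compactness makes the bound uniform in \<open>x\<close>.

  Conversely, if the process held at its starting point with positive probability, its paths would
  be step functions and \<^const>\<open>h1\<close> would be 1; so \<open>h1 < 1\<close> implies that no path is constant on an
  interval. By \<open>h3 < 1\<close> there are a time horizon \<open>\<theta>\<close> and \<open>\<kappa> < 1\<close> such that from distance at least \<open>u\<close> a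
  ball of radius \<open>r(u)\<close> is reached within time \<open>\<theta>\<close> with probability at most \<open>\<kappa>\<close>. Applied to the event
  of visiting \<open>z\<close> at infinitely many of given times, this gives \<open>P \<le> \<kappa> P\<close>, whence \<open>X h = z\<close> has probability
  0 for all but countably many \<open>h\<close>, so that again points are not reached by jumps. Applied to the
  event of coming arbitrarily close to \<open>x\<close> without being there, it gives \<open>P \<le> \<kappa> P\<close> once more.
\<close>

section \<open>Cadlag paths\<close>

text \<open>A non-measurable event has \<open>path_prob\<close> 0, so upper bounds come for free and
  lower bounds have to be earned. Entering an open ball is decided by rational times, which settles
  \<open>h3\<close> in both directions. Leaving an open ball means hitting a closed set, which
  rational times can miss; this is why a lower bound for \<open>h1\<close> is available only once
  the paths are known to be step functions.

  The Markov property is proved at fixed times. The strong Markov property is replaced by first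
  times in finite sets, followed by monotone limits. Counting the points touched by jumps takes the
  place of quasi-left-continuity. Its price is a time \<open>h\<close> at which \<open>X h\<close>
  charges none of countably many points: polarity provides it at once, whereas the converse has to
  produce it from \<open>h3 < 1\<close>.

  Since \<open>h3 < 1\<close> gives a factor below 1 but no smallness, an estimate helps only if in
  the limit the same event stands on both sides.\<close>

lemma cadlag_right:
  assumes "cadlag f" "0 \<le> t" "0 < e"
  obtains d where "0 < d" "\<And>v. t \<le> v \<Longrightarrow> v < t + d \<Longrightarrow> dist (f v) (f t) < e"
proof -
  have "(f \<longlongrightarrow> f t) (at_right t)"
    using assms by (auto simp: cadlag_def)
  then have "\<forall>\<^sub>F v in at_right t. dist (f v) (f t) < e"
    using \<open>0 < e\<close> by (rule tendstoD)
  then obtain b where b: "t < b" "\<And>v. t < v \<Longrightarrow> v < b \<Longrightarrow> dist (f v) (f t) < e"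
    unfolding eventually_at_right_field by auto
  show ?thesis
  proof (rule that[of "b - t"])
    fix v assume "t \<le> v" "v < t + (b - t)"
    then show "dist (f v) (f t) < e"
      using b(2)[of v] \<open>0 < e\<close> by (cases "v = t") auto
  qed (use b in simp)
qed

lemma cadlag_left:
  assumes "cadlag f" "0 < t"
  obtains l where "\<And>e. 0 < e \<Longrightarrow> \<exists>d>0. \<forall>v. t - d < v \<and> v < t \<longrightarrow> dist (f v) l < e"
proof -
  obtain l where l: "(f \<longlongrightarrow> l) (at_left t)"
    using assms by (auto simp: cadlag_def)
  show ?thesis
  proof (rule that[of l])
    fix e :: real assume "0 < e"
    then have "\<forall>\<^sub>F v in at_left t. dist (f v) l < e"
      using l by (intro tendstoD)
    then obtain b where b: "b < t" "\<And>v. b < v \<Longrightarrow> v < t \<Longrightarrow> dist (f v) l < e"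
      unfolding eventually_at_left_field by auto
    then show "\<exists>d>0. \<forall>v. t - d < v \<and> v < t \<longrightarrow> dist (f v) l < e"
      by (intro exI[of _ "t - b"]) auto
  qed
qed

text \<open>Being in an open set persists for a while to the right, so a dense set of times detects
  it; this turns such events into countable unions. Density is asked for only inside
  \<open>[t, b]\<close>, so that dense subsets of a bounded window qualify.\<close>

lemma cadlag_right_dense:
  assumes f: "cadlag f" and "0 \<le> t" "t < b" "open U" "f t \<in> U"
    and D: "\<And>u v. 0 \<le> u \<Longrightarrow> u < v \<Longrightarrow> t \<le> u \<Longrightarrow> v \<le> b \<Longrightarrow> \<exists>q\<in>D. u < q \<and> q < v"
  shows "\<exists>q\<in>D. t < q \<and> q < b \<and> f q \<in> U"
proof -
  obtain e where e: "0 < e" "\<And>y. dist y (f t) < e \<Longrightarrow> y \<in> U"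
    using assms(4,5) unfolding open_dist by blast
  obtain d where d: "0 < d" "\<And>v. t \<le> v \<Longrightarrow> v < t + d \<Longrightarrow> dist (f v) (f t) < e"
    using cadlag_right[OF f \<open>0 \<le> t\<close> e(1)] by blast
  obtain q where "q \<in> D" "t < q" "q < min b (t + d)"
    using D[of t "min b (t + d)"] \<open>0 \<le> t\<close> \<open>t < b\<close> d(1) by auto
  then show ?thesis
    using d(2)[of q] e(2) by (intro bexI[of _ q]) auto
qed

text \<open>Bisection replaces an open cover. Near a single point \<open>x\<close>, the values to
  the left stay within \<open>r/2\<close> of the left limit and those from \<open>x\<close> on
  within \<open>r/2\<close> of \<open>f x\<close>, so a pair of values \<open>r\<close> apart must
  straddle \<open>x\<close>.\<close>

lemma cadlag_finite_jumps:
  assumes f: "cadlag f" and "0 < r"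
  shows "\<exists>F. finite F \<and> (\<forall>u v. 0 \<le> u \<longrightarrow> u < v \<longrightarrow> v \<le> T \<longrightarrow> r \<le> dist (f u) (f v) \<longrightarrow> (\<exists>s\<in>F. u < s \<and> s \<le> v))"
proof (cases "0 \<le> T")
  case True
  define P where "P a b \<longleftrightarrow> (\<exists>F. finite F \<and> (\<forall>u v. 0 \<le> u \<longrightarrow> a \<le> u \<longrightarrow> u < v \<longrightarrow> v \<le> b \<longrightarrow>
    r \<le> dist (f u) (f v) \<longrightarrow> (\<exists>s\<in>F. u < s \<and> s \<le> v)))" for a b
  have "P 0 T"
  proof (rule Bolzano[OF True])
    fix a b c assume "P a b" "P b c" and "a \<le> b" "b \<le> c"
    then obtain F G where
      F: "finite F" "\<And>u v. 0 \<le> u \<Longrightarrow> a \<le> u \<Longrightarrow> u < v \<Longrightarrow> v \<le> b \<Longrightarrow> r \<le> dist (f u) (f v) \<Longrightarrow> \<exists>s\<in>F. u < s \<and> s \<le> v" and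
      G: "finite G" "\<And>u v. 0 \<le> u \<Longrightarrow> b \<le> u \<Longrightarrow> u < v \<Longrightarrow> v \<le> c \<Longrightarrow> r \<le> dist (f u) (f v) \<Longrightarrow> \<exists>s\<in>G. u < s \<and> s \<le> v"
      unfolding P_def by metis
    \<comment> \<open>A pair with \<open>u < b < v\<close> lies in neither half, so the common
      endpoint joins the witnesses.\<close>
    show "P a c"
      unfolding P_def
    proof (intro exI[of _ "insert b (F \<union> G)"] conjI allI impI)
      fix u v assume uv: "0 \<le> u" "a \<le> u" "u < v" "v \<le> c" "r \<le> dist (f u) (f v)"
      consider "v \<le> b" | "u < b" "b < v" | "b \<le> u" by linarith
      then show "\<exists>s\<in>insert b (F \<union> G). u < s \<and> s \<le> v"
        by cases (use F(2)[OF uv(1,2,3) _ uv(5)] G(2)[OF uv(1) _ uv(3,4,5)] in auto)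
    qed (use F G in auto)
  next
    fix x assume x: "0 \<le> x" "x \<le> T"
    obtain d1 where d1: "0 < d1" "\<And>v. x \<le> v \<Longrightarrow> v < x + d1 \<Longrightarrow> dist (f v) (f x) < r/2"
      using cadlag_right[OF f x(1)] \<open>0 < r\<close> by (metis half_gt_zero)
    \<comment> \<open>At \<open>x = 0\<close> there is no left limit, and the claim is vacuous
      because of \<open>0 \<le> v\<close>; this is what the condition \<open>0 \<le> u\<close> in
      \<open>P\<close> is for.\<close>
    obtain d2 l where d2: "0 < d2" "\<And>v. 0 \<le> v \<Longrightarrow> x - d2 < v \<Longrightarrow> v < x \<Longrightarrow> dist (f v) l < r/2"
    proof (cases "x = 0")
      case True
      then show ?thesis by (intro that[of 1]) auto
    next
      case False
      then obtain l where "\<And>e. 0 < e \<Longrightarrow> \<exists>d>0. \<forall>v. x - d < v \<and> v < x \<longrightarrow> dist (f v) l < e"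
        using cadlag_left[OF f, of x] x by fastforce
      from this[of "r/2"] \<open>0 < r\<close> that show ?thesis by auto
    qed
    show "\<exists>d>0. \<forall>a b. a \<le> x \<and> x \<le> b \<and> b - a < d \<longrightarrow> P a b"
    proof (intro exI[of _ "min d1 d2"] conjI allI impI)
      fix a b assume ab: "a \<le> x \<and> x \<le> b \<and> b - a < min d1 d2"
      show "P a b"
        unfolding P_def
      proof (intro exI[of _ "{x}"] conjI allI impI)
        fix u v assume uv: "0 \<le> u" "a \<le> u" "u < v" "v \<le> b" "r \<le> dist (f u) (f v)"
        have "\<not> x \<le> u"
        proof
          assume "x \<le> u"
          then have "dist (f u) (f x) < r/2" "dist (f v) (f x) < r/2"
            using d1(2)[of u] d1(2)[of v] uv ab by auto
          then show False
            using uv(5) dist_triangle2[of "f u" "f v" "f x"] by simp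
        qed
        moreover have "\<not> v < x"
        proof
          assume "v < x"
          then have "dist (f u) l < r/2" "dist (f v) l < r/2"
            using d2(2)[of u] d2(2)[of v] uv ab by auto
          then show False
            using uv(5) dist_triangle2[of "f u" "f v" l] by simp
        qed
        ultimately show "\<exists>s\<in>{x}. u < s \<and> s \<le> v" by auto
      qed auto
    qed (use d1 d2 in auto)
  qed
  then show ?thesis
    unfolding P_def by auto
next
  case False
  then show ?thesis by (intro exI[of _ "{}"]) auto
qed

lemma at_left_shift: "at_left (h + t) = filtermap ((+) h) (at_left t)" for h t :: real
  using filtermap_nhds_shift[of "- h" t, symmetric]
  by (simp add: filter_eq_iff eventually_filtermap eventually_at_filter add.commute)

lemma at_right_shift: "at_right (h + t) = filtermap ((+) h) (at_right t)" for h t :: real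
  using filtermap_nhds_shift[of "- h" t, symmetric]
  by (simp add: filter_eq_iff eventually_filtermap eventually_at_filter add.commute)

lemma cadlag_shift:
  assumes "cadlag f" "0 \<le> h"
  shows "cadlag (\<lambda>t. f (h + t))"
  unfolding cadlag_def
proof (intro conjI allI impI)
  fix t :: real assume "0 \<le> t"
  then have "(f \<longlongrightarrow> f (h + t)) (at_right (h + t))"
    using assms by (auto simp: cadlag_def)
  then show "((\<lambda>t. f (h + t)) \<longlongrightarrow> f (h + t)) (at_right t)"
    by (simp add: at_right_shift filterlim_filtermap)
next
  fix t :: real assume "0 < t"
  then have "\<exists>l. (f \<longlongrightarrow> l) (at_left (h + t))"
    using assms unfolding cadlag_def by simp
  then show "\<exists>l. ((\<lambda>t. f (h + t)) \<longlongrightarrow> l) (at_left t)"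
    by (simp add: at_left_shift filterlim_filtermap)
qed

text \<open>Take a convergent subsequence of the times. If infinitely many of them lie at or after
  the limit \<open>s\<close>, right-continuity gives the value \<open>f s\<close>; otherwise almost
  all lie before \<open>s\<close> and give the left limit.\<close>

lemma cadlag_seq_compact:
  fixes f :: "real \<Rightarrow> 'a::euclidean_space"
  assumes f: "cadlag f" and q: "\<And>n::nat. q n \<in> {0..K}"
  obtains s \<phi> l where "s \<in> {0..K}" "strict_mono \<phi>" "(\<lambda>n. f (q (\<phi> n))) \<longlonglongrightarrow> l"
    "l = f s \<or> 0 < s \<and> (f \<longlongrightarrow> l) (at_left s)"
proof -
  obtain s \<phi> where s: "s \<in> {0..K}" "strict_mono \<phi>" "(q \<circ> \<phi>) \<longlonglongrightarrow> s"
    using seq_compactE[OF compact_imp_seq_compact[OF compact_Icc[of 0 K]], of q] q by metis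
  show ?thesis
  proof (cases "infinite {n. s \<le> q (\<phi> n)}")
    case True
    then obtain \<psi> where \<psi>: "strict_mono (\<psi> :: nat \<Rightarrow> nat)" "\<And>n. s \<le> q (\<phi> (\<psi> n))"
      using infinite_enumerate[OF True] by blast
    have lim: "(\<lambda>n. q (\<phi> (\<psi> n))) \<longlonglongrightarrow> s"
      using LIMSEQ_subseq_LIMSEQ[OF s(3) \<psi>(1)] by (simp add: comp_def)
    have "(\<lambda>n. f (q (\<phi> (\<psi> n)))) \<longlonglongrightarrow> f s"
    proof (rule tendstoI)
      fix e :: real assume "0 < e"
      then obtain d where d: "0 < d" "\<And>v. s \<le> v \<Longrightarrow> v < s + d \<Longrightarrow> dist (f v) (f s) < e"
        using cadlag_right[OF f, of s e] s(1) by auto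
      have "\<forall>\<^sub>F n in sequentially. q (\<phi> (\<psi> n)) < s + d"
        using lim d(1) by (intro order_tendstoD) auto
      then show "\<forall>\<^sub>F n in sequentially. dist (f (q (\<phi> (\<psi> n)))) (f s) < e"
        by eventually_elim (use d(2) \<psi>(2) in auto)
    qed
    then show ?thesis
      using s \<psi> by (intro that[of s "\<phi> \<circ> \<psi>"]) (auto simp: strict_mono_o)
  next
    case False
    then have less: "\<forall>\<^sub>F n in sequentially. q (\<phi> n) < s"
      by (simp add: cofinite_eq_sequentially[symmetric] eventually_cofinite not_less)
    then obtain n where "q (\<phi> n) < s"
      using eventually_happens[of "\<lambda>n. q (\<phi> n) < s" sequentially] by auto
    then have "0 < s" using q[of "\<phi> n"] by auto
    obtain l where l: "(f \<longlongrightarrow> l) (at_left s)"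
      using f \<open>0 < s\<close> by (auto simp: cadlag_def)
    have "filterlim (\<lambda>n. q (\<phi> n)) (at_left s) sequentially"
      using s(3) less by (auto simp: filterlim_at comp_def elim: eventually_mono)
    then have "(\<lambda>n. f (q (\<phi> n))) \<longlonglongrightarrow> l"
      using l by (rule filterlim_compose[rotated])
    then show ?thesis
      using s l \<open>0 < s\<close> by (intro that[of s \<phi> l]) auto
  qed
qed

text \<open>This isolates the only way in which coming arbitrarily close to a point in bounded time
  differs from being there: the point may be a left limit that the path jumps away from.\<close>

lemma cadlag_accumulation:
  fixes f :: "real \<Rightarrow> 'a::euclidean_space"
  assumes f: "cadlag f" and acc: "\<And>e. 0 < e \<Longrightarrow> \<exists>q. 0 \<le> q \<and> q \<le> K \<and> dist (f q) w < e"
  obtains s where "s \<in> {0..K}" "w = f s \<or> 0 < s \<and> (f \<longlongrightarrow> w) (at_left s)"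
proof -
  have "\<forall>n. \<exists>q. 0 \<le> q \<and> q \<le> K \<and> dist (f q) w < inverse (Suc n)"
    using acc by simp
  then obtain q where q: "\<And>n. q n \<in> {0..K}" "\<And>n. dist (f (q n)) w < inverse (Suc n)"
    by (metis atLeastAtMost_iff)
  obtain s \<phi> l where s: "s \<in> {0..K}" "strict_mono \<phi>" "(\<lambda>n. f (q (\<phi> n))) \<longlonglongrightarrow> l"
    "l = f s \<or> 0 < s \<and> (f \<longlongrightarrow> l) (at_left s)"
    by (rule cadlag_seq_compact[OF f q(1)])
  have "(\<lambda>n. f (q n)) \<longlonglongrightarrow> w"
    unfolding tendsto_dist_iff[of _ w]
    by (rule Lim_null_comparison[OF always_eventually LIMSEQ_inverse_real_of_nat])
      (use q(2) in \<open>simp add: less_imp_le\<close>)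
  from LIMSEQ_subseq_LIMSEQ[OF this s(2)] s(3) have "l = w"
    by (auto simp: comp_def intro: LIMSEQ_unique)
  then show ?thesis using s that by auto
qed

text \<open>Times at which the norm exceeds \<open>n\<close> would have a subsequence with
  convergent, hence bounded, values.\<close>

lemma cadlag_bounded:
  fixes f :: "real \<Rightarrow> 'a::euclidean_space"
  assumes f: "cadlag f"
  shows "\<exists>n::nat. \<forall>q\<in>{0..K}. norm (f q) \<le> n"
proof (rule ccontr)
  assume "\<not> ?thesis"
  then have "\<forall>n::nat. \<exists>q\<in>{0..K}. n < norm (f q)" by (auto simp: not_le)
  then obtain q where q: "\<And>n::nat. q n \<in> {0..K}" "\<And>n. n < norm (f (q n))" by metis
  obtain t \<phi> l where "t \<in> {0..K}" and s: "strict_mono \<phi>" "(\<lambda>n. f (q (\<phi> n))) \<longlonglongrightarrow> l"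
    and "l = f t \<or> 0 < t \<and> (f \<longlongrightarrow> l) (at_left t)"
    by (rule cadlag_seq_compact[OF f q(1)])
  have "Bseq (\<lambda>n. f (q (\<phi> n)))"
    using s(2) by (intro convergent_imp_Bseq) (auto simp: convergent_def)
  then obtain B where B: "\<And>n. norm (f (q (\<phi> n))) \<le> B" by (auto simp: Bseq_def)
  obtain n :: nat where "B < n" using reals_Archimedean2 by blast
  also have "real n \<le> \<phi> n" using s(1) by (simp add: strict_mono_imp_increasing)
  also have "\<dots> < norm (f (q (\<phi> n)))" by (rule q(2))
  also have "\<dots> \<le> B" by (rule B)
  finally show False by simp
qed

text \<open>For a cadlag path and a dense set \<open>A\<close> of times this says that the path jumps, by at least
  \<open>r\<close>, from or to the point \<open>x\<close>; in this form it only involves countably many times.\<close>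

definition jump_touch :: "(real \<Rightarrow> 'a::metric_space) \<Rightarrow> real set \<Rightarrow> real \<Rightarrow> 'a \<Rightarrow> bool" where
  "jump_touch w A r x \<longleftrightarrow> (\<forall>m. \<exists>u\<in>A. \<exists>v\<in>A. u < v \<and> v - u < inverse (Suc m) \<and> r < dist (w u) (w v) \<and>
     (dist (w u) x < inverse (Suc m) \<or> dist (w v) x < inverse (Suc m)))"

lemma jump_touch_mono:
  assumes "jump_touch w A r x" "A \<subseteq> B" "r' \<le> r"
  shows "jump_touch w B r' x"
  unfolding jump_touch_def
proof
  fix m
  obtain u v where "u \<in> A" "v \<in> A" "u < v \<and> v - u < inverse (Suc m) \<and> r < dist (w u) (w v) \<and>
     (dist (w u) x < inverse (Suc m) \<or> dist (w v) x < inverse (Suc m))"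
    using assms(1) unfolding jump_touch_def by blast
  then show "\<exists>u\<in>B. \<exists>v\<in>B. u < v \<and> v - u < inverse (Suc m) \<and> r' < dist (w u) (w v) \<and>
     (dist (w u) x < inverse (Suc m) \<or> dist (w v) x < inverse (Suc m))"
    using assms(2,3) by (intro bexI[of _ u] bexI[of _ v]) auto
qed

text \<open>Every pair \<open>u\<close>, \<open>v\<close> from \<open>jump_touch\<close> straddles
  one of the finitely many times from \<open>cadlag_finite_jumps\<close>, and a single such time
  \<open>s\<close> serves all \<open>m\<close>. As \<open>u\<close> and \<open>v\<close> close in on
  \<open>s\<close> from the two sides, \<open>x\<close> can only be the left limit or the value
  there.\<close>

lemma finite_jump_touch:
  fixes f :: "real \<Rightarrow> 'a::euclidean_space"
  assumes f: "cadlag f" and "0 < r" and A: "A \<subseteq> {0..T}"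
  shows "finite {x. jump_touch f A r x}"
proof -
  obtain F where F: "finite F" "\<And>u v. 0 \<le> u \<Longrightarrow> u < v \<Longrightarrow> v \<le> T \<Longrightarrow> r \<le> dist (f u) (f v) \<Longrightarrow> \<exists>s\<in>F. u < s \<and> s \<le> v"
    using cadlag_finite_jumps[OF f \<open>0 < r\<close>, of T] by blast
  have "\<forall>s. \<exists>l. 0 < s \<longrightarrow> (\<forall>e>0. \<exists>d>0. \<forall>v. s - d < v \<and> v < s \<longrightarrow> dist (f v) l < e)"
    by (metis cadlag_left[OF f])
  then obtain L where L: "\<And>s e. 0 < s \<Longrightarrow> 0 < e \<Longrightarrow> \<exists>d>0. \<forall>v. s - d < v \<and> v < s \<longrightarrow> dist (f v) (L s) < e"
    by metis
  have "{x. jump_touch f A r x} \<subseteq> f ` F \<union> L ` F"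
  proof
    fix x assume "x \<in> {x. jump_touch f A r x}"
    then have x: "\<exists>u\<in>A. \<exists>v\<in>A. u < v \<and> v - u < inverse (Suc m) \<and> r < dist (f u) (f v) \<and>
     (dist (f u) x < inverse (Suc m) \<or> dist (f v) x < inverse (Suc m))" for m
      by (auto simp: jump_touch_def)
    define Q where "Q m s \<longleftrightarrow> (\<exists>u v. 0 \<le> u \<and> u < s \<and> s \<le> v \<and> v - u < inverse (Suc m) \<and>
       (dist (f u) x < inverse (Suc m) \<or> dist (f v) x < inverse (Suc m)))" for m s
    have Q: "\<exists>s\<in>F. Q m s" for m
    proof -
      obtain u v where uv: "u \<in> A" "v \<in> A" "u < v" "v - u < inverse (Suc m)" "r < dist (f u) (f v)"
        "dist (f u) x < inverse (Suc m) \<or> dist (f v) x < inverse (Suc m)"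
        using x[of m] by blast
      then have "0 \<le> u" "v \<le> T" using A by auto
      then obtain s where "s \<in> F" "u < s" "s \<le> v"
        using F(2)[of u v] uv by auto
      then show ?thesis
        unfolding Q_def using uv \<open>0 \<le> u\<close> by blast
    qed
    have Q_anti: "Q m s" if "Q n s" "m \<le> n" for m n s
    proof -
      have "inverse (real (Suc n)) \<le> inverse (real (Suc m))"
        using that(2) by (simp add: field_simps)
      then show ?thesis using that(1) unfolding Q_def by (meson less_le_trans)
    qed
    \<comment> \<open>Pigeonhole: if every \<open>s\<close> failed at some index, none would work at
      the maximum of these indices, as \<open>Q\<close> is antitone in \<open>m\<close>.\<close>
    have "\<exists>s\<in>F. \<forall>m. Q m s"
    proof (rule ccontr)
      assume "\<not> (\<exists>s\<in>F. \<forall>m. Q m s)"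
      then obtain m where m: "\<And>s. s \<in> F \<Longrightarrow> \<not> Q (m s) s" by metis
      obtain s where "s \<in> F" "Q (Max (m ` F)) s" using Q by blast
      then show False
        using m Q_anti[of "Max (m ` F)" s "m s"] F(1) by auto
    qed
    then obtain s where s: "s \<in> F" "\<And>m. Q m s" by blast
    have "0 < s" using s(2)[of 0] by (auto simp: Q_def)
    have close: "dist (L s) x < 2 * e \<or> dist (f s) x < 2 * e" if "0 < e" for e
    proof -
      obtain d1 where d1: "0 < d1" "\<And>v. s - d1 < v \<Longrightarrow> v < s \<Longrightarrow> dist (f v) (L s) < e"
        using L[OF \<open>0 < s\<close> \<open>0 < e\<close>] by blast
      obtain d2 where d2: "0 < d2" "\<And>v. s \<le> v \<Longrightarrow> v < s + d2 \<Longrightarrow> dist (f v) (f s) < e"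
        using cadlag_right[OF f _ \<open>0 < e\<close>, of s] \<open>0 < s\<close> by auto
      obtain m where m: "inverse (Suc m) < min e (min d1 d2)"
        using reals_Archimedean[of "min e (min d1 d2)"] \<open>0 < e\<close> d1(1) d2(1) by auto
      obtain u v where uv: "u < s" "s \<le> v" "v - u < inverse (Suc m)"
        "dist (f u) x < inverse (Suc m) \<or> dist (f v) x < inverse (Suc m)"
        using s(2)[of m] unfolding Q_def by blast
      then have "dist (f u) (L s) < e" "dist (f v) (f s) < e"
        using d1(2)[of u] d2(2)[of v] m by auto
      then show ?thesis
        using uv(4) m dist_triangle3[of "L s" x "f u"] dist_triangle3[of "f s" x "f v"] by auto
    qed
    have "x = L s \<or> x = f s"
    proof (rule ccontr)
      assume "\<not> (x = L s \<or> x = f s)"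
      then have "0 < min (dist (L s) x) (dist (f s) x) / 2" by auto
      from close[OF this] show False by auto
    qed
    then show "x \<in> f ` F \<union> L ` F" using s(1) by auto
  qed
  then show ?thesis using F(1) finite_subset by blast
qed

lemma jump_touchI:
  fixes f :: "real \<Rightarrow> 'a::euclidean_space"
  assumes f: "cadlag f" and s: "0 \<le> a" "a < s" "s < b"
    and l: "(f \<longlongrightarrow> l) (at_left s)" "l \<noteq> f s" and x: "x = l \<or> x = f s"
    and D: "\<And>u v. a \<le> u \<Longrightarrow> u < v \<Longrightarrow> v \<le> b \<Longrightarrow> \<exists>q\<in>D. u < q \<and> q < v"
  shows "\<exists>n::nat. jump_touch f D (inverse (Suc n)) x"
proof -
  \<comment> \<open>Half of the jump, so that errors below \<open>r/2\<close> at both ends still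
    leave a difference above \<open>r\<close>.\<close>
  define r where "r = dist l (f s) / 2"
  have "0 < r" using l(2) by (simp add: r_def)
  then obtain n where n: "inverse (real (Suc n)) < r" using reals_Archimedean by blast
  have "jump_touch f D r x"
    unfolding jump_touch_def
  proof
    fix m :: nat
    define i where "i = inverse (real (Suc m))"
    define e where "e = min i (r/2)"
    have "0 < i" "0 < e" using \<open>0 < r\<close> by (auto simp: e_def i_def)
    have "\<forall>\<^sub>F v in at_left s. dist (f v) l < e"
      using l(1) \<open>0 < e\<close> by (rule tendstoD)
    then obtain c where c: "c < s" "\<And>v. c < v \<Longrightarrow> v < s \<Longrightarrow> dist (f v) l < e"
      unfolding eventually_at_left_field by auto
    obtain d where d: "0 < d" "\<And>v. s \<le> v \<Longrightarrow> v < s + d \<Longrightarrow> dist (f v) (f s) < e"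
      using cadlag_right[OF f _ \<open>0 < e\<close>, of s] s by auto
    obtain u where u: "u \<in> D" "max a (max c (s - i/2)) < u" "u < s"
      using D[of "max a (max c (s - i/2))" s] s c \<open>0 < i\<close> by auto
    obtain v where v: "v \<in> D" "s < v" "v < min b (min (s + d) (s + i/2))"
      using D[of s "min b (min (s + d) (s + i/2))"] s d \<open>0 < i\<close> by auto
    have uv: "dist (f u) l < e" "dist (f v) (f s) < e"
      using c(2)[of u] d(2)[of v] u v by auto
    have "2 * r \<le> dist l (f u) + dist (f u) (f v) + dist (f v) (f s)"
      using dist_triangle[of l "f s" "f u"] dist_triangle[of "f u" "f s" "f v"] by (simp add: r_def)
    then have "r < dist (f u) (f v)"
      using uv \<open>0 < r\<close> by (simp add: dist_commute e_def)
    moreover have "dist (f u) x < i \<or> dist (f v) x < i"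
      using x uv by (auto simp: e_def)
    moreover have "v - u < i" using u v by simp
    ultimately show "\<exists>u\<in>D. \<exists>v\<in>D. u < v \<and> v - u < inverse (Suc m) \<and> r < dist (f u) (f v) \<and>
       (dist (f u) x < inverse (Suc m) \<or> dist (f v) x < inverse (Suc m))"
      using u v by (intro bexI[of _ u] bexI[of _ v]) (auto simp: i_def)
  qed
  then show ?thesis
    using jump_touch_mono[of f D r x D] n by (intro exI[of _ n]) auto
qed

section \<open>The Markov property\<close>

locale levy =
  fixes M :: "'w measure" and X :: "real \<Rightarrow> 'w \<Rightarrow> 'a::euclidean_space"
  assumes levy: "levy_process M X"

sublocale levy \<subseteq> prob_space M
  using levy by (simp add: levy_process_def)

context levy
begin

lemma X_measurable[measurable]: "0 \<le> t \<Longrightarrow> X t \<in> borel_measurable M"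
  using levy by (simp add: levy_process_def)

lemma AE_X_0: "AE \<omega> in M. X 0 \<omega> = 0"
  using levy by (simp add: levy_process_def)

lemma AE_cadlag: "AE \<omega> in M. cadlag (\<lambda>t. X t \<omega>)"
  using levy by (simp add: levy_process_def)

lemma indep_increments:
  fixes t :: "nat \<Rightarrow> real"
  assumes "0 \<le> t 0" "\<And>i. i < n \<Longrightarrow> t i < t (Suc i)"
  shows "indep_vars (\<lambda>_. borel) (\<lambda>i \<omega>. X (t (Suc i)) \<omega> - X (t i) \<omega>) {..<n}"
  using levy assms unfolding levy_process_def by blast

lemma distr_increment:
  assumes "0 \<le> s" "0 \<le> t"
  shows "distr M borel (\<lambda>\<omega>. X (s + t) \<omega> - X s \<omega>) = distr M borel (X t)"
  using levy assms unfolding levy_process_def by blast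

lemma distr_increments:
  fixes t :: "nat \<Rightarrow> real"
  assumes t: "0 \<le> t 0" "\<And>i. i < n \<Longrightarrow> t i < t (Suc i)"
  shows "distr M (\<Pi>\<^sub>M i\<in>{..<n}. borel) (\<lambda>\<omega>. \<lambda>i\<in>{..<n}. X (t (Suc i)) \<omega> - X (t i) \<omega>) =
    (\<Pi>\<^sub>M i\<in>{..<n}. distr M borel (X (t (Suc i) - t i)))"
proof -
  have t0: "0 \<le> t i" if "i \<le> n" for i
    using that
  proof (induction i)
    case (Suc i)
    then show ?case using t(2)[of i] by simp
  qed (use t in simp)
  have D: "distr M borel (\<lambda>\<omega>. X (t (Suc i)) \<omega> - X (t i) \<omega>) = distr M borel (X (t (Suc i) - t i))" if "i < n" for i
    using distr_increment[of "t i" "t (Suc i) - t i"] t0[of i] t(2)[of i] that by simp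
  show ?thesis
  \<comment> \<open>The product characterisation of independence used below is for nonempty index
    sets; over the empty one both sides are the unit mass on the only function.\<close>
  proof (cases "n = 0")
    case True
    show ?thesis
    proof (rule measure_eqI)
      fix A assume "A \<in> sets (distr M (\<Pi>\<^sub>M i\<in>{..<n}. borel) (\<lambda>\<omega>. \<lambda>i\<in>{..<n}. X (t (Suc i)) \<omega> - X (t i) \<omega>))"
      then have "A = {} \<or> A = {\<lambda>_. undefined}"
        using True by (simp add: sets_PiM_empty)
      then show "emeasure (distr M (\<Pi>\<^sub>M i\<in>{..<n}. borel) (\<lambda>\<omega>. \<lambda>i\<in>{..<n}. X (t (Suc i)) \<omega> - X (t i) \<omega>)) A =
        emeasure (\<Pi>\<^sub>M i\<in>{..<n}. distr M borel (X (t (Suc i) - t i))) A"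
        using True by (auto simp: emeasure_distr sets_PiM_empty restrict_def emeasure_space_1)
    qed (use True in \<open>simp add: sets_PiM_empty\<close>)
  next
    case False
    have "distr M (\<Pi>\<^sub>M i\<in>{..<n}. borel) (\<lambda>\<omega>. \<lambda>i\<in>{..<n}. X (t (Suc i)) \<omega> - X (t i) \<omega>) =
      (\<Pi>\<^sub>M i\<in>{..<n}. distr M borel (\<lambda>\<omega>. X (t (Suc i)) \<omega> - X (t i) \<omega>))"
      using indep_increments[of t n] t False t0
      by (subst indep_vars_iff_distr_eq_PiM'[symmetric]) (auto intro!: borel_measurable_diff X_measurable)
    also have "\<dots> = (\<Pi>\<^sub>M i\<in>{..<n}. distr M borel (X (t (Suc i) - t i)))"
      using D by (intro PiM_cong) auto
    finally show ?thesis .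
  qed
qed

text \<open>\<open>restrict\<close> yields extensional functions, the points of the product space.
  The index sets are uncountable, so a measurable event of this space depends on countably many
  times only; this is why path events are phrased through rational times.\<close>

definition past :: "real \<Rightarrow> 'w \<Rightarrow> real \<Rightarrow> 'a" where
  "past a \<omega> = (\<lambda>u\<in>{0..a}. X u \<omega>)"

definition future :: "real \<Rightarrow> 'w \<Rightarrow> real \<Rightarrow> 'a" where
  "future a \<omega> = (\<lambda>v\<in>{0..}. X (a + v) \<omega> - X a \<omega>)"

lemma past_measurable[measurable]: "past a \<in> measurable M (\<Pi>\<^sub>M u\<in>{0..a}. borel)"
  unfolding past_def[abs_def] by (intro measurable_restrict) auto

lemma future_measurable[measurable]: "0 \<le> a \<Longrightarrow> future a \<in> measurable M (\<Pi>\<^sub>M v\<in>{0..}. borel)"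
  unfolding future_def[abs_def] by (intro measurable_restrict) (auto intro!: borel_measurable_diff X_measurable)

text \<open>All times are put on one grid containing \<open>a\<close>. The past is then a function
  of the increments before the grid point \<open>a\<close> and the future one of those after it, so
  independence of the increments separates them.\<close>

lemma finite_times:
  assumes "0 \<le> a" "finite J" "J \<subseteq> {0..a}" "finite K" "K \<subseteq> {0..}"
  shows indep_finite_times:
    "indep_var (\<Pi>\<^sub>M u\<in>J. borel) (\<lambda>\<omega>. \<lambda>u\<in>J. X u \<omega>) (\<Pi>\<^sub>M v\<in>K. borel) (\<lambda>\<omega>. \<lambda>v\<in>K. X (a + v) \<omega> - X a \<omega>)"
    and distr_finite_times:
    "distr M (\<Pi>\<^sub>M v\<in>K. borel) (\<lambda>\<omega>. \<lambda>v\<in>K. X (a + v) \<omega> - X a \<omega>) =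
     distr M (\<Pi>\<^sub>M v\<in>K. borel) (\<lambda>\<omega>. \<lambda>v\<in>K. X v \<omega> - X 0 \<omega>)"
proof -
  \<comment> \<open>With \<open>0\<close> in the grid the sums telescope from time 0; with
    \<open>a\<close> in it the increments split exactly there.\<close>
  define T where "T = {0, a} \<union> J \<union> (+) a ` K"
  have T: "finite T" "T \<subseteq> {0..}" "0 \<in> T" "a \<in> T"
    using assms by (auto simp: T_def)
  define l where "l = sorted_list_of_set T"
  have l: "set l = T" "sorted_wrt (<) l"
    using T(1) by (simp_all add: l_def)
  define t where "t i = l ! i" for i
  define n where "n = length l - 1"
  have len: "length l = Suc n"
    using T(3) l(1) by (cases l) (auto simp: n_def)
  have t_less: "t i < t j" if "i < j" "j \<le> n" for i j
    using sorted_wrt_nth_less[OF l(2), of i j] that len by (simp add: t_def)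
  have t_le: "t i \<le> t j" if "i \<le> j" "j \<le> n" for i j
    using t_less[of i j] that by (cases "i = j") auto
  have t_T: "t i \<in> T" if "i \<le> n" for i
    using that len l(1) nth_mem[of i l] by (simp add: t_def)
  have "\<forall>u\<in>T. \<exists>i\<le>n. t i = u"
  proof
    fix u assume "u \<in> T"
    then obtain i where "i < length l" "l ! i = u"
      using l(1) in_set_conv_nth[of u l] by auto
    then show "\<exists>i\<le>n. t i = u"
      using len by (intro exI[of _ i]) (auto simp: t_def)
  qed
  then obtain idx where idx: "\<And>u. u \<in> T \<Longrightarrow> idx u \<le> n \<and> t (idx u) = u"
    by metis
  have idx_mono: "idx u \<le> idx v" if "u \<le> v" "u \<in> T" "v \<in> T" for u v
    using t_less[of "idx v" "idx u"] idx[OF that(2)] idx[OF that(3)] that(1) by force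
  have t0: "t 0 = 0"
    using t_le[of 0 "idx 0"] idx[OF T(3)] t_T[of 0] T(2) by auto
  have t_nonneg: "0 \<le> t i" if "i \<le> n" for i
    using t_le[of 0 i] that t0 by simp
  define k where "k = idx a"
  have k: "k \<le> n" "t k = a" using idx[OF T(4)] by (auto simp: k_def)
  define \<xi> where "\<xi> i \<omega> = X (t (Suc i)) \<omega> - X (t i) \<omega>" for i \<omega>
  have indep: "indep_vars (\<lambda>_. borel) \<xi> {..<n}"
    using indep_increments[of t n] t0 t_less unfolding \<xi>_def by simp
  define f where "f p = (\<lambda>u\<in>J. \<Sum>i<idx u. p i :: 'a)" for p
  define g where "g p = (\<lambda>v\<in>K. \<Sum>i=k..<idx (a + v). p i :: 'a)" for p
  have J_idx: "idx u \<le> k" "t (idx u) = u" "u \<in> T" if "u \<in> J" for u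
    using idx_mono[of u a] idx[of u] that assms by (auto simp: k_def T_def)
  have K_idx: "k \<le> idx (a + v)" "t (idx (a + v)) = a + v" "idx (a + v) \<le> n" if "v \<in> K" for v
    using idx_mono[of a "a + v"] idx[of "a + v"] that assms by (auto simp: k_def T_def)
  have f_meas: "f \<in> measurable (\<Pi>\<^sub>M i\<in>{..<k}. borel) (\<Pi>\<^sub>M u\<in>J. borel)"
    unfolding f_def[abs_def] using J_idx
    by (intro measurable_restrict borel_measurable_sum measurable_component_singleton) fastforce
  have g_meas: "g \<in> measurable (\<Pi>\<^sub>M i\<in>{k..<n}. borel) (\<Pi>\<^sub>M u\<in>K. borel)"
    unfolding g_def[abs_def] using K_idx
    by (intro measurable_restrict borel_measurable_sum measurable_component_singleton) fastforce
  have f_eq: "f (restrict (\<lambda>i. \<xi> i \<omega>) {..<k}) = (\<lambda>u\<in>J. X u \<omega> - X 0 \<omega>)" for \<omega>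
    unfolding f_def
  proof (rule restrict_ext)
    fix u assume u: "u \<in> J"
    have "(\<Sum>i<idx u. restrict (\<lambda>i. \<xi> i \<omega>) {..<k} i) = (\<Sum>i<idx u. \<xi> i \<omega>)"
      using J_idx(1)[OF u] by (intro sum.cong) auto
    also have "\<dots> = X (t (idx u)) \<omega> - X (t 0) \<omega>"
      unfolding \<xi>_def by (rule sum_lessThan_telescope)
    finally show "(\<Sum>i<idx u. restrict (\<lambda>i. \<xi> i \<omega>) {..<k} i) = X u \<omega> - X 0 \<omega>"
      using J_idx(2)[OF u] t0 by simp
  qed
  have g_eq: "g (restrict (\<lambda>i. \<xi> i \<omega>) {k..<n}) = (\<lambda>v\<in>K. X (a + v) \<omega> - X a \<omega>)" for \<omega>
    unfolding g_def
  proof (rule restrict_ext)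
    fix v assume v: "v \<in> K"
    have "(\<Sum>i=k..<idx (a + v). restrict (\<lambda>i. \<xi> i \<omega>) {k..<n} i) = (\<Sum>i=k..<idx (a + v). \<xi> i \<omega>)"
      using K_idx(3)[OF v] by (intro sum.cong) auto
    also have "\<dots> = X (t (idx (a + v))) \<omega> - X (t k) \<omega>"
      unfolding \<xi>_def using K_idx(1)[OF v] by (rule sum_Suc_diff')
    finally show "(\<Sum>i=k..<idx (a + v). restrict (\<lambda>i. \<xi> i \<omega>) {k..<n} i) = X (a + v) \<omega> - X a \<omega>"
      using K_idx(2)[OF v] k by simp
  qed
  have indep0: "indep_var (\<Pi>\<^sub>M u\<in>J. borel) (\<lambda>\<omega>. \<lambda>u\<in>J. X u \<omega> - X 0 \<omega>)
    (\<Pi>\<^sub>M v\<in>K. borel) (\<lambda>\<omega>. \<lambda>v\<in>K. X (a + v) \<omega> - X a \<omega>)"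
  proof -
    have "{..<k} \<inter> {k..<n} = {}" "{..<k} \<subseteq> {..<n}" "{k..<n} \<subseteq> {..<n}"
      using k(1) by auto
    from indep_var_compose[OF indep_var_restrict[OF indep this] f_meas g_meas]
    show ?thesis by (simp add: comp_def f_eq g_eq)
  qed
  have meas_J: "(\<lambda>\<omega>. \<lambda>u\<in>J. X u \<omega>) \<in> measurable M (\<Pi>\<^sub>M u\<in>J. borel)"
    using assms by (intro measurable_restrict X_measurable) auto
  have meas_J0: "(\<lambda>\<omega>. \<lambda>u\<in>J. X u \<omega> - X 0 \<omega>) \<in> measurable M (\<Pi>\<^sub>M u\<in>J. borel)"
    using assms by (intro measurable_restrict borel_measurable_diff X_measurable) auto
  have meas_K: "(\<lambda>\<omega>. \<lambda>v\<in>K. X (a + v) \<omega> - X a \<omega>) \<in> measurable M (\<Pi>\<^sub>M u\<in>K. borel)"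
    using assms by (intro measurable_restrict borel_measurable_diff X_measurable) auto
  \<comment> \<open>\<open>X 0\<close> vanishes only almost surely. The past therefore enters
    through increments from time 0 and is exchanged for the path itself by equality of laws.\<close>
  have AE_J: "AE \<omega> in M. (\<lambda>u\<in>J. X u \<omega>) = (\<lambda>u\<in>J. X u \<omega> - X 0 \<omega>)"
    using AE_X_0 by eventually_elim simp
  show "indep_var (\<Pi>\<^sub>M u\<in>J. borel) (\<lambda>\<omega>. \<lambda>u\<in>J. X u \<omega>) (\<Pi>\<^sub>M v\<in>K. borel) (\<lambda>\<omega>. \<lambda>v\<in>K. X (a + v) \<omega> - X a \<omega>)"
    unfolding indep_var_distribution_eq
  proof (intro conjI meas_J meas_K)
    have "distr M (\<Pi>\<^sub>M u\<in>J. borel) (\<lambda>\<omega>. \<lambda>u\<in>J. X u \<omega>) = distr M (\<Pi>\<^sub>M u\<in>J. borel) (\<lambda>\<omega>. \<lambda>u\<in>J. X u \<omega> - X 0 \<omega>)"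
      using AE_J meas_J meas_J0 by (intro distr_cong_AE) auto
    moreover have "distr M ((\<Pi>\<^sub>M u\<in>J. borel) \<Otimes>\<^sub>M (\<Pi>\<^sub>M v\<in>K. borel)) (\<lambda>\<omega>. (\<lambda>u\<in>J. X u \<omega>, \<lambda>v\<in>K. X (a + v) \<omega> - X a \<omega>)) =
      distr M ((\<Pi>\<^sub>M u\<in>J. borel) \<Otimes>\<^sub>M (\<Pi>\<^sub>M v\<in>K. borel)) (\<lambda>\<omega>. (\<lambda>u\<in>J. X u \<omega> - X 0 \<omega>, \<lambda>v\<in>K. X (a + v) \<omega> - X a \<omega>))"
      using AE_J by (intro distr_cong_AE measurable_Pair meas_J meas_J0 meas_K) auto
    ultimately show "distr M (\<Pi>\<^sub>M u\<in>J. borel) (\<lambda>\<omega>. \<lambda>u\<in>J. X u \<omega>) \<Otimes>\<^sub>M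
        distr M (\<Pi>\<^sub>M v\<in>K. borel) (\<lambda>\<omega>. \<lambda>v\<in>K. X (a + v) \<omega> - X a \<omega>) =
      distr M ((\<Pi>\<^sub>M u\<in>J. borel) \<Otimes>\<^sub>M (\<Pi>\<^sub>M v\<in>K. borel)) (\<lambda>\<omega>. (\<lambda>u\<in>J. X u \<omega>, \<lambda>v\<in>K. X (a + v) \<omega> - X a \<omega>))"
      using indep0 unfolding indep_var_distribution_eq by simp
  qed
  define m where "m = n - k"
  define h where "h p = (\<lambda>v\<in>K. \<Sum>i<idx (a + v) - k. p i :: 'a)" for p
  have h_meas: "h \<in> measurable (\<Pi>\<^sub>M i\<in>{..<m}. borel) (\<Pi>\<^sub>M u\<in>K. borel)"
    unfolding h_def[abs_def] using K_idx k(1)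
    by (intro measurable_restrict borel_measurable_sum measurable_component_singleton)
       (fastforce simp: m_def)
  have h_eq: "h (\<lambda>i\<in>{..<m}. X (s (Suc i)) \<omega> - X (s i) \<omega>) = (\<lambda>v\<in>K. X (b + v) \<omega> - X b \<omega>)"
    if s: "\<And>i. i \<le> m \<Longrightarrow> s i = t (k + i) - a + b" for s b \<omega>
    unfolding h_def
  proof (rule restrict_ext)
    fix v assume v: "v \<in> K"
    have le: "idx (a + v) - k \<le> m"
      using K_idx[OF v] by (simp add: m_def)
    have "(\<Sum>i<idx (a + v) - k. (\<lambda>i\<in>{..<m}. X (s (Suc i)) \<omega> - X (s i) \<omega>) i) =
      (\<Sum>i<idx (a + v) - k. X (s (Suc i)) \<omega> - X (s i) \<omega>)"
      using le by (intro sum.cong) auto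
    also have "\<dots> = X (s (idx (a + v) - k)) \<omega> - X (s 0) \<omega>"
      by (rule sum_lessThan_telescope)
    finally show "(\<Sum>i<idx (a + v) - k. (\<lambda>i\<in>{..<m}. X (s (Suc i)) \<omega> - X (s i) \<omega>) i) = X (b + v) \<omega> - X b \<omega>"
      using s[OF le] s[of 0] K_idx[OF v] k by (simp add: add.commute)
  qed
  \<comment> \<open>The right-hand side does not mention \<open>b\<close>: moving the grid keeps the
    lengths of its steps, and by stationarity the laws of the increments. The instances
    \<open>b = a\<close> and \<open>b = 0\<close> give the claim.\<close>
  have law: "distr M (\<Pi>\<^sub>M v\<in>K. borel) (\<lambda>\<omega>. \<lambda>v\<in>K. X (b + v) \<omega> - X b \<omega>) =
    distr (\<Pi>\<^sub>M i\<in>{..<m}. distr M borel (X (t (k + Suc i) - t (k + i)))) (\<Pi>\<^sub>M v\<in>K. borel) h" if "0 \<le> b" for b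
  proof -
    define s where "s i = t (k + i) - a + b" for i
    have s0: "0 \<le> s i" if "i \<le> m" for i
      using t_le[of k "k + i"] that k \<open>0 \<le> b\<close> by (simp add: s_def m_def)
    have s: "0 \<le> s 0" "\<And>i. i < m \<Longrightarrow> s i < s (Suc i)"
      using s0[of 0] t_less k by (auto simp: s_def m_def)
    have meas: "(\<lambda>\<omega>. \<lambda>i\<in>{..<m}. X (s (Suc i)) \<omega> - X (s i) \<omega>) \<in> measurable M (\<Pi>\<^sub>M i\<in>{..<m}. borel)"
      using s0 by (intro measurable_restrict borel_measurable_diff X_measurable) auto
    have "distr M (\<Pi>\<^sub>M v\<in>K. borel) (\<lambda>\<omega>. \<lambda>v\<in>K. X (b + v) \<omega> - X b \<omega>) =
      distr M (\<Pi>\<^sub>M v\<in>K. borel) (\<lambda>\<omega>. h (\<lambda>i\<in>{..<m}. X (s (Suc i)) \<omega> - X (s i) \<omega>))"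
      using h_eq[of s b] by (simp add: s_def)
    also have "\<dots> = distr (distr M (\<Pi>\<^sub>M i\<in>{..<m}. borel) (\<lambda>\<omega>. \<lambda>i\<in>{..<m}. X (s (Suc i)) \<omega> - X (s i) \<omega>)) (\<Pi>\<^sub>M v\<in>K. borel) h"
      by (subst distr_distr[OF h_meas meas]) (simp add: comp_def)
    also have "\<dots> = distr (\<Pi>\<^sub>M i\<in>{..<m}. distr M borel (X (s (Suc i) - s i))) (\<Pi>\<^sub>M v\<in>K. borel) h"
      by (subst distr_increments[OF s]) auto
    finally show ?thesis
      by (simp add: s_def)
  qed
  show "distr M (\<Pi>\<^sub>M v\<in>K. borel) (\<lambda>\<omega>. \<lambda>v\<in>K. X (a + v) \<omega> - X a \<omega>) =
     distr M (\<Pi>\<^sub>M v\<in>K. borel) (\<lambda>\<omega>. \<lambda>v\<in>K. X v \<omega> - X 0 \<omega>)"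
    using law[of a] law[of 0] assms(1) by simp
qed

lemma distr_future:
  assumes "0 \<le> a"
  shows "distr M (\<Pi>\<^sub>M v\<in>{0..}. borel) (future a) = distr M (\<Pi>\<^sub>M v\<in>{0..}. borel) (future 0)"
proof (rule measure_eqI_PiM_infinite)
  show "finite_measure (distr M (\<Pi>\<^sub>M v\<in>{0..}. borel) (future a))"
    using assms by (intro prob_space.finite_measure prob_space_distr future_measurable)
  fix A :: "real \<Rightarrow> 'a set" and J :: "real set"
  assume J: "finite J" "J \<subseteq> {0..}" and A: "\<And>i. i \<in> J \<Longrightarrow> A i \<in> sets borel"
  have eq: "emeasure (distr M (\<Pi>\<^sub>M v\<in>{0..}. borel) (future b)) (prod_emb {0..} (\<lambda>_. borel) J (Pi\<^sub>E J A)) =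
    emeasure (distr M (\<Pi>\<^sub>M v\<in>J. borel) (\<lambda>\<omega>. \<lambda>v\<in>J. X (b + v) \<omega> - X b \<omega>)) (Pi\<^sub>E J A)" if "0 \<le> b" for b
  proof -
    have m: "(\<lambda>\<omega>. \<lambda>v\<in>J. X (b + v) \<omega> - X b \<omega>) \<in> measurable M (\<Pi>\<^sub>M v\<in>J. borel)"
      using that J by (intro measurable_restrict borel_measurable_diff X_measurable) auto
    have "future b -` prod_emb {0..} (\<lambda>_. borel) J (Pi\<^sub>E J A) \<inter> space M =
      (\<lambda>\<omega>. \<lambda>v\<in>J. X (b + v) \<omega> - X b \<omega>) -` Pi\<^sub>E J A \<inter> space M"
      using J(2) by (auto simp: prod_emb_iff future_def PiE_iff subset_eq)
    then show ?thesis
      using that J A m by (subst (1 2) emeasure_distr) (auto intro!: sets_PiM_I sets_PiM_I_finite)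
  qed
  show "emeasure (distr M (\<Pi>\<^sub>M v\<in>{0..}. borel) (future a)) (prod_emb {0..} (\<lambda>_. borel) J (Pi\<^sub>E J A)) =
    emeasure (distr M (\<Pi>\<^sub>M v\<in>{0..}. borel) (future 0)) (prod_emb {0..} (\<lambda>_. borel) J (Pi\<^sub>E J A))"
    using assms distr_finite_times[OF assms, of "{}" J] J by (simp add: eq)
qed simp_all

text \<open>Both sigma-algebras are generated by preimages of cylinders, which are closed under
  intersection; on cylinders only finitely many times are involved.\<close>

lemma indep_past_future:
  assumes a: "0 \<le> a"
  shows "indep_var (\<Pi>\<^sub>M u\<in>{0..a}. borel) (past a) (\<Pi>\<^sub>M v\<in>{0..}. borel) (future a)"
proof -
  have sig: "sigma_sets (space M) {f -` A \<inter> space M | A. A \<in> sets (\<Pi>\<^sub>M i\<in>I. borel)} =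
      sigma_sets (space M) {f -` A \<inter> space M | A. A \<in> prod_algebra I (\<lambda>_. borel)}"
    if "f \<in> measurable M (\<Pi>\<^sub>M i\<in>I. (borel :: 'a measure))" for f and I :: "real set"
  proof -
    have "f \<in> space M \<rightarrow> (\<Pi>\<^sub>E i\<in>I. space (borel :: 'a measure))"
      using measurable_space[OF that] by (auto simp: space_PiM)
    note eq = sigma_sets_vimage_commute[OF this]
    show ?thesis
      unfolding sets_PiM eq by (rule sigma_sets_sigma_sets_eq) auto
  qed
  have stable: "Int_stable {f -` A \<inter> space M | A. A \<in> prod_algebra I (\<lambda>_. borel :: 'a measure)}"
    for f :: "'w \<Rightarrow> real \<Rightarrow> 'a" and I :: "real set"
    unfolding Int_stable_def
  proof safe
    fix A B assume "A \<in> prod_algebra I (\<lambda>_. borel :: 'a measure)" "B \<in> prod_algebra I (\<lambda>_. borel :: 'a measure)"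
    then have "A \<inter> B \<in> prod_algebra I (\<lambda>_. borel :: 'a measure)"
      using Int_stable_prod_algebra by (auto simp: Int_stable_def)
    then show "\<exists>C. (f -` A \<inter> space M) \<inter> (f -` B \<inter> space M) = f -` C \<inter> space M \<and> C \<in> prod_algebra I (\<lambda>_. borel :: 'a measure)"
      by (intro exI[of _ "A \<inter> B"]) auto
  qed
  show ?thesis
    unfolding indep_var_eq sig[OF past_measurable] sig[OF future_measurable[OF a]]
  proof (intro conjI indep_set_sigma_sets stable past_measurable future_measurable[OF a] indep_setI)
    show "{past a -` A \<inter> space M | A. A \<in> prod_algebra {0..a} (\<lambda>_. borel)} \<subseteq> events"
      using measurable_sets[OF past_measurable[of a]] by (auto simp: sets_PiM)
    show "{future a -` A \<inter> space M | A. A \<in> prod_algebra {0..} (\<lambda>_. borel)} \<subseteq> events"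
      using measurable_sets[OF future_measurable[OF a]] by (auto simp: sets_PiM)
    fix A B assume "A \<in> {past a -` A \<inter> space M | A. A \<in> prod_algebra {0..a} (\<lambda>_. borel)}"
      "B \<in> {future a -` A \<inter> space M | A. A \<in> prod_algebra {0..} (\<lambda>_. borel)}"
    then obtain A' B' where AB: "A = past a -` A' \<inter> space M" "B = future a -` B' \<inter> space M"
      "A' \<in> prod_algebra {0..a} (\<lambda>_. borel)" "B' \<in> prod_algebra {0..} (\<lambda>_. borel)"
      by auto
    obtain J E where J: "A' = prod_emb {0..a} (\<lambda>_. borel) J (Pi\<^sub>E J E)" "finite J" "J \<subseteq> {0..a}"
      "\<And>i. i \<in> J \<Longrightarrow> E i \<in> sets borel"
      using AB(3) by (rule prod_algebraE) blast
    obtain K G where K: "B' = prod_emb {0..} (\<lambda>_. borel) K (Pi\<^sub>E K G)" "finite K" "K \<subseteq> {0..}"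
      "\<And>i. i \<in> K \<Longrightarrow> G i \<in> sets borel"
      using AB(4) by (rule prod_algebraE) blast
    have A: "A = (\<lambda>\<omega>. \<lambda>u\<in>J. X u \<omega>) -` Pi\<^sub>E J E \<inter> space M"
      using J(3) by (auto simp: AB J(1) prod_emb_iff past_def PiE_iff subset_eq)
    have B: "B = (\<lambda>\<omega>. \<lambda>v\<in>K. X (a + v) \<omega> - X a \<omega>) -` Pi\<^sub>E K G \<inter> space M"
      using K(3) by (auto simp: AB K(1) prod_emb_iff future_def PiE_iff subset_eq)
    have "A \<inter> B = (\<lambda>\<omega>. (\<lambda>u\<in>J. X u \<omega>, \<lambda>v\<in>K. X (a + v) \<omega> - X a \<omega>)) -` (Pi\<^sub>E J E \<times> Pi\<^sub>E K G) \<inter> space M"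
      by (auto simp: A B)
    then show "prob (A \<inter> B) = prob A * prob B"
      using indep_varD[OF indep_finite_times[OF a J(2,3) K(2,3)], of "Pi\<^sub>E J E" "Pi\<^sub>E K G"] J K A B
      by (simp add: sets_PiM_I_finite)
  qed
qed

text \<open>The natural filtration at time \<open>a\<close>, without completion.\<close>

abbreviation "history a \<equiv> vimage_algebra (space M) (past a) (\<Pi>\<^sub>M u\<in>{0..a}. borel)"

lemma X_history: "0 \<le> u \<Longrightarrow> u \<le> a \<Longrightarrow> X u \<in> borel_measurable (history a)"
proof -
  assume u: "0 \<le> u" "u \<le> a"
  have "(\<lambda>\<omega>. past a \<omega> u) \<in> borel_measurable (history a)"
  proof (rule measurable_compose[OF measurable_vimage_algebra1 measurable_component_singleton])
    show "past a \<in> space M \<rightarrow> space (\<Pi>\<^sub>M u\<in>{0..a}. borel)"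
      using measurable_space[OF past_measurable[of a]] by auto
  qed (use u in auto)
  then show ?thesis using u by (simp add: past_def)
qed

lemma history_events: "B \<in> sets (history a) \<Longrightarrow> B \<in> sets M"
  using sets_vimage_algebra2[of "past a" "space M" "\<Pi>\<^sub>M u\<in>{0..a}. borel"]
    measurable_sets[OF past_measurable[of a]] measurable_space[OF past_measurable[of a]] by auto

lemma history_mono:
  assumes B: "B \<in> sets (history a)" and "a \<le> b"
  shows "B \<in> sets (history b)"
proof -
  have *: "past c \<in> space M \<rightarrow> space (\<Pi>\<^sub>M u\<in>{0..c}. borel)" for c
    using measurable_space[OF past_measurable[of c]] by auto
  have "past a = (\<lambda>\<omega>. restrict (past b \<omega>) {0..a})"
    using \<open>a \<le> b\<close> by (auto simp: past_def fun_eq_iff restrict_def)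
  then have "past a \<in> measurable (history b) (\<Pi>\<^sub>M u\<in>{0..a}. borel)"
    using measurable_compose[OF measurable_vimage_algebra1[OF *] measurable_restrict_subset[of "{0..a}" "{0..b}"]] \<open>a \<le> b\<close>
    by auto
  then show ?thesis
    using B measurable_sets[of "past a" "history b"] sets_vimage_algebra2[OF *] by auto
qed

text \<open>The joint law of past and future is a product, so the future can be integrated out for a
  fixed past, of which \<open>X a\<close> is a coordinate. The fresh copy of the path is
  \<open>future 0\<close>, which starts exactly at 0, unlike \<open>X\<close> itself.\<close>

lemma markov:
  assumes a: "0 \<le> a" and B: "B \<in> sets (history a)"
    and \<Psi>: "Measurable.pred (borel \<Otimes>\<^sub>M (\<Pi>\<^sub>M v\<in>{0..}. borel)) \<Psi>"
  shows "emeasure M {\<omega>\<in>B. \<Psi> (X a \<omega>, future a \<omega>)} =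
    (\<integral>\<^sup>+\<omega>. emeasure M {\<omega>'\<in>space M. \<Psi> (X a \<omega>, future 0 \<omega>')} * indicator B \<omega> \<partial>M)"
proof -
  let ?P = "\<Pi>\<^sub>M u\<in>{0..a}. (borel :: 'a measure)" and ?F = "\<Pi>\<^sub>M v\<in>{0..}. (borel :: 'a measure)"
  have "past a \<in> space M \<rightarrow> space ?P"
    using measurable_space[OF past_measurable[of a]] by auto
  then obtain A where A: "A \<in> sets ?P" "B = past a -` A \<inter> space M"
    using B sets_vimage_algebra2[of "past a" "space M" ?P] by auto
  define S where "S = {(p, z). p \<in> A \<and> \<Psi> (p a, z)} \<inter> space (?P \<Otimes>\<^sub>M ?F)"
  have \<Psi>': "Measurable.pred (?P \<Otimes>\<^sub>M ?F) (\<lambda>(p, z). \<Psi> (p a, z))"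
  proof -
    have "(\<lambda>(p, z). (p a, z)) \<in> measurable (?P \<Otimes>\<^sub>M ?F) (borel \<Otimes>\<^sub>M ?F)"
      unfolding split_beta'
      using a by (intro measurable_Pair measurable_compose[OF measurable_fst measurable_component_singleton]) auto
    from measurable_compose[OF this \<Psi>] show ?thesis by (simp add: split_beta')
  qed
  have S: "S \<in> sets (?P \<Otimes>\<^sub>M ?F)"
  proof -
    have "S = {x \<in> space (?P \<Otimes>\<^sub>M ?F). fst x \<in> A \<and> (\<lambda>(p, z). \<Psi> (p a, z)) x}"
      by (auto simp: S_def)
    also have "\<dots> \<in> sets (?P \<Otimes>\<^sub>M ?F)"
      using A(1) \<Psi>' by measurable
    finally show ?thesis .
  qed
  interpret F: prob_space "distr M ?F (future 0)"
    by (intro prob_space_distr future_measurable) simp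
  have pair: "(\<lambda>\<omega>. (past a \<omega>, future a \<omega>)) \<in> measurable M (?P \<Otimes>\<^sub>M ?F)"
    using a by measurable
  have "{\<omega>\<in>B. \<Psi> (X a \<omega>, future a \<omega>)} = (\<lambda>\<omega>. (past a \<omega>, future a \<omega>)) -` S \<inter> space M"
    using a measurable_space[OF pair] by (auto simp: A(2) S_def past_def)
  then have "emeasure M {\<omega>\<in>B. \<Psi> (X a \<omega>, future a \<omega>)} =
      emeasure (distr M (?P \<Otimes>\<^sub>M ?F) (\<lambda>\<omega>. (past a \<omega>, future a \<omega>))) S"
    by (simp add: emeasure_distr[OF pair S])
  also have "\<dots> = emeasure (distr M ?P (past a) \<Otimes>\<^sub>M distr M ?F (future 0)) S"
    using indep_past_future[OF a] unfolding indep_var_distribution_eq by (simp add: distr_future[OF a])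
  also have "\<dots> = (\<integral>\<^sup>+p. emeasure (distr M ?F (future 0)) (Pair p -` S) \<partial>distr M ?P (past a))"
    using S by (intro F.emeasure_pair_measure_alt) simp
  also have "\<dots> = (\<integral>\<^sup>+\<omega>. emeasure (distr M ?F (future 0)) (Pair (past a \<omega>) -` S) \<partial>M)"
    using S F.measurable_emeasure_Pair[of S ?P] by (intro nn_integral_distr) auto
  also have "\<dots> = (\<integral>\<^sup>+\<omega>. emeasure M {\<omega>'\<in>space M. \<Psi> (X a \<omega>, future 0 \<omega>')} * indicator B \<omega> \<partial>M)"
  proof (rule nn_integral_cong)
    fix \<omega> assume \<omega>: "\<omega> \<in> space M"
    have "emeasure (distr M ?F (future 0)) (Pair (past a \<omega>) -` S) = emeasure M (future 0 -` (Pair (past a \<omega>) -` S) \<inter> space M)"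
      using S by (intro emeasure_distr future_measurable sets_Pair1) auto
    also have "future 0 -` (Pair (past a \<omega>) -` S) \<inter> space M =
      (if \<omega> \<in> B then {\<omega>'\<in>space M. \<Psi> (X a \<omega>, future 0 \<omega>')} else {})"
      using \<omega> a measurable_space[OF past_measurable[of a]] measurable_space[OF future_measurable[of 0]]
      by (auto simp: A(2) S_def past_def space_pair_measure)
    finally show "emeasure (distr M ?F (future 0)) (Pair (past a \<omega>) -` S) =
      emeasure M {\<omega>'\<in>space M. \<Psi> (X a \<omega>, future 0 \<omega>')} * indicator B \<omega>"
      by simp
  qed
  finally show ?thesis .
qed

end

text \<open>Infinitely many events of probability at least \<open>e\<close> occur infinitely often
  with probability at least \<open>e\<close>, by continuity from above.\<close>

lemma (in prob_space) finite_large_events: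
  assumes S[measurable]: "\<And>c. S c \<in> events" and fin: "AE \<omega> in M. finite {c. \<omega> \<in> S c}" and "0 < e"
  shows "finite {c. e \<le> prob (S c)}"
proof (rule ccontr)
  assume "infinite {c. e \<le> prob (S c)}"
  then obtain c :: "nat \<Rightarrow> 'b" where c: "inj c" "range c \<subseteq> {c. e \<le> prob (S c)}"
    using infinite_countable_subset by blast
  define E where "E N = (\<Union>k\<in>{N..}. S (c k))" for N
  have E[measurable]: "E N \<in> events" for N
    unfolding E_def by measurable
  have "(\<lambda>N. prob (E N)) \<longlonglongrightarrow> prob (\<Inter>N. E N)"
    by (rule finite_Lim_measure_decseq) (fastforce simp: decseq_def E_def)+
  moreover have "e \<le> prob (E N)" for N
  proof -
    have "e \<le> prob (S (c N))" using c(2) by auto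
    also have "\<dots> \<le> prob (E N)" by (rule finite_measure_mono) (auto simp: E_def)
    finally show ?thesis .
  qed
  ultimately have "e \<le> prob (\<Inter>N. E N)"
    by (intro LIMSEQ_le_const) auto
  moreover have "AE \<omega> in M. \<omega> \<notin> (\<Inter>N. E N)"
    using fin
  proof eventually_elim
    case (elim \<omega>)
    show ?case
    proof
      assume *: "\<omega> \<in> (\<Inter>N. E N)"
      have "finite {k. \<omega> \<in> S (c k)}"
        using finite_vimageI[OF elim c(1)] by (simp add: vimage_def)
      then obtain N where "\<forall>k\<in>{k. \<omega> \<in> S (c k)}. k < N"
        using finite_nat_set_iff_bounded by blast
      moreover have "\<omega> \<in> E N" using * by blast
      ultimately show False by (auto simp: E_def)
    qed
  qed
  then have "prob (\<Inter>N. E N) = 0"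
    by (subst prob_eq_0) auto
  ultimately show False using \<open>0 < e\<close> by simp
qed

section \<open>Jumps from or to a given point\<close>

lemma jump_touch_cong:
  assumes "\<And>t. t \<in> A \<Longrightarrow> w t = w' t"
  shows "jump_touch w A r x = jump_touch w' A r x"
proof -
  have "jump_touch w' A r x" if eq: "\<And>t. t \<in> A \<Longrightarrow> w t = w' t" and touch: "jump_touch w A r x" for w w'
    unfolding jump_touch_def
  proof
    fix m
    obtain u v where "u \<in> A" "v \<in> A" "u < v \<and> v - u < inverse (Suc m) \<and> r < dist (w u) (w v) \<and>
       (dist (w u) x < inverse (Suc m) \<or> dist (w v) x < inverse (Suc m))"
      using touch unfolding jump_touch_def by blast
    then show "\<exists>u\<in>A. \<exists>v\<in>A. u < v \<and> v - u < inverse (Suc m) \<and> r < dist (w' u) (w' v) \<and>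
       (dist (w' u) x < inverse (Suc m) \<or> dist (w' v) x < inverse (Suc m))"
      using eq by (intro bexI[of _ u] bexI[of _ v]) auto
  qed
  from this[of w w'] this[of w' w] assms show ?thesis by auto
qed

lemma jump_touch_shift:
  fixes w :: "real \<Rightarrow> 'a::real_normed_vector"
  shows "jump_touch (\<lambda>v. w (h + v) - y) A r (x - y) \<longleftrightarrow> jump_touch w ((+) h ` A) r x"
  by (simp add: jump_touch_def dist_norm)

lemma pred_Bex_countable:
  assumes "countable I" "\<And>i. i \<in> I \<Longrightarrow> Measurable.pred N (P i)"
  shows "Measurable.pred N (\<lambda>x. \<exists>i\<in>I. P i x)"
  using assms unfolding pred_def by (intro sets.sets_Collect_countable_Ex')

lemma pred_Ball_countable:
  assumes "countable I" "\<And>i. i \<in> I \<Longrightarrow> Measurable.pred N (P i)"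
  shows "Measurable.pred N (\<lambda>x. \<forall>i\<in>I. P i x)"
  using assms unfolding pred_def by (intro sets.sets_Collect_countable_All')

lemma pred_jump_touch[measurable (raw)]:
  fixes x :: "'b \<Rightarrow> 'a::euclidean_space"
  assumes A: "countable A" "\<And>t. t \<in> A \<Longrightarrow> (\<lambda>\<omega>. w \<omega> t) \<in> borel_measurable N" and [measurable]: "x \<in> borel_measurable N"
  shows "Measurable.pred N (\<lambda>\<omega>. jump_touch (w \<omega>) A r (x \<omega>))"
proof -
  have "Measurable.pred N (\<lambda>\<omega>. u < v \<and> v - u < inverse (real (Suc m)) \<and> r < dist (w \<omega> u) (w \<omega> v) \<and>
      (dist (w \<omega> u) (x \<omega>) < inverse (real (Suc m)) \<or> dist (w \<omega> v) (x \<omega>) < inverse (real (Suc m))))"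
    if "u \<in> A" "v \<in> A" for m u v
  proof -
    note [measurable] = A(2)[OF that(1)] A(2)[OF that(2)]
    show ?thesis by measurable
  qed
  then show ?thesis
    unfolding jump_touch_def by (intro pred_intros_countable pred_Bex_countable A(1))
qed

context levy
begin

lemma AE_future_0: "AE \<omega> in M. \<forall>t\<ge>0. future 0 \<omega> t = X t \<omega>"
  using AE_X_0 by eventually_elim (simp add: future_def)

lemma events_jump_touch:
  assumes "countable A" "A \<subseteq> {0..}"
  shows "{\<omega>\<in>space M. jump_touch (future 0 \<omega>) A r c} \<in> events"
proof -
  have "Measurable.pred M (\<lambda>\<omega>. jump_touch (future 0 \<omega>) A r c)"
    using assms
    by (intro pred_jump_touch) (auto intro!: measurable_compose[OF future_measurable measurable_component_singleton])
  then show ?thesis by simp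
qed

text \<open>The points that the process started at 0 touches by a jump with positive probability.
  Jump size and horizon are discretised, because a path touches only finitely many points for a
  fixed \<open>n\<close> and \<open>T\<close>.\<close>

definition jump_points :: "'a set" where
  "jump_points = {c. \<exists>n T :: nat. prob {\<omega>\<in>space M. jump_touch (future 0 \<omega>) (\<rat> \<inter> {0..real T}) (inverse (Suc n)) c} \<noteq> 0}"

text \<open>For fixed \<open>n\<close> and \<open>T\<close> almost every path touches finitely many
  points, so only finitely many points are touched with probability above a given threshold.\<close>

lemma countable_jump_points: "countable jump_points"
proof -
  define S where "S n T c = {\<omega>\<in>space M. jump_touch (future 0 \<omega>) (\<rat> \<inter> {0..real T}) (inverse (Suc n)) c}" for n T :: nat and c
  have "finite {c. inverse (Suc k) \<le> prob (S n T c)}" for n T k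
  proof (rule finite_large_events)
    show "S n T c \<in> events" for c
      unfolding S_def by (rule events_jump_touch) (auto intro: countable_rat)
    show "AE \<omega> in M. finite {c. \<omega> \<in> S n T c}"
      using AE_cadlag AE_future_0
    proof eventually_elim
      case (elim \<omega>)
      have "{c. \<omega> \<in> S n T c} \<subseteq> {c. jump_touch (\<lambda>t. X t \<omega>) (\<rat> \<inter> {0..real T}) (inverse (Suc n)) c}"
        using elim(2) jump_touch_cong[of "\<rat> \<inter> {0..real T}" "future 0 \<omega>" "\<lambda>t. X t \<omega>"] by (auto simp: S_def)
      then show ?case
        using finite_jump_touch[OF elim(1), of "inverse (Suc n)" "\<rat> \<inter> {0..real T}" T] by (auto intro: finite_subset)
    qed
  qed simp
  moreover have "jump_points \<subseteq> (\<Union>n T k. {c. inverse (Suc k) \<le> prob (S n T c)})"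
  proof
    fix c assume "c \<in> jump_points"
    then obtain n T where "prob (S n T c) \<noteq> 0"
      by (auto simp: jump_points_def S_def)
    then have "0 < prob (S n T c)" by (simp add: zero_less_measure_iff)
    from reals_Archimedean[OF this] show "c \<in> (\<Union>n T k. {c. inverse (Suc k) \<le> prob (S n T c)})"
      by (auto intro: less_imp_le)
  qed
  moreover have "countable (\<Union>n T k. {c. inverse (Suc k) \<le> prob (S n T c)})" if "\<And>n T k. finite {c. inverse (Suc k) \<le> prob (S n T c)}"
    by (intro countable_UN countableI_type countable_finite that)
  ultimately show ?thesis
    using countable_subset by blast
qed

text \<open>Conditionally on \<open>X h\<close>, the path touches \<open>x\<close> by a jump after time \<open>h\<close> only if \<open>x - X h\<close> is
  one of the countably many \<^term>\<open>jump_points\<close>.\<close>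

lemma AE_no_jump_touch:
  assumes h: "0 \<le> h" and null: "\<And>c. c \<in> jump_points \<Longrightarrow> prob {\<omega>\<in>space M. X h \<omega> = x - c} = 0"
  shows "AE \<omega> in M. \<forall>s l. h < s \<longrightarrow> ((\<lambda>t. X t \<omega>) \<longlongrightarrow> l) (at_left s) \<longrightarrow> x = l \<or> x = X s \<omega> \<longrightarrow> l = X s \<omega>"
proof -
  have notin: "AE \<omega> in M. x - X h \<omega> \<notin> jump_points"
  proof -
    have "AE \<omega> in M. \<forall>c\<in>jump_points. X h \<omega> \<noteq> x - c"
    proof (subst AE_ball_countable[OF countable_jump_points], intro ballI)
      fix c assume "c \<in> jump_points"
      then show "AE \<omega> in M. X h \<omega> \<noteq> x - c"
        using null[of c] h by (subst (asm) prob_eq_0) auto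
    qed
    then show ?thesis by eventually_elim auto
  qed
  have "AE \<omega> in M. \<not> jump_touch (\<lambda>t. X t \<omega>) ((+) h ` (\<rat> \<inter> {0..real T})) (inverse (Suc n)) x" for n T :: nat
  proof -
    let ?A = "\<rat> \<inter> {0..real T}"
    \<comment> \<open>Seen from \<open>X h\<close>, touching \<open>x\<close> means that the
      increments after \<open>h\<close> touch \<open>x - X h\<close>.\<close>
    define \<Psi> where "\<Psi> p = jump_touch (snd p) ?A (inverse (Suc n)) (x - fst p)" for p :: "'a \<times> (real \<Rightarrow> 'a)"
    have \<Psi>: "Measurable.pred (borel \<Otimes>\<^sub>M (\<Pi>\<^sub>M v\<in>{0..}. borel)) \<Psi>"
      unfolding \<Psi>_def
      by (intro pred_jump_touch)
         (auto intro!: countable_Int1 countable_rat borel_measurable_diff measurable_compose[OF measurable_snd measurable_component_singleton])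
    have sp: "space M \<in> sets (history h)"
      using sets.top[of "history h"] by simp
    have "emeasure M {\<omega>\<in>space M. \<Psi> (X h \<omega>, future h \<omega>)} =
      (\<integral>\<^sup>+\<omega>. emeasure M {\<omega>'\<in>space M. \<Psi> (X h \<omega>, future 0 \<omega>')} * indicator (space M) \<omega> \<partial>M)"
      by (rule markov[OF h sp \<Psi>])
    also have "\<dots> = (\<integral>\<^sup>+\<omega>. 0 \<partial>M)"
    proof (rule nn_integral_cong_AE)
      show "AE \<omega> in M. emeasure M {\<omega>'\<in>space M. \<Psi> (X h \<omega>, future 0 \<omega>')} * indicator (space M) \<omega> = 0"
        using notin
      proof eventually_elim
        case (elim \<omega>)
        then show ?case
          by (simp add: \<Psi>_def jump_points_def emeasure_eq_measure)
      qed
    qed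
    finally have "emeasure M {\<omega>\<in>space M. \<Psi> (X h \<omega>, future h \<omega>)} = 0" by simp
    moreover have "{\<omega>\<in>space M. \<Psi> (X h \<omega>, future h \<omega>)} \<in> events"
      using \<Psi> h by measurable
    ultimately have "AE \<omega> in M. \<not> \<Psi> (X h \<omega>, future h \<omega>)"
      by (simp add: AE_iff_measurable[OF _ refl])
    then show ?thesis
    proof eventually_elim
      case (elim \<omega>)
      have "jump_touch (future h \<omega>) ?A (inverse (Suc n)) (x - X h \<omega>) =
        jump_touch (\<lambda>v. X (h + v) \<omega> - X h \<omega>) ?A (inverse (Suc n)) (x - X h \<omega>)"
        by (rule jump_touch_cong) (simp add: future_def)
      then show ?case
        using elim jump_touch_shift[of "\<lambda>t. X t \<omega>" h "X h \<omega>" ?A "inverse (Suc n)" x] by (simp add: \<Psi>_def)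
    qed
  qed
  then have "AE \<omega> in M. \<forall>n T :: nat. \<not> jump_touch (\<lambda>t. X t \<omega>) ((+) h ` (\<rat> \<inter> {0..real T})) (inverse (Suc n)) x"
    by (simp add: AE_all_countable)
  then show ?thesis
    using AE_cadlag
  proof eventually_elim
    case (elim \<omega>)
    show ?case
    proof (intro allI impI, rule ccontr)
      fix s l assume s: "h < s" and l: "((\<lambda>t. X t \<omega>) \<longlongrightarrow> l) (at_left s)" "x = l \<or> x = X s \<omega>" "l \<noteq> X s \<omega>"
      obtain T :: nat where T: "s - h < real T" using reals_Archimedean2 by blast
      have "\<exists>n::nat. jump_touch (\<lambda>t. X t \<omega>) ((+) h ` (\<rat> \<inter> {0..real T})) (inverse (Suc n)) x"
      proof (rule jump_touchI[OF elim(2) h s _ l(1,3,2)])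
        show "s < h + real T" using T by simp
        fix u v assume uv: "h \<le> u" "u < v" "v \<le> h + real T"
        obtain q where q: "q \<in> \<rat>" "u - h < q" "q < v - h"
          using Rats_dense_in_real[of "u - h" "v - h"] uv by auto
        then show "\<exists>q\<in>(+) h ` (\<rat> \<inter> {0..real T}). u < q \<and> q < v"
          using uv by (intro bexI[of _ "h + q"]) auto
      qed
      then show False using elim(1) by blast
    qed
  qed
qed

end

section \<open>Hitting times and killed paths\<close>

lemma hitting_time_less_iff: "hitting_time B w < c \<longleftrightarrow> (\<exists>t>0. w t \<in> Some ` B \<and> ereal t < c)"
  unfolding hitting_time_def Inf_less_iff by auto

lemma hitting_time_eq_infinity_iff: "hitting_time B w = \<infinity> \<longleftrightarrow> (\<forall>t>0. w t \<notin> Some ` B)"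
proof
  assume "hitting_time B w = \<infinity>"
  then show "\<forall>t>0. w t \<notin> Some ` B"
    using hitting_time_less_iff[of B w \<infinity>] by auto
next
  assume "\<forall>t>0. w t \<notin> Some ` B"
  then have "\<not> hitting_time B w < \<infinity>"
    unfolding hitting_time_less_iff by blast
  then show "hitting_time B w = \<infinity>" by simp
qed

text \<open>The margin beyond \<open>c\<close> is essential: hits may accumulate at \<open>c\<close>
  from the right, and then the infimum is \<open>c\<close> although no hit occurs up to
  \<open>c\<close>.\<close>

lemma hitting_time_gt_iff: "ereal c < hitting_time B w \<longleftrightarrow> (\<exists>n::nat. \<forall>t. 0 < t \<longrightarrow> t < c + inverse (Suc n) \<longrightarrow> w t \<notin> Some ` B)"
proof
  assume "ereal c < hitting_time B w"
  then obtain d where d: "c < d" "ereal d < hitting_time B w"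
    using ereal_dense2[of "ereal c" "hitting_time B w"] by auto
  obtain n :: nat where n: "inverse (Suc n) < d - c"
    using reals_Archimedean[of "d - c"] d(1) by auto
  show "\<exists>n::nat. \<forall>t. 0 < t \<longrightarrow> t < c + inverse (Suc n) \<longrightarrow> w t \<notin> Some ` B"
  proof (intro exI[of _ n] allI impI notI)
    fix t assume "0 < t" "t < c + inverse (Suc n)" "w t \<in> Some ` B"
    then have "\<exists>t>0. w t \<in> Some ` B \<and> ereal t < ereal d"
      using n by (intro exI[of _ t]) simp
    then have "hitting_time B w < ereal d"
      by (simp only: hitting_time_less_iff)
    then show False using d(2) by simp
  qed
next
  assume "\<exists>n::nat. \<forall>t. 0 < t \<longrightarrow> t < c + inverse (Suc n) \<longrightarrow> w t \<notin> Some ` B"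
  then obtain n :: nat where n: "\<And>t. 0 < t \<Longrightarrow> t < c + inverse (Suc n) \<Longrightarrow> w t \<notin> Some ` B" by blast
  have "ereal c < ereal (c + inverse (Suc n))" by simp
  also have "\<dots> \<le> hitting_time B w"
    using n hitting_time_less_iff[of B w "ereal (c + inverse (Suc n))"] by (auto simp: not_less[symmetric])
  finally show "ereal c < hitting_time B w" .
qed

lemma lifetime_kill:
  assumes "0 < s"
  shows "lifetime (kill_path (levy_path X) x (\<omega>, s)) = ereal s"
proof -
  have "t \<ge> 0 \<and> kill_path (levy_path X) x (\<omega>, s) t = None \<longleftrightarrow> s \<le> t" for t
    using assms by (simp add: kill_path_def levy_path_def not_less)
  then have "{ereal t | t. t \<ge> 0 \<and> kill_path (levy_path X) x (\<omega>, s) t = None} = ereal ` {s..}"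
    by (simp add: image_def Bex_def conj_commute)
  moreover have "Inf (ereal ` {s..}) = ereal s"
  proof (rule antisym)
    show "Inf (ereal ` {s..}) \<le> ereal s" by (rule Inf_lower) simp
    show "ereal s \<le> Inf (ereal ` {s..})" by (rule Inf_greatest) auto
  qed
  ultimately show ?thesis by (simp add: lifetime_def)
qed

lemma kill_path_in: "kill_path (levy_path X) x (\<omega>, s) t \<in> Some ` B \<longleftrightarrow> t < s \<and> x + X t \<omega> \<in> B"
  by (auto simp: kill_path_def levy_path_def)

text \<open>The event of \<open>Q\<close> may be arbitrary here: if it is not measurable, its
  \<open>emeasure\<close> is 0 and the bound holds anyway.\<close>

lemma path_prob_le:
  assumes "AE p in M. Q (W x p) \<longrightarrow> p \<in> S" "S \<in> sets M"
  shows "path_prob M W x Q \<le> emeasure M S"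
proof -
  have "path_prob M W x Q \<le> emeasure (completion M) S"
    unfolding path_prob_def using assms by (intro emeasure_mono_AE AE_completion) auto
  then show ?thesis using assms by simp
qed

lemma sets_completion_AE_eq:
  assumes "AE p in M. Q p \<longleftrightarrow> p \<in> S" "S \<in> sets M"
  shows "{p\<in>space M. Q p} \<in> sets (completion M)"
proof (rule completion.in_sets_AE)
  show "AE p in completion M. p \<in> S \<longleftrightarrow> p \<in> {p\<in>space M. Q p}"
    using AE_completion[OF assms(1)] AE_space[of "completion M"] by eventually_elim auto
qed (use assms(2) in auto)

text \<open>For a lower bound the event has to be measurable in the completion, which almost sure
  equality with a measurable \<open>S'\<close> ensures.\<close>

lemma path_prob_ge:
  assumes "AE p in M. Q (W x p) \<longleftrightarrow> p \<in> S'" "S' \<in> sets M"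
    and "AE p in M. p \<in> S \<longrightarrow> p \<in> S'"
  shows "emeasure M S \<le> path_prob M W x Q"
proof -
  have "emeasure M S \<le> emeasure M S'"
    using assms by (intro emeasure_mono_AE) auto
  also have "\<dots> = emeasure (completion M) S'" using assms by simp
  also have "\<dots> \<le> path_prob M W x Q"
    unfolding path_prob_def
  proof (rule emeasure_mono_AE)
    show "{\<omega> \<in> space M. Q (W x \<omega>)} \<in> sets (completion M)"
      using assms by (intro sets_completion_AE_eq) auto
    show "AE p in completion M. p \<in> S' \<longrightarrow> p \<in> {\<omega> \<in> space M. Q (W x \<omega>)}"
      using AE_completion[OF assms(1)] AE_space[of "completion M"] by eventually_elim auto
  qed
  finally show ?thesis .
qed

locale killed_levy = levy M X for M :: "'w measure" and X :: "real \<Rightarrow> 'w \<Rightarrow> 'a::euclidean_space" +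
  fixes q :: real
  assumes q_pos: "0 < q"
begin

abbreviation "expo \<equiv> density lborel (\<lambda>s. ennreal (exponential_density q s))"
abbreviation "killed \<equiv> kill_path (levy_path X)"

sublocale expo: prob_space expo
  using q_pos by (rule prob_space_exponential_density)

sublocale kill: pair_prob_space M expo ..

lemma kill_space_eq: "kill_space q M = M \<Otimes>\<^sub>M expo"
  by (simp add: kill_space_def)

lemma expo_gt: "0 \<le> a \<Longrightarrow> measure expo {a<..} = exp (- q * a)"
proof -
  assume a: "0 \<le> a"
  have "measure expo {..a} = 1 - exp (- q * a)"
    using emeasure_erlang_density[OF q_pos, of 0 a] q_pos a
    by (simp add: measure_def erlang_CDF_0)
  moreover have "measure expo (space expo - {..a}) = 1 - measure expo {..a}"
    by (rule expo.prob_compl) simp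
  moreover have "space expo - {..a} = {a<..}" by auto
  ultimately show ?thesis by simp
qed

lemma emeasure_kill_times:
  assumes "A \<in> sets M" "B \<in> sets borel"
  shows "emeasure (kill_space q M) (A \<times> B) = ennreal (prob A * measure expo B)"
  using assms expo.emeasure_pair_measure_Times[of A M B]
  by (simp add: kill_space_eq emeasure_eq_measure expo.emeasure_eq_measure ennreal_mult)

lemma AE_kill_fst:
  assumes "AE \<omega> in M. P \<omega>"
  shows "AE p in kill_space q M. P (fst p)"
proof -
  obtain N where N: "{\<omega>\<in>space M. \<not> P \<omega>} \<subseteq> N" "emeasure M N = 0" "N \<in> sets M"
    using assms by (rule AE_E)
  show ?thesis
  proof (rule AE_I)
    show "{p \<in> space (kill_space q M). \<not> P (fst p)} \<subseteq> N \<times> UNIV"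
      using N(1) by (auto simp: kill_space_eq space_pair_measure)
    show "emeasure (kill_space q M) (N \<times> UNIV) = 0"
      using N emeasure_kill_times[of N UNIV] by (simp add: measure_def)
    show "N \<times> UNIV \<in> sets (kill_space q M)"
      using N by (simp add: kill_space_eq)
  qed
qed

lemma AE_kill_pos: "AE p in kill_space q M. 0 < snd p"
proof (rule AE_I)
  show "{p \<in> space (kill_space q M). \<not> 0 < snd p} \<subseteq> space M \<times> {..0}"
    by (auto simp: kill_space_eq space_pair_measure)
  show "space M \<times> {..0} \<in> sets (kill_space q M)"
    by (simp add: kill_space_eq)
  have "measure expo {..0} = 0"
    using emeasure_erlang_density[OF q_pos, of 0 0] by (simp add: measure_def erlang_CDF_0)
  then show "emeasure (kill_space q M) (space M \<times> {..0}) = 0"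
    using emeasure_kill_times[of "space M" "{..0}"] by simp
qed

end

text \<open>Spatial homogeneity: started at \<open>- y\<close>, the path is at 0 exactly when
  \<open>X\<close> is at \<open>y\<close>. That the probability is 1 already implies measurability
  in the completion, since otherwise \<open>emeasure\<close> would be 0.\<close>

lemma (in levy) polar_iff: "polar M (levy_path X) {0} \<longleftrightarrow> (\<forall>y. AE \<omega> in M. \<forall>t>0. X t \<omega> \<noteq> y)"
proof -
  have hit: "hitting_time {0} (levy_path X (- y) \<omega>) = \<infinity> \<longleftrightarrow> (\<forall>t>0. X t \<omega> \<noteq> y)" for y \<omega>
    by (auto simp: hitting_time_eq_infinity_iff levy_path_def)
  have "path_prob M (levy_path X) (- y) (\<lambda>w. hitting_time {0} w = \<infinity>) = 1 \<longleftrightarrow> (AE \<omega> in M. \<forall>t>0. X t \<omega> \<noteq> y)" for y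
  proof
    assume 1: "path_prob M (levy_path X) (- y) (\<lambda>w. hitting_time {0} w = \<infinity>) = 1"
    interpret C: prob_space "completion M"
      by (rule prob_spaceI) (simp add: emeasure_space_1)
    have *: "emeasure (completion M) {\<omega> \<in> space M. \<forall>t>0. X t \<omega> \<noteq> y} = 1"
      using 1 by (simp add: path_prob_def hit)
    then have "{\<omega> \<in> space M. \<forall>t>0. X t \<omega> \<noteq> y} \<in> sets (completion M)"
      using emeasure_notin_sets by fastforce
    then have "AE \<omega> in completion M. \<omega> \<in> {\<omega> \<in> space M. \<forall>t>0. X t \<omega> \<noteq> y}"
      using * by (subst C.AE_in_set_eq_1) (simp_all add: measure_def)
    then have "AE \<omega> in completion M. \<forall>t>0. X t \<omega> \<noteq> y" by eventually_elim simp
    then show "AE \<omega> in M. \<forall>t>0. X t \<omega> \<noteq> y" by (simp add: AE_completion_iff)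
  next
    assume AE: "AE \<omega> in M. \<forall>t>0. X t \<omega> \<noteq> y"
    have "emeasure M (space M) \<le> path_prob M (levy_path X) (- y) (\<lambda>w. hitting_time {0} w = \<infinity>)"
      by (rule path_prob_ge[where S' = "space M"]) (use AE in \<open>auto simp: hit\<close>)
    moreover have "path_prob M (levy_path X) (- y) (\<lambda>w. hitting_time {0} w = \<infinity>) \<le> emeasure M (space M)"
      by (rule path_prob_le) auto
    ultimately show "path_prob M (levy_path X) (- y) (\<lambda>w. hitting_time {0} w = \<infinity>) = 1"
      by (simp add: emeasure_space_1)
  qed
  note iff = this
  show ?thesis
    unfolding polar_def
  proof (intro iffI allI conjI)
    fix y assume "{0} \<in> sets borel \<and> (\<forall>x. path_prob M (levy_path X) x (\<lambda>w. hitting_time {0} w = \<infinity>) = 1)"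
    then show "AE \<omega> in M. \<forall>t>0. X t \<omega> \<noteq> y"
      using iff[of y] by blast
  next
    fix x assume "\<forall>y. AE \<omega> in M. \<forall>t>0. X t \<omega> \<noteq> y"
    then show "path_prob M (levy_path X) x (\<lambda>w. hitting_time {0} w = \<infinity>) = 1"
      using iff[of "- x"] by simp
  qed simp
qed

lemma (in prob_space) decseq_prob_less:
  assumes "\<And>n. E n \<in> events" "decseq E" "AE \<omega> in M. \<exists>n. \<omega> \<notin> E n" "0 < e"
  obtains n :: nat where "prob (E n) < e"
proof -
  have "(\<lambda>n. prob (E n)) \<longlonglongrightarrow> prob (\<Inter>n. E n)"
    using assms(1,2) by (intro finite_Lim_measure_decseq) auto
  moreover have "prob (\<Inter>n. E n) = 0"
    using assms(1,3) by (subst prob_eq_0) auto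
  ultimately have "\<forall>\<^sub>F n in sequentially. prob (E n) < e"
    using assms(4) by (intro order_tendstoD) auto
  then show ?thesis
    using that by (auto dest: eventually_happens)
qed

section \<open>Polarity bounds the three quantities\<close>

context levy
begin

lemma small_fluctuations:
  assumes "0 < r" "0 < e"
  obtains t where "0 < t" "prob {\<omega>\<in>space M. \<exists>v\<in>\<rat> \<inter> {0<..<t}. r < norm (X v \<omega>)} < e"
proof -
  define E where "E n = {\<omega>\<in>space M. \<exists>v\<in>\<rat> \<inter> {0<..<inverse (real (Suc n))}. r < norm (X v \<omega>)}" for n
  have E: "E n \<in> events" for n
  proof -
    have "Measurable.pred M (\<lambda>\<omega>. \<exists>v\<in>\<rat> \<inter> {0<..<inverse (real (Suc n))}. r < norm (X v \<omega>))"
    proof (rule pred_Bex_countable)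
      fix v assume "v \<in> \<rat> \<inter> {0<..<inverse (real (Suc n))}"
      then have [measurable]: "X v \<in> borel_measurable M" by (intro X_measurable) auto
      show "Measurable.pred M (\<lambda>\<omega>. r < norm (X v \<omega>))" by measurable
    qed (auto intro: countable_rat)
    then show ?thesis by (simp add: E_def)
  qed
  have "inverse (real (Suc n)) \<le> inverse (real (Suc m))" if "m \<le> n" for m n
    using that by (simp add: field_simps)
  then have "decseq E"
    unfolding decseq_def E_def by (fastforce intro: less_le_trans)
  moreover have "AE \<omega> in M. \<exists>n. \<omega> \<notin> E n"
    using AE_cadlag AE_X_0
  proof eventually_elim
    case (elim \<omega>)
    obtain d where d: "0 < d" "\<And>v. 0 \<le> v \<Longrightarrow> v < 0 + d \<Longrightarrow> dist (X v \<omega>) (X 0 \<omega>) < r"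
      using cadlag_right[OF elim(1) _ \<open>0 < r\<close>, of 0] by auto
    obtain n where n: "inverse (real (Suc n)) < d"
      using reals_Archimedean[OF d(1)] by blast
    have "norm (X v \<omega>) < r" if "v \<in> {0<..<inverse (real (Suc n))}" for v
      using d(2)[of v] elim(2) that n by auto
    then have "\<omega> \<notin> E n"
      unfolding E_def by (auto simp: not_less less_imp_le)
    then show ?case ..
  qed
  ultimately obtain n where "prob (E n) < e"
    using decseq_prob_less[of E e] E \<open>0 < e\<close> by blast
  then show ?thesis
    by (intro that[of "inverse (real (Suc n))"]) (auto simp: E_def)
qed

section \<open>Coming close to a point in bounded time\<close>

lemma pred_close[measurable (raw)]:
  "0 \<le> t \<Longrightarrow> Measurable.pred M (\<lambda>\<omega>. dist (X t \<omega>) w < r)"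
  by measurable

text \<open>On cadlag paths this is the event of entering the open ball around \<open>w\<close> at
  some time strictly between 0 and \<open>K\<close>; the rational times make it measurable.\<close>

definition near :: "real \<Rightarrow> 'a \<Rightarrow> real \<Rightarrow> 'w set" where
  "near K w r = {\<omega>\<in>space M. \<exists>v\<in>\<rat> \<inter> {0<..<K}. dist (X v \<omega>) w < r}"

lemma near_events[measurable]: "near K w r \<in> events"
proof -
  have "Measurable.pred M (\<lambda>\<omega>. \<exists>v\<in>\<rat> \<inter> {0<..<K}. dist (X v \<omega>) w < r)"
    by (rule pred_Bex_countable) (auto intro: countable_rat pred_close)
  then show ?thesis by (simp add: near_def)
qed

lemma near_mono: "dist w w' + r \<le> r' \<Longrightarrow> near K w r \<subseteq> near K w' r'"
proof -
  assume le: "dist w w' + r \<le> r'"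
  have "dist z w' < r'" if "dist z w < r" for z
    using dist_triangle[of z w' w] that le by simp
  then show ?thesis unfolding near_def by blast
qed

text \<open>A path in all these events has \<open>w\<close> as a value or a left limit. Time 0 is
  excluded by \<open>w \<noteq> 0\<close>, a value at a later time by polarity, and a left limit
  different from the value by \<open>AE_no_jump_touch\<close>, as polarity leaves \<open>X h\<close>
  without atoms.\<close>

lemma near_small_pointwise:
  assumes polar: "\<And>y. AE \<omega> in M. \<forall>t>0. X t \<omega> \<noteq> y" and "w \<noteq> 0" "0 < e"
  obtains r where "0 < r" "prob (near K w r) < e"
proof -
  have "AE \<omega> in M. \<forall>s l. h < s \<longrightarrow> ((\<lambda>t. X t \<omega>) \<longlongrightarrow> l) (at_left s) \<longrightarrow> w = l \<or> w = X s \<omega> \<longrightarrow> l = X s \<omega>"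
    if "0 < h" for h
  proof (rule AE_no_jump_touch)
    fix c
    have "AE \<omega> in M. X h \<omega> \<noteq> w - c"
      using polar[of "w - c"] by eventually_elim (use that in auto)
    then show "prob {\<omega>\<in>space M. X h \<omega> = w - c} = 0"
      using that by (subst prob_eq_0) auto
  qed (use that in simp)
  \<comment> \<open>Countably many base times \<open>h\<close> tending to 0 reach every jump time
    \<open>s > 0\<close>.\<close>
  then have jump: "AE \<omega> in M. \<forall>n::nat. \<forall>s l. inverse (Suc n) < s \<longrightarrow> ((\<lambda>t. X t \<omega>) \<longlongrightarrow> l) (at_left s) \<longrightarrow> w = l \<or> w = X s \<omega> \<longrightarrow> l = X s \<omega>"
    by (subst AE_all_countable) simp
  have "decseq (\<lambda>n. near K w (inverse (Suc n)))"
    unfolding decseq_def by (intro allI impI near_mono) (simp add: field_simps)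
  moreover have "AE \<omega> in M. \<exists>n. \<omega> \<notin> near K w (inverse (Suc n))"
    using jump polar[of w] AE_cadlag AE_X_0
  proof eventually_elim
    case (elim \<omega>)
    show ?case
    proof (rule ccontr)
      assume "\<nexists>n. \<omega> \<notin> near K w (inverse (real (Suc n)))"
      then have near: "\<omega> \<in> near K w (inverse (real (Suc n)))" for n by blast
      have acc: "\<exists>v. 0 \<le> v \<and> v \<le> K \<and> dist (X v \<omega>) w < \<epsilon>" if \<epsilon>: "0 < \<epsilon>" for \<epsilon>
      proof -
        obtain n where n: "inverse (real (Suc n)) < \<epsilon>" using reals_Archimedean[OF \<epsilon>] by blast
        obtain v where "v \<in> {0<..<K}" "dist (X v \<omega>) w < inverse (real (Suc n))"
          using near[of n] by (auto simp: near_def)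
        then show ?thesis using n by (intro exI[of _ v]) auto
      qed
      obtain s where s: "s \<in> {0..K}" "w = X s \<omega> \<or> 0 < s \<and> ((\<lambda>t. X t \<omega>) \<longlongrightarrow> w) (at_left s)"
        using acc by (rule cadlag_accumulation[OF elim(3)])
      have "w \<noteq> X s \<omega>"
      proof (cases "s = 0")
        case False
        then have "0 < s" using s(1) by simp
        then show ?thesis using elim(2) by metis
      qed (use elim(4) \<open>w \<noteq> 0\<close> in simp)
      then have "0 < s" "((\<lambda>t. X t \<omega>) \<longlongrightarrow> w) (at_left s)" using s(2) by auto
      moreover obtain n where "inverse (real (Suc n)) < s"
        using reals_Archimedean[OF \<open>0 < s\<close>] by blast
      ultimately have "w = X s \<omega>" using elim(1) by blast
      then show False using \<open>w \<noteq> X s \<omega>\<close> by simp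
    qed
  qed
  ultimately obtain n where "prob (near K w (inverse (real (Suc n)))) < e"
    using decseq_prob_less[of "\<lambda>n. near K w (inverse (Suc n))" e] \<open>0 < e\<close> near_events by blast
  then show ?thesis
    by (intro that[of "inverse (real (Suc n))"]) auto
qed

text \<open>Reaching the unit ball around a distant point requires a large norm before time
  \<open>K\<close>, while paths are bounded on bounded time intervals.\<close>

lemma near_small_at_infinity:
  assumes "0 < e"
  obtains R where "\<And>w. R \<le> norm w \<Longrightarrow> prob (near K w 1) < e"
proof -
  define E where "E n = {\<omega>\<in>space M. \<exists>v\<in>\<rat> \<inter> {0<..<K}. real n < norm (X v \<omega>)}" for n
  have E[measurable]: "E n \<in> events" for n
  proof -
    have "Measurable.pred M (\<lambda>\<omega>. \<exists>v\<in>\<rat> \<inter> {0<..<K}. real n < norm (X v \<omega>))"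
    proof (rule pred_Bex_countable)
      fix v assume "v \<in> \<rat> \<inter> {0<..<K}"
      then have [measurable]: "X v \<in> borel_measurable M" by (intro X_measurable) auto
      show "Measurable.pred M (\<lambda>\<omega>. real n < norm (X v \<omega>))" by measurable
    qed (auto intro: countable_rat)
    then show ?thesis by (simp add: E_def)
  qed
  have "decseq E"
    unfolding decseq_def E_def by (auto intro: le_less_trans[OF iffD2[OF of_nat_le_iff]])
  moreover have "AE \<omega> in M. \<exists>n. \<omega> \<notin> E n"
    using AE_cadlag
  proof eventually_elim
    case (elim \<omega>)
    obtain n :: nat where "\<forall>v\<in>{0..K}. norm (X v \<omega>) \<le> n"
      using cadlag_bounded[OF elim] by blast
    then have "\<omega> \<notin> E n" by (auto simp: E_def not_less)
    then show ?case ..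
  qed
  ultimately obtain n where n: "prob (E n) < e"
    using decseq_prob_less[of E e] E \<open>0 < e\<close> by blast
  show ?thesis
  proof (rule that[of "real n + 1"])
    fix w :: 'a assume w: "real n + 1 \<le> norm w"
    have "real n < norm x" if "dist x w < 1" for x
      using w that norm_triangle_ineq2[of w x] by (simp add: dist_norm norm_minus_commute)
    then have "near K w 1 \<subseteq> E n"
      unfolding near_def E_def by blast
    then have "prob (near K w 1) \<le> prob (E n)"
      by (intro finite_measure_mono) auto
    then show "prob (near K w 1) < e" using n by simp
  qed
qed

text \<open>Large \<open>w\<close> are covered by \<open>near_small_at_infinity\<close>; the
  remaining ones form a compact annulus, on which finitely many of the pointwise radii
  suffice.\<close>

lemma near_small_uniform:
  assumes polar: "\<And>y. AE \<omega> in M. \<forall>t>0. X t \<omega> \<noteq> y" and "0 < u" "0 < e"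
  obtains r where "0 < r" "\<And>w. u \<le> norm w \<Longrightarrow> prob (near K w r) < e"
proof -
  obtain R where R: "\<And>w. R \<le> norm w \<Longrightarrow> prob (near K w 1) < e"
    using near_small_at_infinity[OF \<open>0 < e\<close>] by blast
  define C where "C = cball (0::'a) R - ball 0 u"
  have "compact C" unfolding C_def by (intro compact_diff) auto
  have "\<exists>r>0. prob (near K w r) < e" if "w \<in> C" for w
  proof -
    have "w \<noteq> 0" using that \<open>0 < u\<close> by (auto simp: C_def)
    then show ?thesis
      using near_small_pointwise[OF polar _ \<open>0 < e\<close>] by metis
  qed
  then obtain \<rho> where \<rho>: "\<And>w. w \<in> C \<Longrightarrow> 0 < \<rho> w" "\<And>w. w \<in> C \<Longrightarrow> prob (near K w (\<rho> w)) < e"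
    by metis
  have "C \<subseteq> (\<Union>w\<in>C. ball w (\<rho> w / 2))"
    using \<rho>(1) by force
  then obtain D where D: "D \<subseteq> C" "finite D" "C \<subseteq> (\<Union>w\<in>D. ball w (\<rho> w / 2))"
    using compactE_image[OF \<open>compact C\<close>, of C "\<lambda>w. ball w (\<rho> w / 2)"] by auto
  \<comment> \<open>Half radii leave room for moving the centre to a point of the finite cover; the
    1 is the radius that serves all \<open>w\<close> with norm at least \<open>R\<close>, and keeps
    the minimum meaningful if \<open>D\<close> is empty.\<close>
  define r where "r = Min (insert 1 ((\<lambda>w. \<rho> w / 2) ` D))"
  have r: "0 < r" "r \<le> 1" "\<And>w. w \<in> D \<Longrightarrow> r \<le> \<rho> w / 2"
  proof -
    show "0 < r" "r \<le> 1"
      using D \<rho>(1) by (auto simp: r_def)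
    show "r \<le> \<rho> w / 2" if "w \<in> D" for w
      unfolding r_def using D(2) that by (intro Min_le) auto
  qed
  show ?thesis
  proof (rule that[OF r(1)])
    fix w :: 'a assume w: "u \<le> norm w"
    have "\<exists>w' r'. near K w r \<subseteq> near K w' r' \<and> prob (near K w' r') < e"
    proof (cases "R \<le> norm w")
      case True
      then show ?thesis
        using R[OF True] near_mono[of w w r 1 K] r(2) by (intro exI[of _ w] exI[of _ 1]) auto
    next
      case False
      then have "w \<in> C" using w by (simp add: C_def)
      then obtain w' where w': "w' \<in> D" "dist w' w < \<rho> w' / 2" using D(3) by auto
      have "near K w r \<subseteq> near K w' (\<rho> w')"
        using w' r(3)[OF w'(1)] by (intro near_mono) (simp add: dist_commute)
      then show ?thesis using \<rho>(2) w'(1) D(1) by blast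
    qed
    then obtain w' r' where *: "near K w r \<subseteq> near K w' r'" "prob (near K w' r') < e" by blast
    have "prob (near K w r) \<le> prob (near K w' r')"
      using *(1) by (intro finite_measure_mono) auto
    then show "prob (near K w r) < e" using *(2) by simp
  qed
qed

end

section \<open>Upper bounds for the killed process\<close>

context killed_levy
begin

lemma h2_less_1: "h2 (kill_space q M) killed < 1"
proof -
  have "h2 (kill_space q M) killed \<le> ennreal (1/2)"
    unfolding h2_def
  proof (rule SUP_least)
    fix r :: real assume "r \<in> {0<..}"
    \<comment> \<open>Leaving the ball means a norm of at least \<open>r\<close>, a closed
      condition; the weaker open condition \<open>r/2 < norm\<close> carries over to rational
      times.\<close>
    then obtain t where t: "0 < t" "prob {\<omega>\<in>space M. \<exists>v\<in>\<rat> \<inter> {0<..<t}. r/2 < norm (X v \<omega>)} < 1/2"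
      using small_fluctuations[of "r/2" "1/2"] by auto
    let ?E = "{\<omega>\<in>space M. \<exists>v\<in>\<rat> \<inter> {0<..<t}. r/2 < norm (X v \<omega>)}"
    have E: "?E \<in> events"
    proof -
      have "Measurable.pred M (\<lambda>\<omega>. \<exists>v\<in>\<rat> \<inter> {0<..<t}. r/2 < norm (X v \<omega>))"
      proof (rule pred_Bex_countable)
        fix v assume "v \<in> \<rat> \<inter> {0<..<t}"
        then have [measurable]: "X v \<in> borel_measurable M" by (intro X_measurable) auto
        show "Measurable.pred M (\<lambda>\<omega>. r/2 < norm (X v \<omega>))" by measurable
      qed (auto intro: countable_rat)
      then show ?thesis by simp
    qed
    have "path_prob (kill_space q M) killed x (\<lambda>w. exit_time (ball x r) w < ereal t) \<le> ennreal (1/2)" for x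
    proof -
      have "path_prob (kill_space q M) killed x (\<lambda>w. exit_time (ball x r) w < ereal t) \<le>
        emeasure (kill_space q M) (?E \<times> UNIV)"
      proof (rule path_prob_le)
        show "?E \<times> UNIV \<in> sets (kill_space q M)"
          using E by (simp add: kill_space_eq)
        show "AE p in kill_space q M. exit_time (ball x r) (killed x p) < ereal t \<longrightarrow> p \<in> ?E \<times> UNIV"
          using AE_kill_fst[OF AE_cadlag] AE_space
        proof eventually_elim
          case (elim p)
          obtain \<omega> z where p: "p = (\<omega>, z)" by (cases p)
          show ?case
          proof
            assume "exit_time (ball x r) (killed x p) < ereal t"
            then obtain v where v: "0 < v" "v < t" "r \<le> norm (X v \<omega>)"
              unfolding exit_time_def hitting_time_less_iff p kill_path_in by (auto simp: dist_norm)
            have "X v \<omega> \<in> {y. r/2 < norm y}"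
              using v \<open>r \<in> {0<..}\<close> by auto
            moreover have "open {y :: 'a. r/2 < norm y}"
              by (intro open_Collect_less continuous_intros)
            ultimately have "\<exists>c\<in>\<rat>. v < c \<and> c < t \<and> X c \<omega> \<in> {y. r/2 < norm y}"
              using v elim(1) by (intro cadlag_right_dense[of "\<lambda>t. X t \<omega>"] Rats_dense_in_real) (auto simp: p)
            then show "p \<in> ?E \<times> UNIV"
              using v elim(2) by (auto simp: p kill_space_eq space_pair_measure)
          qed
        qed
      qed
      also have "\<dots> = ennreal (prob ?E)"
        using emeasure_kill_times[OF E, of UNIV] expo.prob_space by simp
      also have "\<dots> \<le> ennreal (1/2)" using t(2) by (intro ennreal_leI) simp
      finally show ?thesis .
    qed
    then have "(SUP x. path_prob (kill_space q M) killed x (\<lambda>w. exit_time (ball x r) w < ereal t)) \<le> ennreal (1/2)"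
      by (intro SUP_least)
    then show "(INF t\<in>{0<..}. SUP x. path_prob (kill_space q M) killed x (\<lambda>w. exit_time (ball x r) w < ereal t)) \<le> ennreal (1/2)"
      using t(1) by (intro INF_lower2[of t]) auto
  qed
  also have "\<dots> < ennreal 1" by (rule ennreal_lessI) auto
  finally show ?thesis by simp
qed

lemma h1_less_1:
  assumes null: "\<And>t. 0 < t \<Longrightarrow> AE \<omega> in M. X t \<omega> \<noteq> 0"
  shows "h1 (kill_space q M) killed < 1"
proof -
  have "h1 (kill_space q M) killed \<le> ennreal (1 - exp (- q) / 2)"
    unfolding h1_def
  proof (rule SUP_least)
    fix t :: real assume t: "t \<in> {0<..}"
    \<comment> \<open>Being alive and away at one time \<open>s < t\<close> forces an exit before
      \<open>t\<close>. The cap 1 keeps the survival probability above \<open>exp (- q)\<close> for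
      all \<open>t\<close>, as the supremum over \<open>t\<close> demands.\<close>
    define s where "s = min (t/2) 1"
    have s: "0 < s" "s \<le> 1" "s < t" using t by (auto simp: s_def)
    note [measurable] = X_measurable[OF less_imp_le[OF s(1)]]
    define E where "E n = {\<omega>\<in>space M. norm (X s \<omega>) < inverse (real (Suc n))}" for n
    have E[measurable]: "E n \<in> events" for n
      unfolding E_def by measurable
    have "inverse (real (Suc n)) \<le> inverse (real (Suc m))" if "m \<le> n" for m n
      using that by (simp add: field_simps)
    then have "decseq E"
      unfolding decseq_def E_def by (fastforce intro: less_le_trans)
    moreover have "AE \<omega> in M. \<exists>n. \<omega> \<notin> E n"
      using null[OF s(1)]
    proof eventually_elim
      case (elim \<omega>)
      then obtain n where "inverse (real (Suc n)) < norm (X s \<omega>)"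
        using reals_Archimedean[of "norm (X s \<omega>)"] by auto
      then show ?case by (intro exI[of _ n]) (simp add: E_def)
    qed
    ultimately obtain n where n: "prob (E n) < 1/2"
      using decseq_prob_less[of E "1/2"] E by auto
    define r where "r = inverse (real (Suc n))"
    define A where "A = {\<omega>\<in>space M. r \<le> norm (X s \<omega>)}"
    have A[measurable]: "A \<in> events" unfolding A_def by measurable
    have "A = space M - E n" by (auto simp: A_def E_def r_def)
    then have A_ge: "1/2 \<le> prob A" using n prob_compl[OF E[of n]] by simp
    have "path_prob (kill_space q M) killed x (\<lambda>w. ereal t < exit_time (ball x r) w) \<le> ennreal (1 - exp (- q) / 2)" for x
    proof -
      let ?K = "kill_space q M"
      have AK: "A \<times> {s<..} \<in> sets ?K" by (simp add: kill_space_eq)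
      have "path_prob ?K killed x (\<lambda>w. ereal t < exit_time (ball x r) w) \<le> emeasure ?K (space ?K - A \<times> {s<..})"
      proof (rule path_prob_le)
        show "AE p in ?K. ereal t < exit_time (ball x r) (killed x p) \<longrightarrow> p \<in> space ?K - A \<times> {s<..}"
          using AE_space
        proof eventually_elim
          case (elim p)
          obtain \<omega> z where p: "p = (\<omega>, z)" by (cases p)
          show ?case
          proof
            assume "ereal t < exit_time (ball x r) (killed x p)"
            then obtain n :: nat where n: "\<And>v. 0 < v \<Longrightarrow> v < t + inverse (Suc n) \<Longrightarrow> killed x p v \<notin> Some ` (- ball x r)"
              unfolding exit_time_def hitting_time_gt_iff by blast
            have "s < t + inverse (Suc n)" using s(3) by (simp add: add_strict_increasing2 less_trans[OF s(3)])
            from n[OF s(1) this] have "\<not> (s < z \<and> r \<le> norm (X s \<omega>))"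
              by (auto simp: p kill_path_in dist_norm)
            then show "p \<in> space ?K - A \<times> {s<..}"
              using elim by (auto simp: p A_def)
          qed
        qed
      qed (use AK in auto)
      also have "\<dots> = ennreal (1 - prob A * exp (- q * s))"
      proof -
        have "emeasure ?K (space ?K - A \<times> {s<..}) = emeasure ?K (space ?K) - emeasure ?K (A \<times> {s<..})"
          using emeasure_kill_times[of A "{s<..}"] A AK by (intro emeasure_compl) auto
        also have "emeasure ?K (space ?K) = ennreal 1"
          using kill.P.emeasure_space_1 by (simp add: kill_space_eq)
        also have "emeasure ?K (A \<times> {s<..}) = ennreal (prob A * exp (- q * s))"
          using emeasure_kill_times[of A "{s<..}"] A expo_gt[of s] s(1) by simp
        finally show ?thesis by (subst ennreal_minus[symmetric]) auto
      qed
      also have "\<dots> \<le> ennreal (1 - exp (- q) / 2)"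
      proof (intro ennreal_leI)
        have "exp (- q) \<le> exp (- q * s)" using q_pos s by (simp add: mult_le_cancel_left1)
        then have "1/2 * exp (- q) \<le> prob A * exp (- q * s)"
          using A_ge by (intro mult_mono) auto
        then show "1 - prob A * exp (- q * s) \<le> 1 - exp (- q) / 2" by simp
      qed
      finally show ?thesis .
    qed
    then have "(SUP x. path_prob (kill_space q M) killed x (\<lambda>w. ereal t < exit_time (ball x r) w)) \<le> ennreal (1 - exp (- q) / 2)"
      by (intro SUP_least)
    then show "(INF r\<in>{0<..}. SUP x. path_prob (kill_space q M) killed x (\<lambda>w. ereal t < exit_time (ball x r) w)) \<le> ennreal (1 - exp (- q) / 2)"
      by (intro INF_lower2[of r]) (auto simp: r_def)
  qed
  also have "\<dots> < ennreal 1" by (rule ennreal_lessI) auto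
  finally show ?thesis by simp
qed

lemma h3_less_1:
  assumes polar: "\<And>y. AE \<omega> in M. \<forall>t>0. X t \<omega> \<noteq> y"
  shows "h3 (kill_space q M) killed < 1"
proof -
  \<comment> \<open>Survival beyond \<open>K\<close> has probability exactly 1/4. Together with a
    probability below 1/4 of coming near before \<open>K\<close> this stays within 1/2.\<close>
  define K where "K = ln 4 / q"
  have K: "0 \<le> K" "exp (- q * K) = 1/4"
    using q_pos by (auto simp: K_def exp_minus)
  let ?K = "kill_space q M"
  have "h3 ?K killed \<le> ennreal (1/2)"
    unfolding h3_def
  proof (rule SUP_least)
    fix u :: real assume "u \<in> {0<..}"
    then obtain r where r: "0 < r" "\<And>w. u \<le> norm w \<Longrightarrow> prob (near K w r) < 1/4"
      using near_small_uniform[OF polar, of u "1/4" K] by auto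
    have "path_prob ?K killed y (\<lambda>w. hitting_time (ball x r) w < lifetime w) \<le> ennreal (1/2)"
      if "u \<le> norm (x - y)" for x y
    proof -
      \<comment> \<open>A hit before the lifetime happens before \<open>K\<close> unless the path
        survives beyond \<open>K\<close>.\<close>
      let ?S = "space M \<times> {K<..} \<union> near K (x - y) r \<times> UNIV"
      have "path_prob ?K killed y (\<lambda>w. hitting_time (ball x r) w < lifetime w) \<le> emeasure ?K ?S"
      proof (rule path_prob_le)
        show "?S \<in> sets ?K"
          by (intro sets.Un) (auto simp: kill_space_eq)
        show "AE p in ?K. hitting_time (ball x r) (killed y p) < lifetime (killed y p) \<longrightarrow> p \<in> ?S"
          using AE_kill_fst[OF AE_cadlag] AE_space AE_kill_pos
        proof eventually_elim
          case (elim p)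
          obtain \<omega> z where p: "p = (\<omega>, z)" by (cases p)
          have \<omega>: "\<omega> \<in> space M" using elim(2) by (simp add: p kill_space_eq space_pair_measure)
          show ?case
          proof
            assume "hitting_time (ball x r) (killed y p) < lifetime (killed y p)"
            then obtain v where v: "0 < v" "v < z" "y + X v \<omega> \<in> ball x r"
              using elim(3) unfolding p hitting_time_less_iff kill_path_in by (auto simp: lifetime_kill)
            show "p \<in> ?S"
            proof (cases "K < z")
              case True
              then show ?thesis using \<omega> by (simp add: p)
            next
              case False
              have "X v \<omega> \<in> ball (x - y) r" using v(3) by (simp add: dist_norm algebra_simps)
              then have "\<exists>c\<in>\<rat>. v < c \<and> c < z \<and> X c \<omega> \<in> ball (x - y) r"
                using v elim(1) by (intro cadlag_right_dense[of "\<lambda>t. X t \<omega>"] Rats_dense_in_real) (auto simp: p)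
              then have "\<omega> \<in> near K (x - y) r"
                using v(1) False \<omega> by (auto simp: near_def dist_commute)
              then show ?thesis by (simp add: p)
            qed
          qed
        qed
      qed
      also have "\<dots> \<le> emeasure ?K (space M \<times> {K<..}) + emeasure ?K (near K (x - y) r \<times> UNIV)"
        by (rule emeasure_subadditive) (auto simp: kill_space_eq)
      also have "\<dots> = ennreal (1/4) + ennreal (prob (near K (x - y) r))"
        using emeasure_kill_times[of "space M" "{K<..}"] emeasure_kill_times[of "near K (x - y) r" UNIV]
          expo_gt[OF K(1)] K(2) prob_space expo.prob_space by simp
      also have "\<dots> \<le> ennreal (1/4) + ennreal (1/4)"
        using r(2)[OF that] by (intro add_left_mono ennreal_leI) simp
      also have "\<dots> = ennreal (1/2)" by (subst ennreal_plus[symmetric]) auto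
      finally show ?thesis .
    qed
    then have "(SUP (x, y)\<in>{(x, y). norm (x - y) \<ge> u}. path_prob ?K killed y (\<lambda>w. hitting_time (ball x r) w < lifetime w)) \<le> ennreal (1/2)"
      by (intro SUP_least) auto
    then show "(INF r\<in>{0<..}. SUP (x, y)\<in>{(x, y). norm (x - y) \<ge> u}.
      path_prob ?K killed y (\<lambda>w. hitting_time (ball x r) w < lifetime w)) \<le> ennreal (1/2)"
      using r(1) by (intro INF_lower2[of r]) auto
  qed
  also have "\<dots> < ennreal 1" by (rule ennreal_lessI) auto
  finally show ?thesis by simp
qed

end

section \<open>Paths that hold at their starting point\<close>

lemma card_image_le_changes:
  "card (f ` {..n::nat}) \<le> Suc (card {k. k < n \<and> f (Suc k) \<noteq> f k})"
proof (induction n)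
  case (Suc n)
  have eq: "{k. k < Suc n \<and> f (Suc k) \<noteq> f k} =
    (if f (Suc n) = f n then {k. k < n \<and> f (Suc k) \<noteq> f k} else insert n {k. k < n \<and> f (Suc k) \<noteq> f k})"
    by (auto simp: less_Suc_eq)
  have "f ` {..Suc n} = insert (f (Suc n)) (f ` {..n})"
    by (simp add: atMost_Suc)
  also have "card \<dots> \<le> (if f (Suc n) = f n then card (f ` {..n}) else Suc (card (f ` {..n})))"
    by (auto simp: insert_absorb card_insert_le_m1 card_insert_if)
  also have "\<dots> \<le> Suc (card {k. k < Suc n \<and> f (Suc k) \<noteq> f k})"
    unfolding eq using Suc by auto
  finally show ?case .
qed simp

text \<open>A subset with \<open>Suc B\<close> elements would lie in \<open>V n\<close> for all
  large \<open>n\<close>. A bound for infinitely many \<open>n\<close> is all that a finite liminf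
  provides.\<close>

lemma finite_UN_incseq:
  assumes "incseq V" "\<And>n. finite (V n)" "\<exists>\<^sub>F n in sequentially. card (V n) \<le> B"
  shows "finite (\<Union>n::nat. V n)"
proof (rule ccontr)
  assume "infinite (\<Union>n. V n)"
  then obtain S where S: "finite S" "card S = Suc B" "S \<subseteq> (\<Union>n. V n)"
    using infinite_arbitrarily_large by blast
  have "\<forall>x\<in>S. \<exists>n. x \<in> V n" using S(3) by blast
  then obtain N where N: "\<And>x. x \<in> S \<Longrightarrow> x \<in> V (N x)" by metis
  define m where "m = Max (N ` S)"
  have "x \<in> V m" if "x \<in> S" for x
  proof -
    have "N x \<le> m" unfolding m_def using S(1) that by (intro Max_ge) auto
    then show ?thesis using N[OF that] incseqD[OF assms(1), of "N x" m] by blast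
  qed
  then have "S \<subseteq> V n" if "m \<le> n" for n
    using incseqD[OF assms(1) that] by blast
  moreover obtain n where "m \<le> n" "card (V n) \<le> B"
    using assms(3) unfolding frequently_sequentially by blast
  ultimately have "card S \<le> B"
    using card_mono[OF assms(2)[of n], of S] by force
  then show False using S(2) by simp
qed

text \<open>A finite set is closed, so the values on a dense set of times are all values before
  \<open>T\<close>; it is also discrete, so right-continuity becomes constancy.\<close>

lemma cadlag_finite_range:
  fixes f :: "real \<Rightarrow> 'a::euclidean_space"
  assumes f: "cadlag f" and fin: "finite (f ` (D \<inter> {0..T}))" and s: "0 \<le> s" "s < T"
    and D: "\<And>u v. 0 \<le> u \<Longrightarrow> u < v \<Longrightarrow> \<exists>p\<in>D. u < p \<and> p < v"
  obtains b where "s < b" "\<And>v. s \<le> v \<Longrightarrow> v < b \<Longrightarrow> f v = f s"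
proof -
  define F where "F = f ` (D \<inter> {0..T})"
  have in_F: "f v \<in> F" if "0 \<le> v" "v < T" for v
  proof (rule ccontr)
    assume "f v \<notin> F"
    moreover have "open (- F)" using fin by (simp add: F_def finite_imp_closed open_Compl)
    ultimately have "\<exists>p\<in>D. v < p \<and> p < T \<and> f p \<in> - F"
      using that D by (intro cadlag_right_dense[OF f]) auto
    then show False using that by (auto simp: F_def)
  qed
  have "open (- (F - {f s}))"
    by (intro open_Compl finite_imp_closed) (use fin in \<open>simp add: F_def\<close>)
  then obtain e where e: "0 < e" "\<And>y. dist y (f s) < e \<Longrightarrow> y \<in> - (F - {f s})"
    unfolding open_dist by (metis ComplI Diff_iff insertI1)
  obtain d where d: "0 < d" "\<And>v. s \<le> v \<Longrightarrow> v < s + d \<Longrightarrow> dist (f v) (f s) < e"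
    using cadlag_right[OF f s(1) e(1)] by blast
  show ?thesis
  proof (rule that[of "min T (s + d)"])
    fix v assume "s \<le> v" "v < min T (s + d)"
    then show "f v = f s"
      using e(2)[of "f v"] d(2)[of v] in_F[of v] s by auto
  qed (use s d in simp)
qed

lemma dyadic_dense:
  fixes t :: real
  assumes "0 < t" "0 \<le> u" "u < v"
  shows "\<exists>n k. u < real k * (t / 2^n) \<and> real k * (t / 2^n) < v"
proof -
  obtain n where n: "t / (v - u) < 2 ^ n"
    using real_arch_pow[of 2 "t / (v - u)"] by auto
  define d where "d = t / 2 ^ n"
  have d: "0 < d" "d < v - u"
    using n assms by (auto simp: d_def field_simps)
  define k where "k = Suc (nat \<lfloor>u / d\<rfloor>)"
  have "real k = of_int \<lfloor>u / d\<rfloor> + 1"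
    using assms d by (simp add: k_def)
  then have "u / d < real k" "real k \<le> u / d + 1" by linarith+
  then have "u < real k * d" "real k * d \<le> u + d"
    using d(1) by (auto simp: field_simps)
  then show ?thesis using d(2) unfolding d_def by (intro exI[of _ n] exI[of _ k]) auto
qed

section \<open>Holding probabilities and step paths\<close>

context levy
begin

text \<open>On a cadlag path this means staying at 0 on \<open>[0, t)\<close>; the value at
  \<open>t\<close> itself is included only for rational \<open>t\<close>.\<close>

definition hold :: "real \<Rightarrow> 'w set" where
  "hold t = {\<omega>\<in>space M. \<forall>v\<in>\<rat> \<inter> {0..t}. X v \<omega> = 0}"

lemma hold_history: "hold t \<in> sets (history t)"
proof -
  have "Measurable.pred (history t) (\<lambda>\<omega>. \<forall>v\<in>\<rat> \<inter> {0..t}. X v \<omega> = 0)"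
  proof (rule pred_Ball_countable)
    fix v assume "v \<in> \<rat> \<inter> {0..t}"
    then have [measurable]: "X v \<in> borel_measurable (history t)" by (intro X_history) auto
    show "Measurable.pred (history t) (\<lambda>\<omega>. X v \<omega> = 0)" by measurable
  qed (auto intro: countable_rat)
  then show ?thesis by (simp add: hold_def pred_def)
qed

lemma hold_events[measurable]: "hold t \<in> events"
  using hold_history by (rule history_events)

lemma prob_future_hold:
  assumes "0 \<le> a"
  shows "prob {\<omega>\<in>space M. \<forall>v\<in>\<rat> \<inter> {0..t}. future a \<omega> v = 0} = prob (hold t)"
proof -
  let ?F = "\<Pi>\<^sub>M v\<in>{0..}. (borel :: 'a measure)"
  define S where "S = {z\<in>space ?F. \<forall>v\<in>\<rat> \<inter> {0..t}. z v = 0}"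
  have S: "S \<in> sets ?F"
  proof -
    have "Measurable.pred ?F (\<lambda>z. \<forall>v\<in>\<rat> \<inter> {0..t}. z v = 0)"
    proof (rule pred_Ball_countable)
      fix v assume "v \<in> \<rat> \<inter> {0..t}"
      then have [measurable]: "(\<lambda>z. z v) \<in> borel_measurable ?F" by (intro measurable_component_singleton) auto
      show "Measurable.pred ?F (\<lambda>z. z v = 0)" by measurable
    qed (auto intro: countable_rat)
    then show ?thesis by (simp add: S_def pred_def)
  qed
  have eq: "prob {\<omega>\<in>space M. \<forall>v\<in>\<rat> \<inter> {0..t}. future b \<omega> v = 0} = measure (distr M ?F (future b)) S" if "0 \<le> b" for b
  proof -
    have "{\<omega>\<in>space M. \<forall>v\<in>\<rat> \<inter> {0..t}. future b \<omega> v = 0} = future b -` S \<inter> space M"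
      using measurable_space[OF future_measurable[OF that]] by (auto simp: S_def)
    then show ?thesis using S future_measurable[OF that] by (simp add: measure_distr)
  qed
  have "prob {\<omega>\<in>space M. \<forall>v\<in>\<rat> \<inter> {0..t}. future a \<omega> v = 0} = prob {\<omega>\<in>space M. \<forall>v\<in>\<rat> \<inter> {0..t}. future 0 \<omega> v = 0}"
    using eq[OF assms] eq[of 0] distr_future[OF assms] by simp
  also have "\<dots> = prob (hold t)"
  proof (rule finite_measure_eq_AE)
    show "AE \<omega> in M. \<omega> \<in> {\<omega>\<in>space M. \<forall>v\<in>\<rat> \<inter> {0..t}. future 0 \<omega> v = 0} \<longleftrightarrow> \<omega> \<in> hold t"
      using AE_future_0 by eventually_elim (auto simp: hold_def)
    have "{\<omega>\<in>space M. \<forall>v\<in>\<rat> \<inter> {0..t}. future 0 \<omega> v = 0} = future 0 -` S \<inter> space M"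
      using measurable_space[OF future_measurable[of 0]] by (auto simp: S_def)
    then show "{\<omega>\<in>space M. \<forall>v\<in>\<rat> \<inter> {0..t}. future 0 \<omega> v = 0} \<in> events"
      using S measurable_sets[OF future_measurable[of 0]] by simp
  qed simp
  finally show ?thesis .
qed

text \<open>Markov property at \<open>s\<close>: after holding up to \<open>s\<close>, the
  increments have to hold for another \<open>t\<close>. Rationality of \<open>s\<close> puts
  \<open>X s = 0\<close> into \<open>hold (s + t)\<close> and keeps shifted times rational.\<close>

lemma prob_hold_add:
  assumes "0 \<le> s" "0 \<le> t" "s \<in> \<rat>"
  shows "prob (hold (s + t)) \<le> prob (hold s) * prob (hold t)"
proof -
  let ?F = "\<Pi>\<^sub>M v\<in>{0..}. (borel :: 'a measure)"
  define \<Psi> where "\<Psi> p \<longleftrightarrow> (\<forall>v\<in>\<rat> \<inter> {0..t}. snd p v = 0)" for p :: "'a \<times> (real \<Rightarrow> 'a)"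
  have \<Psi>: "Measurable.pred (borel \<Otimes>\<^sub>M ?F) \<Psi>"
    unfolding \<Psi>_def
  proof (rule pred_Ball_countable)
    fix v assume "v \<in> \<rat> \<inter> {0..t}"
    then have [measurable]: "(\<lambda>p. snd p v) \<in> borel_measurable ((borel :: 'a measure) \<Otimes>\<^sub>M ?F)"
      by (intro measurable_compose[OF measurable_snd measurable_component_singleton]) auto
    show "Measurable.pred ((borel :: 'a measure) \<Otimes>\<^sub>M ?F) (\<lambda>p. snd p v = 0)" by measurable
  qed (auto intro: countable_rat)
  have fut: "emeasure M {\<omega>'\<in>space M. \<Psi> (y, future 0 \<omega>')} = ennreal (prob (hold t))" for y
    using prob_future_hold[of 0 t] by (simp add: \<Psi>_def emeasure_eq_measure)
  have "{\<omega>\<in>hold s. \<Psi> (X s \<omega>, future s \<omega>)} \<in> events"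
  proof -
    have "{\<omega>\<in>space M. \<Psi> (X s \<omega>, future s \<omega>)} \<in> events"
      using \<Psi> assms(1) by measurable
    then have "hold s \<inter> {\<omega>\<in>space M. \<Psi> (X s \<omega>, future s \<omega>)} \<in> events" by auto
    also have "hold s \<inter> {\<omega>\<in>space M. \<Psi> (X s \<omega>, future s \<omega>)} = {\<omega>\<in>hold s. \<Psi> (X s \<omega>, future s \<omega>)}"
      by (auto simp: hold_def)
    finally show ?thesis .
  qed
  moreover have "hold (s + t) \<subseteq> {\<omega>\<in>hold s. \<Psi> (X s \<omega>, future s \<omega>)}"
  proof
    fix \<omega> assume \<omega>: "\<omega> \<in> hold (s + t)"
    have zero: "X v \<omega> = 0" if "v \<in> \<rat>" "0 \<le> v" "v \<le> s + t" for v
      using \<omega> that by (simp add: hold_def)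
    have "future s \<omega> v = 0" if "v \<in> \<rat> \<inter> {0..t}" for v
      using zero[of "s + v"] zero[of s] that assms by (simp add: future_def)
    then show "\<omega> \<in> {\<omega>\<in>hold s. \<Psi> (X s \<omega>, future s \<omega>)}"
      using \<omega> zero assms by (simp add: hold_def \<Psi>_def)
  qed
  ultimately have "emeasure M (hold (s + t)) \<le> emeasure M {\<omega>\<in>hold s. \<Psi> (X s \<omega>, future s \<omega>)}"
    by (intro emeasure_mono)
  also have "\<dots> = (\<integral>\<^sup>+\<omega>. emeasure M {\<omega>'\<in>space M. \<Psi> (X s \<omega>, future 0 \<omega>')} * indicator (hold s) \<omega> \<partial>M)"
    by (rule markov[OF assms(1) hold_history \<Psi>])
  also have "\<dots> = ennreal (prob (hold t)) * emeasure M (hold s)"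
    unfolding fut by (rule nn_integral_cmult_indicator) simp
  finally show ?thesis
    by (simp add: emeasure_eq_measure ennreal_mult''[symmetric] mult.commute)
qed

lemma prob_hold_halving:
  assumes "0 \<le> t" "t \<in> \<rat>"
  shows "prob (hold t) \<le> prob (hold (t / 2^n)) ^ (2^n)"
proof (induction n)
  case (Suc n)
  have half: "t / 2 ^ n = t / 2 ^ Suc n + t / 2 ^ Suc n" by (simp add: field_simps)
  have "prob (hold (t / 2 ^ n)) \<le> prob (hold (t / 2 ^ Suc n)) ^ 2"
    using prob_hold_add[of "t / 2 ^ Suc n" "t / 2 ^ Suc n"] assms unfolding half power2_eq_square
    by simp
  then have "prob (hold (t / 2 ^ n)) ^ (2 ^ n) \<le> (prob (hold (t / 2 ^ Suc n)) ^ 2) ^ (2 ^ n)"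
    by (rule power_mono) simp
  with Suc show ?case by (simp add: power_mult[symmetric])
qed simp

text \<open>Inserting \<open>a \<le> exp (a - 1)\<close> into \<open>prob_hold_halving\<close> shows
  that a dyadic step moves with probability of order \<open>1 / 2^n\<close>, the rate at which the
  expected number of moves over all steps stays bounded.\<close>

lemma prob_hold_dyadic:
  assumes "0 \<le> t" "t \<in> \<rat>" "0 < prob (hold t)"
  shows "1 - prob (hold (t / 2^n)) \<le> - ln (prob (hold t)) / 2^n"
proof -
  define a where "a = prob (hold (t / 2^n))"
  have "prob (hold t) \<le> a ^ (2^n)"
    using prob_hold_halving[OF assms(1,2)] by (simp add: a_def)
  also have "\<dots> \<le> exp (- (1 - a)) ^ (2^n)"
    using exp_ge_add_one_self[of "a - 1"] by (intro power_mono) (auto simp: a_def)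
  also have "\<dots> = exp (- (1 - a) * 2^n)"
    by (simp add: exp_of_nat_mult[symmetric] mult.commute)
  finally have "ln (prob (hold t)) \<le> ln (exp (- (1 - a) * 2^n))"
    using assms(3) by (subst ln_le_cancel_iff) auto
  then show ?thesis by (simp add: a_def field_simps)
qed

text \<open>The expected number of changes along the dyadic grids is bounded, so by Fatou's lemma only
  finitely many values occur on all these grids together.\<close>

lemma AE_finite_range:
  assumes t: "0 < t" "t \<in> \<rat>" "0 < prob (hold t)"
  shows "AE \<omega> in M. finite ((\<lambda>v. X v \<omega>) ` (range (\<lambda>(n, k). real k * (t / 2^n)) \<inter> {0..real m * t}))"
proof -
  define C where "C = - ln (prob (hold t))"
  have "0 \<le> C" using t(3) prob_le_1[of "hold t"] by (simp add: C_def)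
  define d where "d n = t / 2^n" for n :: nat
  have d: "0 < d n" "d n \<in> \<rat>" for n using t by (auto simp: d_def)
  define J where "J n k = {\<omega>\<in>space M. X (real (Suc k) * d n) \<omega> \<noteq> X (real k * d n) \<omega>}" for n k
  have J: "J n k \<in> events" for n k
  proof -
    have [measurable]: "X (real (Suc k) * d n) \<in> borel_measurable M" "X (real k * d n) \<in> borel_measurable M"
      using d(1)[of n] by (auto intro!: X_measurable)
    show ?thesis unfolding J_def by measurable
  qed
  \<comment> \<open>By stationarity a change over one step is as likely as
    \<open>X (d n) \<noteq> 0\<close>, which is outside \<open>hold (d n)\<close> because
    \<open>d n\<close> is rational.\<close>
  have prob_J: "emeasure M (J n k) \<le> ennreal (C / 2^n)" for n k
  proof -
    have dn: "0 \<le> d n" "0 \<le> real k * d n" using d(1)[of n] by auto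
    have [measurable]: "X (d n) \<in> borel_measurable M" "(\<lambda>\<omega>. X (real k * d n + d n) \<omega> - X (real k * d n) \<omega>) \<in> borel_measurable M"
      using dn by (auto intro!: X_measurable borel_measurable_diff)
    have "J n k = (\<lambda>\<omega>. X (real k * d n + d n) \<omega> - X (real k * d n) \<omega>) -` (- {0}) \<inter> space M"
      by (auto simp: J_def algebra_simps)
    then have "emeasure M (J n k) = emeasure (distr M borel (\<lambda>\<omega>. X (real k * d n + d n) \<omega> - X (real k * d n) \<omega>)) (- {0})"
      by (simp add: emeasure_distr)
    also have "\<dots> = emeasure (distr M borel (X (d n))) (- {0})"
      using distr_increment[OF dn(2,1)] by simp
    also have "\<dots> = emeasure M (X (d n) -` (- {0}) \<inter> space M)"
      by (simp add: emeasure_distr)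
    also have "\<dots> \<le> emeasure M (space M - hold (d n))"
    proof (rule emeasure_mono)
      show "X (d n) -` (- {0}) \<inter> space M \<subseteq> space M - hold (d n)"
        using d(2)[of n] dn(1) by (auto simp: hold_def)
    qed auto
    also have "\<dots> = ennreal (1 - prob (hold (d n)))"
      by (simp add: emeasure_eq_measure prob_compl)
    also have "\<dots> \<le> ennreal (C / 2^n)"
      using prob_hold_dyadic[OF less_imp_le[OF t(1)] t(2,3), of n] by (intro ennreal_leI) (simp add: C_def d_def)
    finally show ?thesis .
  qed
  define N where "N n = m * 2^n" for n :: nat
  define S where "S n \<omega> = (\<Sum>k<N n. indicator (J n k) \<omega> :: ennreal)" for n \<omega>
  have S[measurable]: "S n \<in> borel_measurable M" for n
    unfolding S_def[abs_def] using J by measurable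
  have int_S: "(\<integral>\<^sup>+\<omega>. S n \<omega> \<partial>M) \<le> ennreal (real m * C)" for n
  proof -
    have "(\<integral>\<^sup>+\<omega>. S n \<omega> \<partial>M) = (\<Sum>k<N n. emeasure M (J n k))"
      unfolding S_def using J by (subst nn_integral_sum) auto
    also have "\<dots> \<le> (\<Sum>k<N n. ennreal (C / 2^n))"
      by (intro sum_mono prob_J)
    also have "\<dots> = ennreal (real (N n) * (C / 2^n))"
      using \<open>0 \<le> C\<close> by (subst sum_ennreal) auto
    finally show ?thesis by (simp add: N_def)
  qed
  have "(\<integral>\<^sup>+\<omega>. liminf (\<lambda>n. S n \<omega>) \<partial>M) \<le> liminf (\<lambda>n. \<integral>\<^sup>+\<omega>. S n \<omega> \<partial>M)"
    by (intro nn_integral_liminf) simp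
  also have "\<dots> \<le> liminf (\<lambda>n::nat. ennreal (real m * C))"
    by (intro Liminf_mono always_eventually allI int_S)
  also have "\<dots> = ennreal (real m * C)" by (simp add: Liminf_const)
  finally have "(\<integral>\<^sup>+\<omega>. liminf (\<lambda>n. S n \<omega>) \<partial>M) \<noteq> \<infinity>"
    by (metis ennreal_neq_top infinity_ennreal_def top.extremum_uniqueI)
  then have "AE \<omega> in M. liminf (\<lambda>n. S n \<omega>) \<noteq> \<infinity>"
    by (intro nn_integral_PInf_AE) auto
  then show ?thesis
    using AE_space
  proof eventually_elim
    case (elim \<omega>)
    define f where "f v = X v \<omega>" for v
    obtain B :: nat where B: "liminf (\<lambda>n. S n \<omega>) < of_nat B"
      using elim(1) ennreal_Ex_less_of_nat[of "liminf (\<lambda>n. S n \<omega>)"] by (auto simp: less_top)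
    define V where "V n = (\<lambda>k. f (real k * d n)) ` {..N n}" for n
    have "\<exists>\<^sub>F n in sequentially. S n \<omega> < of_nat B"
    proof (rule ccontr)
      assume "\<not> ?thesis"
      then have "\<forall>\<^sub>F n in sequentially. of_nat B \<le> S n \<omega>"
        by (simp add: frequently_def not_less)
      then have "of_nat B \<le> liminf (\<lambda>n. S n \<omega>)" by (rule Liminf_bounded)
      with B show False by simp
    qed
    moreover have "card (V n) \<le> B" if "S n \<omega> < of_nat B" for n
    proof -
      have "S n \<omega> = of_nat (card {k. k < N n \<and> f (real (Suc k) * d n) \<noteq> f (real k * d n)})"
      proof -
        have "S n \<omega> = (\<Sum>k\<in>{..<N n}. of_bool (f (real (Suc k) * d n) \<noteq> f (real k * d n)))"
          unfolding S_def using elim(2) by (intro sum.cong) (auto simp: J_def f_def indicator_def)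
        also have "\<dots> = of_nat (card ({..<N n} \<inter> {k. f (real (Suc k) * d n) \<noteq> f (real k * d n)}))"
          by (simp only: sum_of_bool_eq finite_lessThan)
        finally show ?thesis by (simp add: Int_def)
      qed
      then have "card {k. k < N n \<and> f (real (Suc k) * d n) \<noteq> f (real k * d n)} < B"
        using that by (simp add: of_nat_less_iff)
      then show ?thesis
        using card_image_le_changes[of "\<lambda>k. f (real k * d n)" "N n"] by (simp add: V_def)
    qed
    ultimately have freq: "\<exists>\<^sub>F n in sequentially. card (V n) \<le> B"
      by (rule frequently_elim1)
    \<comment> \<open>The grids are nested: point \<open>k\<close> of one is point
      \<open>2 * k\<close> of the next.\<close>
    have "incseq V"
    proof (rule incseq_SucI)
      fix n
      show "V n \<subseteq> V (Suc n)"
      proof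
        fix y assume "y \<in> V n"
        then obtain k where k: "k \<le> N n" "y = f (real k * d n)" by (auto simp: V_def)
        have eq: "real k * d n = real (2 * k) * d (Suc n)" by (simp add: d_def)
        show "y \<in> V (Suc n)"
          unfolding V_def
        proof (rule image_eqI)
          show "y = f (real (2 * k) * d (Suc n))" using k(2) by (simp only: eq)
          show "2 * k \<in> {..N (Suc n)}" using k(1) by (simp add: N_def)
        qed
      qed
    qed
    moreover have "finite (V n)" for n by (simp add: V_def)
    ultimately have "finite (\<Union>n. V n)"
      using freq by (rule finite_UN_incseq)
    moreover have "f ` (range (\<lambda>(n, k). real k * (t / 2^n)) \<inter> {0..real m * t}) \<subseteq> (\<Union>n. V n)"
    proof safe
      fix n k assume "real k * (t / 2^n) \<in> {0..real m * t}"
      then have "real k \<le> real (N n)"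
        using t(1) by (simp add: N_def field_simps)
      then have "k \<le> N n" by (simp only: of_nat_le_iff)
      then show "f (real k * (t / 2^n)) \<in> (\<Union>n. V n)" by (auto simp: V_def d_def)
    qed
    ultimately show ?case
      unfolding f_def by (rule finite_subset[rotated])
  qed
qed

text \<open>The dyadic grids are dense together, so the finitely many values on them up to time
  \<open>m * t\<close> determine the path there.\<close>

lemma AE_right_constant:
  assumes t: "0 < t" "t \<in> \<rat>" "0 < prob (hold t)"
  shows "AE \<omega> in M. \<forall>s\<ge>0. \<exists>b>s. \<forall>v. s \<le> v \<longrightarrow> v < b \<longrightarrow> X v \<omega> = X s \<omega>"
proof -
  have "AE \<omega> in M. \<forall>m::nat. finite ((\<lambda>v. X v \<omega>) ` (range (\<lambda>(n, k). real k * (t / 2^n)) \<inter> {0..real m * t}))"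
    by (subst AE_all_countable) (intro allI AE_finite_range t)
  then show ?thesis
    using AE_cadlag
  proof eventually_elim
    case (elim \<omega>)
    show ?case
    proof (intro allI impI)
      fix s :: real assume "0 \<le> s"
      obtain m :: nat where "s / t < real m" using reals_Archimedean2 by blast
      then have m: "s < real m * t" using t(1) by (simp add: field_simps)
      have dense: "\<exists>p\<in>range (\<lambda>(n, k). real k * (t / 2^n)). u < p \<and> p < v" if uv: "0 \<le> u" "u < v" for u v
      proof -
        obtain n k where "u < real k * (t / 2^n)" "real k * (t / 2^n) < v"
          using dyadic_dense[OF t(1) uv] by blast
        then show ?thesis by (intro bexI[of _ "real k * (t / 2^n)"]) auto
      qed
      obtain b where "s < b" "\<And>v. s \<le> v \<Longrightarrow> v < b \<Longrightarrow> X v \<omega> = X s \<omega>"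
        using cadlag_finite_range[OF elim(2) elim(1)[rule_format, of m] \<open>0 \<le> s\<close> m dense] by blast
      then show "\<exists>b>s. \<forall>v. s \<le> v \<longrightarrow> v < b \<longrightarrow> X v \<omega> = X s \<omega>" by blast
    qed
  qed
qed

end

section \<open>Consequences of \<open>h1 < 1\<close>\<close>

context killed_levy
begin

text \<open>Right-constant paths make the exit times measurable up to a null set; without this,
  \<^const>\<open>path_prob\<close> could be 0 and \<^const>\<open>h1\<close> could not be bounded from below.\<close>

lemma path_prob_exit_ge:
  assumes t: "0 < t" "t \<in> \<rat>" "0 < prob (hold t)" and s: "0 < s" "0 < r"
  shows "ennreal (prob (hold s)) \<le> path_prob (kill_space q M) killed x (\<lambda>w. ereal (s/2) < exit_time (ball x r) w)"
proof -
  let ?K = "kill_space q M"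
  define S where "S = {p\<in>space ?K. \<exists>n::nat. \<forall>v\<in>\<rat> \<inter> {0<..<s/2 + inverse (Suc n)}. \<not> (v < snd p \<and> r \<le> norm (X v (fst p)))}"
  have S: "S \<in> sets ?K"
  proof -
    have "Measurable.pred ?K (\<lambda>p. \<exists>n::nat. \<forall>v\<in>\<rat> \<inter> {0<..<s/2 + inverse (Suc n)}. \<not> (v < snd p \<and> r \<le> norm (X v (fst p))))"
    proof (intro pred_intros_countable pred_Ball_countable)
      fix n :: nat and v assume "v \<in> \<rat> \<inter> {0<..<s/2 + inverse (Suc n)}"
      then have [measurable]: "X v \<in> borel_measurable M" by (intro X_measurable) auto
      show "Measurable.pred ?K (\<lambda>p. \<not> (v < snd p \<and> r \<le> norm (X v (fst p))))"
        unfolding kill_space_eq by measurable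
    qed (auto intro: countable_rat)
    then show ?thesis by (simp add: S_def pred_def)
  qed
  have "emeasure ?K (hold s \<times> UNIV) \<le> path_prob ?K killed x (\<lambda>w. ereal (s/2) < exit_time (ball x r) w)"
  proof (rule path_prob_ge[OF _ S])
    show "AE p in ?K. ereal (s/2) < exit_time (ball x r) (killed x p) \<longleftrightarrow> p \<in> S"
      using AE_kill_fst[OF AE_right_constant[OF t]] AE_space
    proof eventually_elim
      case (elim p)
      obtain \<omega> z where p: "p = (\<omega>, z)" by (cases p)
      have ball: "x + y \<in> - ball x r \<longleftrightarrow> r \<le> norm y" for y
        by (simp add: dist_norm not_less)
      \<comment> \<open>Constancy to the right carries the closed condition
        \<open>r \<le> norm (X v \<omega>)\<close> over to a rational time; right-continuity alone
        could lose it on the boundary of the ball.\<close>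
      have rational: "(\<forall>v. 0 < v \<longrightarrow> v < c \<longrightarrow> \<not> (v < z \<and> r \<le> norm (X v \<omega>))) \<longleftrightarrow>
        (\<forall>v\<in>\<rat> \<inter> {0<..<c}. \<not> (v < z \<and> r \<le> norm (X v \<omega>)))" for c
      proof (intro iffI allI impI notI)
        fix v assume R: "\<forall>v\<in>\<rat> \<inter> {0<..<c}. \<not> (v < z \<and> r \<le> norm (X v \<omega>))"
          and v: "0 < v" "v < c" "v < z \<and> r \<le> norm (X v \<omega>)"
        obtain b where b: "v < b" "\<And>v'. v \<le> v' \<Longrightarrow> v' < b \<Longrightarrow> X v' \<omega> = X v \<omega>"
          using elim(1) v(1) unfolding p fst_conv by (meson less_imp_le)
        obtain v' where "v' \<in> \<rat>" "v < v'" "v' < min b (min c z)"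
          using Rats_dense_in_real[of v "min b (min c z)"] b(1) v by auto
        then show False using R b(2)[of v'] v by force
      qed auto
      then show ?case
        using elim(2) unfolding exit_time_def hitting_time_gt_iff p kill_path_in ball rational
        by (simp add: S_def)
    qed
    show "AE p in ?K. p \<in> hold s \<times> UNIV \<longrightarrow> p \<in> S"
      using AE_space
    proof eventually_elim
      case (elim p)
      show ?case
      proof
        assume p: "p \<in> hold s \<times> UNIV"
        \<comment> \<open>Exiting after \<open>s/2\<close> asks for slightly more than
          \<open>s/2\<close>; with this margin the window still ends before \<open>s\<close>, the
          end of the holding period.\<close>
        obtain n :: nat where n: "inverse (Suc n) < s/2"
          using reals_Archimedean[of "s/2"] s(1) by auto
        have "X v (fst p) = 0" if "v \<in> \<rat> \<inter> {0<..<s/2 + inverse (Suc n)}" for v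
        proof -
          have "v \<in> \<rat> \<inter> {0..s}" using that n by auto
          then show ?thesis using p by (auto simp: hold_def)
        qed
        then show "p \<in> S" using elim s(2) by (auto simp: S_def intro!: exI[of _ n])
      qed
    qed
  qed
  then show ?thesis
    using emeasure_kill_times[of "hold s" UNIV] expo.prob_space by simp
qed

text \<open>A path that holds leaves no ball, however small, so each holding probability survives
  the infimum over \<open>r\<close> and bounds \<open>h1\<close> from below. If one of them is
  positive, they tend to 1 along \<open>t' / 2^n\<close>.\<close>

lemma prob_hold_eq_0:
  assumes h1: "h1 (kill_space q M) killed < 1" and "0 < t"
  shows "prob (hold t) = 0"
proof (rule ccontr)
  assume "prob (hold t) \<noteq> 0"
  then have pos: "0 < prob (hold t)" by (simp add: zero_less_measure_iff)
  \<comment> \<open>The halving estimates are for rational times.\<close>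
  obtain t' where t': "0 < t'" "t' < t" "t' \<in> \<rat>"
    using Rats_dense_in_real[OF \<open>0 < t\<close>] by blast
  have "prob (hold t) \<le> prob (hold t')"
  proof (rule finite_measure_mono)
    show "hold t \<subseteq> hold t'" using t' by (auto simp: hold_def)
  qed simp
  then have pos': "0 < prob (hold t')" using pos by simp
  have lower: "ennreal (prob (hold s)) \<le> h1 (kill_space q M) killed" if "0 < s" for s
  proof -
    have "ennreal (prob (hold s)) \<le> (INF r\<in>{0<..}. SUP x. path_prob (kill_space q M) killed x (\<lambda>w. ereal (s/2) < exit_time (ball x r) w))"
    proof (rule INF_greatest)
      fix r :: real assume "r \<in> {0<..}"
      then show "ennreal (prob (hold s)) \<le> (SUP x. path_prob (kill_space q M) killed x (\<lambda>w. ereal (s/2) < exit_time (ball x r) w))"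
        using path_prob_exit_ge[OF t'(1,3) pos' that] by (intro SUP_upper2[of 0]) auto
    qed
    also have "\<dots> \<le> h1 (kill_space q M) killed"
      unfolding h1_def using that by (intro SUP_upper2[of "s/2"]) auto
    finally show ?thesis .
  qed
  have "(\<lambda>n. prob (hold (t' / 2^n))) \<longlonglongrightarrow> 1"
  proof (rule real_tendsto_sandwich)
    show "\<forall>\<^sub>F n in sequentially. 1 + ln (prob (hold t')) * (1/2) ^ n \<le> prob (hold (t' / 2^n))"
      using prob_hold_dyadic[OF less_imp_le[OF t'(1)] t'(3) pos'] by (intro always_eventually) (simp add: field_simps power_divide)
    have "(\<lambda>n. 1 + ln (prob (hold t')) * (1/2) ^ n) \<longlonglongrightarrow> 1 + ln (prob (hold t')) * 0"
      by (intro tendsto_intros LIMSEQ_power_zero) simp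
    then show "(\<lambda>n. 1 + ln (prob (hold t')) * (1/2) ^ n) \<longlonglongrightarrow> 1" by simp
    show "\<forall>\<^sub>F n in sequentially. prob (hold (t' / 2^n)) \<le> 1" by simp
  qed simp
  then have "(\<lambda>n. ennreal (prob (hold (t' / 2^n)))) \<longlonglongrightarrow> ennreal 1"
    by (intro tendsto_ennrealI)
  then have "ennreal 1 \<le> h1 (kill_space q M) killed"
    using lower t'(1) by (intro LIMSEQ_le_const2) auto
  then show False using h1 by simp
qed

text \<open>Rational intervals suffice, which leaves countably many null sets. Inside such an
  interval two values differ, so one of them is not \<open>x\<close>.\<close>

lemma AE_not_constant:
  assumes h1: "h1 (kill_space q M) killed < 1"
  shows "AE \<omega> in M. \<forall>a b x. 0 \<le> a \<longrightarrow> a < b \<longrightarrow> (\<exists>v\<in>\<rat>. a < v \<and> v < b \<and> X v \<omega> \<noteq> x)"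
proof -
  have "AE \<omega> in M. \<exists>v\<in>\<rat> \<inter> {0..t}. X (a + v) \<omega> \<noteq> X a \<omega>" if "0 \<le> a" "0 < t" for a t
  proof -
    have "AE \<omega> in M. \<not> (\<forall>v\<in>\<rat> \<inter> {0..t}. future a \<omega> v = 0)"
    proof -
      have "{\<omega>\<in>space M. \<forall>v\<in>\<rat> \<inter> {0..t}. future a \<omega> v = 0} \<in> events"
      proof -
        have "Measurable.pred M (\<lambda>\<omega>. \<forall>v\<in>\<rat> \<inter> {0..t}. future a \<omega> v = 0)"
        proof (rule pred_Ball_countable)
          fix v assume "v \<in> \<rat> \<inter> {0..t}"
          then have [measurable]: "(\<lambda>\<omega>. future a \<omega> v) \<in> borel_measurable M"
            using that by (intro measurable_compose[OF future_measurable measurable_component_singleton]) auto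
          show "Measurable.pred M (\<lambda>\<omega>. future a \<omega> v = 0)" by measurable
        qed (auto intro: countable_rat)
        then show ?thesis by (simp add: pred_def)
      qed
      then show ?thesis
        using prob_future_hold[OF that(1), of t] prob_hold_eq_0[OF h1 that(2)]
        by (subst AE_iff_measurable[OF _ refl]) (auto simp: emeasure_eq_measure)
    qed
    then show ?thesis by eventually_elim (auto simp: future_def)
  qed
  then have "AE \<omega> in M. \<forall>a\<in>\<rat>. \<forall>t\<in>\<rat>. 0 \<le> a \<longrightarrow> 0 < t \<longrightarrow> (\<exists>v\<in>\<rat> \<inter> {0..t}. X (a + v) \<omega> \<noteq> X a \<omega>)"
    by (simp add: AE_ball_countable countable_rat)
  then show ?thesis
  proof eventually_elim
    case (elim \<omega>)
    show ?case
    proof (intro allI impI)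
      fix a b :: real and x assume ab: "0 \<le> a" "a < b"
      obtain c where c: "c \<in> \<rat>" "a < c" "c < b" using Rats_dense_in_real[OF ab(2)] by blast
      obtain e where e: "e \<in> \<rat>" "c < e" "e < b" using Rats_dense_in_real[OF c(3)] by blast
      obtain v where v: "v \<in> \<rat>" "0 \<le> v" "v \<le> e - c" "X (c + v) \<omega> \<noteq> X c \<omega>"
        using elim[rule_format, of c "e - c"] c e ab by auto
      have "c + v \<in> \<rat>" "a < c + v" "c + v < b" using c e v by auto
      then show "\<exists>v\<in>\<rat>. a < v \<and> v < b \<and> X v \<omega> \<noteq> x"
        using v(4) c by (cases "X c \<omega> = x") auto
    qed
  qed
qed

end

section \<open>Points are not hit\<close>

text \<open>The killing time is independent of the path, so dividing by the probability of surviving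
  beyond \<theta> removes the killing. As \<open>h3\<close> is a supremum over \<open>u\<close>, the
  constants \<theta> and \<kappa> serve all \<open>u\<close>, and only the radius depends on
  \<open>u\<close>.\<close>

lemma (in killed_levy) near_bound:
  assumes h3: "h3 (kill_space q M) killed < 1"
  obtains \<theta> \<kappa> where "0 < \<theta>" "0 \<le> \<kappa>" "\<kappa> < 1"
    "\<And>u. 0 < u \<Longrightarrow> \<exists>r>0. \<forall>w. u \<le> norm w \<longrightarrow> prob (near \<theta> w r) \<le> \<kappa>"
proof -
  let ?K = "kill_space q M"
  \<comment> \<open>The strict gap above \<open>h3\<close> is what allows a radius to be picked from
    the infimum; it also makes \<open>c\<close> positive.\<close>
  obtain c' where c': "h3 ?K killed < c'" "c' < 1" using dense[OF h3] by blast
  define c where "c = enn2real c'"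
  have c: "c' = ennreal c" "0 < c" "c < 1"
  proof -
    show eq: "c' = ennreal c"
      using less_trans[OF c'(2) ennreal_one_less_top] by (simp add: c_def)
    show "0 < c" using order.strict_trans1[OF zero_le c'(1)] by (simp add: eq)
    show "c < 1" using c'(2) by (simp add: eq ennreal_less_one_iff)
  qed
  \<comment> \<open>Any \<kappa> strictly between \<open>c\<close> and 1 would do. Then \<theta> is
    the time with survival probability \<open>c / \<kappa>\<close>, so that
    \<open>prob (near \<theta> w r) * (c / \<kappa>) \<le> c\<close> gives the bound
    \<kappa>.\<close>
  define \<kappa> where "\<kappa> = (1 + c) / 2"
  define \<theta> where "\<theta> = ln (\<kappa> / c) / q"
  have \<kappa>: "0 \<le> \<kappa>" "\<kappa> < 1" "c < \<kappa>" using c by (auto simp: \<kappa>_def)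
  then have \<theta>: "0 < \<theta>" "exp (- q * \<theta>) = c / \<kappa>"
    using c q_pos by (auto simp: \<theta>_def exp_minus)
  show ?thesis
  proof (rule that[OF \<theta>(1) \<kappa>(1,2)])
    fix u :: real assume u: "0 < u"
    have "(INF r\<in>{0<..}. SUP (x, y)\<in>{(x, y). norm (x - y) \<ge> u}.
      path_prob ?K killed y (\<lambda>w. hitting_time (ball x r) w < lifetime w)) \<le> h3 ?K killed"
      unfolding h3_def using u by (intro SUP_upper) auto
    also have "\<dots> < c'" by (rule c')
    finally obtain r where r: "0 < r" "(SUP (x, y)\<in>{(x, y). norm (x - y) \<ge> u}.
      path_prob ?K killed y (\<lambda>w. hitting_time (ball x r) w < lifetime w)) < c'"
      unfolding INF_less_iff by auto
    show "\<exists>r>0. \<forall>w. u \<le> norm w \<longrightarrow> prob (near \<theta> w r) \<le> \<kappa>"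
    proof (intro exI[of _ r] conjI allI impI r(1))
      fix w :: 'a assume w: "u \<le> norm w"
      define S where "S = {p\<in>space ?K. \<exists>v\<in>\<rat> \<inter> {0<..}. v < snd p \<and> dist (X v (fst p)) w < r}"
      have S: "S \<in> sets ?K"
      proof -
        have "Measurable.pred ?K (\<lambda>p. \<exists>v\<in>\<rat> \<inter> {0<..}. v < snd p \<and> dist (X v (fst p)) w < r)"
        proof (rule pred_Bex_countable)
          fix v :: real assume "v \<in> \<rat> \<inter> {0<..}"
          then have [measurable]: "X v \<in> borel_measurable M" by (intro X_measurable) auto
          show "Measurable.pred ?K (\<lambda>p. v < snd p \<and> dist (X v (fst p)) w < r)"
            unfolding kill_space_eq by measurable
        qed (auto intro: countable_rat)
        then show ?thesis by (simp add: S_def pred_def)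
      qed
      have "emeasure ?K (near \<theta> w r \<times> {\<theta><..}) \<le> path_prob ?K killed 0 (\<lambda>p. hitting_time (ball w r) p < lifetime p)"
      proof (rule path_prob_ge[OF _ S])
        show "AE p in ?K. hitting_time (ball w r) (killed 0 p) < lifetime (killed 0 p) \<longleftrightarrow> p \<in> S"
          using AE_kill_fst[OF AE_cadlag] AE_space AE_kill_pos
        proof eventually_elim
          case (elim p)
          obtain \<omega> z where p: "p = (\<omega>, z)" by (cases p)
          have "hitting_time (ball w r) (killed 0 p) < lifetime (killed 0 p) \<longleftrightarrow> (\<exists>t>0. t < z \<and> X t \<omega> \<in> ball w r)"
            using elim(3) unfolding p hitting_time_less_iff kill_path_in by (auto simp: lifetime_kill)
          also have "\<dots> \<longleftrightarrow> (\<exists>v\<in>\<rat> \<inter> {0<..}. v < z \<and> X v \<omega> \<in> ball w r)"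
          proof
            assume "\<exists>t>0. t < z \<and> X t \<omega> \<in> ball w r"
            then obtain t where t: "0 < t" "t < z" "X t \<omega> \<in> ball w r" by blast
            then have "\<exists>v\<in>\<rat>. t < v \<and> v < z \<and> X v \<omega> \<in> ball w r"
              using elim(1) by (intro cadlag_right_dense[of "\<lambda>t. X t \<omega>"] Rats_dense_in_real) (auto simp: p)
            then show "\<exists>v\<in>\<rat> \<inter> {0<..}. v < z \<and> X v \<omega> \<in> ball w r"
              using t(1) by fastforce
          qed auto
          also have "\<dots> \<longleftrightarrow> p \<in> S"
            using elim(2) by (simp add: S_def p dist_commute)
          finally show ?case .
        qed
        show "AE p in ?K. p \<in> near \<theta> w r \<times> {\<theta><..} \<longrightarrow> p \<in> S"
          using AE_space
        proof eventually_elim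
          case (elim p)
          show ?case
          proof
            assume "p \<in> near \<theta> w r \<times> {\<theta><..}"
            then obtain v where "v \<in> \<rat>" "0 < v" "v < \<theta>" "dist (X v (fst p)) w < r" "\<theta> < snd p"
              by (auto simp: near_def)
            then show "p \<in> S" using elim by (auto simp: S_def intro!: bexI[of _ v])
          qed
        qed
      qed
      also have "\<dots> \<le> (SUP (x, y)\<in>{(x, y). norm (x - y) \<ge> u}.
        path_prob ?K killed y (\<lambda>w. hitting_time (ball x r) w < lifetime w))"
        using w by (intro SUP_upper2[of "(w, 0)"]) auto
      also have "\<dots> \<le> ennreal c" using r(2) c(1) by simp
      finally have "prob (near \<theta> w r) * (c / \<kappa>) \<le> c"
        using emeasure_kill_times[of "near \<theta> w r" "{\<theta><..}"] expo_gt[of \<theta>] \<theta> c(2) by simp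
      then show "prob (near \<theta> w r) \<le> \<kappa>"
        using c(2) \<kappa>(3) by (simp add: field_simps)
    qed
  qed
qed

text \<open>The consequences of \<open>h1 < 1\<close> and \<open>h3 < 1\<close> for the process
  without killing, from which polarity is derived.\<close>

locale avoiding_levy = levy M X for M :: "'w measure" and X :: "real \<Rightarrow> 'w \<Rightarrow> 'a::euclidean_space" +
  fixes \<theta> \<kappa> :: real
  assumes \<theta>: "0 < \<theta>" and \<kappa>: "0 \<le> \<kappa>" "\<kappa> < 1"
    and near_le: "\<And>u. 0 < u \<Longrightarrow> \<exists>r>0. \<forall>w. u \<le> norm w \<longrightarrow> prob (near \<theta> w r) \<le> \<kappa>"
    and not_constant: "AE \<omega> in M. \<forall>a b x. 0 \<le> a \<longrightarrow> a < b \<longrightarrow> (\<exists>v\<in>\<rat>. a < v \<and> v < b \<and> X v \<omega> \<noteq> x)"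
begin

text \<open>The strong Markov property at the first time \<open>a\<close> for which \<open>B a\<close> occurs.\<close>

lemma prob_return_finite:
  assumes F: "finite F" "F \<subseteq> {c..<c + \<theta>}" "0 \<le> c"
    and B: "\<And>a. a \<in> F \<Longrightarrow> B a \<in> sets (history a)"
    and far: "\<And>a \<omega>. a \<in> F \<Longrightarrow> \<omega> \<in> B a \<Longrightarrow> u \<le> dist (X a \<omega>) x"
    and near: "\<And>w. u \<le> norm w \<Longrightarrow> prob (near \<theta> w r) \<le> \<kappa>"
  shows "prob {\<omega>\<in>space M. \<exists>a\<in>F. \<exists>b\<in>F. a < b \<and> \<omega> \<in> B a \<and> dist (X b \<omega>) x < r} \<le> \<kappa> * prob (\<Union>a\<in>F. B a)"
proof -
  let ?F = "\<Pi>\<^sub>M v\<in>{0..}. (borel :: 'a measure)"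
  have pos: "0 \<le> a" if "a \<in> F" for a using F that by auto
  \<comment> \<open>The events \<open>first a\<close> are disjoint, so the bounds over the different
    first times add up to at most \<kappa> times the probability of the union.\<close>
  define first where "first a = B a - (\<Union>a'\<in>{a'\<in>F. a' < a}. B a')" for a
  define \<Psi> where "\<Psi> a p \<longleftrightarrow> (\<exists>b\<in>{b\<in>F. a < b}. dist (fst p + snd p (b - a)) x < r)" for a and p :: "'a \<times> (real \<Rightarrow> 'a)"
  have first: "first a \<in> sets (history a)" if "a \<in> F" for a
    unfolding first_def
  proof (intro sets.Diff B that sets.finite_UN)
    show "B a' \<in> sets (history a)" if "a' \<in> {a'\<in>F. a' < a}" for a'
      using history_mono[OF B[of a'], of a] that by auto
  qed (use F in auto)
  have first_events[measurable]: "first a \<in> events" if "a \<in> F" for a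
    using first[OF that] by (rule history_events)
  have \<Psi>: "Measurable.pred (borel \<Otimes>\<^sub>M ?F) (\<Psi> a)" for a
    unfolding \<Psi>_def
  proof (rule pred_Bex_countable)
    fix b assume "b \<in> {b\<in>F. a < b}"
    then have [measurable]: "(\<lambda>p. snd p (b - a)) \<in> borel_measurable ((borel :: 'a measure) \<Otimes>\<^sub>M ?F)"
      by (intro measurable_compose[OF measurable_snd measurable_component_singleton]) auto
    show "Measurable.pred (borel \<Otimes>\<^sub>M ?F) (\<lambda>p. dist (fst p + snd p (b - a)) x < r)" by measurable
  qed (use F in \<open>auto intro: countable_finite\<close>)
  define R where "R a = {\<omega>\<in>first a. \<Psi> a (X a \<omega>, future a \<omega>)}" for a
  have R[measurable]: "R a \<in> events" if "a \<in> F" for a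
  proof -
    have [measurable]: "X a \<in> borel_measurable M" "future a \<in> measurable M ?F"
      using pos[OF that] by auto
    have "{\<omega>\<in>space M. \<Psi> a (X a \<omega>, future a \<omega>)} \<in> events"
      using \<Psi> by measurable
    then have "first a \<inter> {\<omega>\<in>space M. \<Psi> a (X a \<omega>, future a \<omega>)} \<in> events" using first_events[OF that] by auto
    also have "first a \<inter> {\<omega>\<in>space M. \<Psi> a (X a \<omega>, future a \<omega>)} = R a"
      using sets.sets_into_space[OF first_events[OF that]] by (auto simp: R_def)
    finally show ?thesis .
  qed
  have R_le: "emeasure M (R a) \<le> ennreal \<kappa> * emeasure M (first a)" if a: "a \<in> F" for a
  proof -
    have "emeasure M (R a) = (\<integral>\<^sup>+\<omega>. emeasure M {\<omega>'\<in>space M. \<Psi> a (X a \<omega>, future 0 \<omega>')} * indicator (first a) \<omega> \<partial>M)"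
      unfolding R_def by (rule markov[OF pos[OF a] first[OF a] \<Psi>])
    also have "\<dots> \<le> (\<integral>\<^sup>+\<omega>. ennreal \<kappa> * indicator (first a) \<omega> \<partial>M)"
    proof (rule nn_integral_mono)
      fix \<omega>
      show "emeasure M {\<omega>'\<in>space M. \<Psi> a (X a \<omega>, future 0 \<omega>')} * indicator (first a) \<omega> \<le> ennreal \<kappa> * indicator (first a) \<omega>"
      proof (cases "\<omega> \<in> first a")
        case True
        define w where "w = x - X a \<omega>"
        have w: "u \<le> norm w"
          using far[OF a, of \<omega>] True by (simp add: w_def first_def dist_norm norm_minus_commute)
        have "emeasure M {\<omega>'\<in>space M. \<Psi> a (X a \<omega>, future 0 \<omega>')} \<le> emeasure M (near \<theta> w r)"
        proof (rule emeasure_mono_AE)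
          show "AE \<omega>' in M. \<omega>' \<in> {\<omega>'\<in>space M. \<Psi> a (X a \<omega>, future 0 \<omega>')} \<longrightarrow> \<omega>' \<in> near \<theta> w r"
            using AE_cadlag AE_future_0
          proof eventually_elim
            case (elim \<omega>')
            show ?case
            proof
              assume *: "\<omega>' \<in> {\<omega>'\<in>space M. \<Psi> a (X a \<omega>, future 0 \<omega>')}"
              then obtain b where b: "b \<in> F" "a < b" "dist (X a \<omega> + future 0 \<omega>' (b - a)) x < r"
                by (auto simp: \<Psi>_def)
              then have "X (b - a) \<omega>' \<in> ball w r"
                using elim(2) by (simp add: w_def dist_norm algebra_simps norm_minus_commute)
              \<comment> \<open>All times lie in one window of length \<theta>. As
                \<open>b - a\<close> may be irrational, right-continuity then moves the hit to a
                rational time, still before \<theta>.\<close>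
              moreover have "b - a < \<theta>" using subsetD[OF F(2) a] subsetD[OF F(2) b(1)] by simp
              ultimately have "\<exists>v\<in>\<rat>. b - a < v \<and> v < \<theta> \<and> X v \<omega>' \<in> ball w r"
                using b(2) elim(1) by (intro cadlag_right_dense[of "\<lambda>t. X t \<omega>'"] Rats_dense_in_real) auto
              then obtain v where "v \<in> \<rat>" "b - a < v" "v < \<theta>" "dist (X v \<omega>') w < r"
                by (auto simp: dist_commute)
              then show "\<omega>' \<in> near \<theta> w r"
                using b(2) * by (auto simp: near_def intro!: bexI[of _ v])
            qed
          qed
        qed simp
        also have "\<dots> \<le> ennreal \<kappa>"
          unfolding emeasure_eq_measure using near[OF w] by (rule ennreal_leI)
        finally show ?thesis using True by simp
      qed simp
    qed
    also have "\<dots> = ennreal \<kappa> * emeasure M (first a)"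
      using a by (intro nn_integral_cmult_indicator) simp
    finally show ?thesis .
  qed
  have disj: "disjoint_family_on first F"
    unfolding disjoint_family_on_def
  proof (intro ballI impI)
    fix a b assume "a \<in> F" "b \<in> F" "a \<noteq> b"
    then show "first a \<inter> first b = {}"
      by (cases "a < b") (auto simp: first_def)
  qed
  have "{\<omega>\<in>space M. \<exists>a\<in>F. \<exists>b\<in>F. a < b \<and> \<omega> \<in> B a \<and> dist (X b \<omega>) x < r} \<subseteq> (\<Union>a\<in>F. R a)"
  proof safe
    fix \<omega> a b assume \<omega>: "\<omega> \<in> space M" and ab: "a \<in> F" "b \<in> F" "a < b" "\<omega> \<in> B a" "dist (X b \<omega>) x < r"
    \<comment> \<open>Replacing \<open>a\<close> by the first time of occurrence loses nothing,
      since \<open>b\<close> comes after that time as well.\<close>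
    define a0 where "a0 = Min {a\<in>F. \<omega> \<in> B a}"
    have "a0 \<in> {a\<in>F. \<omega> \<in> B a}"
      unfolding a0_def using F(1) ab by (intro Min_in) auto
    moreover have le: "a0 \<le> a'" if "a' \<in> F" "\<omega> \<in> B a'" for a'
      unfolding a0_def using F(1) that by (intro Min_le) auto
    ultimately have "a0 \<in> F" "\<omega> \<in> first a0"
      by (auto simp: first_def dest: leD)
    moreover have "a0 < b" using le[OF ab(1,4)] ab(3) by simp
    ultimately have "\<omega> \<in> R a0"
      using ab(2,5) by (auto simp: R_def \<Psi>_def future_def intro!: exI[of _ b])
    with \<open>a0 \<in> F\<close> show "\<omega> \<in> (\<Union>a\<in>F. R a)" by blast
  qed
  then have "emeasure M {\<omega>\<in>space M. \<exists>a\<in>F. \<exists>b\<in>F. a < b \<and> \<omega> \<in> B a \<and> dist (X b \<omega>) x < r} \<le> emeasure M (\<Union>a\<in>F. R a)"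
    using F(1) by (intro emeasure_mono sets.finite_UN) auto
  also have "\<dots> \<le> (\<Sum>a\<in>F. emeasure M (R a))"
    using F(1) by (intro emeasure_subadditive_finite) auto
  also have "\<dots> \<le> (\<Sum>a\<in>F. ennreal \<kappa> * emeasure M (first a))"
    by (intro sum_mono R_le)
  also have "\<dots> = ennreal \<kappa> * emeasure M (\<Union>a\<in>F. first a)"
    using F(1) disj by (subst sum_emeasure[symmetric]) (auto simp: sum_distrib_left)
  also have "\<dots> \<le> ennreal \<kappa> * emeasure M (\<Union>a\<in>F. B a)"
    using F(1) history_events[OF B] by (intro mult_left_mono emeasure_mono sets.finite_UN) (auto simp: first_def)
  finally show ?thesis
    using \<kappa> by (simp add: emeasure_eq_measure ennreal_mult''[symmetric])
qed

text \<open>A dense \<open>D\<close> need have no first time at which \<open>B\<close> occurs, so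
  the finite case is extended by exhausting \<open>D\<close> with finite sets; the bound does not
  depend on them.\<close>

lemma prob_return:
  assumes D: "countable D" "D \<subseteq> {c..<c + \<theta>}" "0 \<le> c"
    and B: "\<And>a. a \<in> D \<Longrightarrow> B a \<in> sets (history a)"
    and far: "\<And>a \<omega>. a \<in> D \<Longrightarrow> \<omega> \<in> B a \<Longrightarrow> u \<le> dist (X a \<omega>) x"
    and near: "\<And>w. u \<le> norm w \<Longrightarrow> prob (near \<theta> w r) \<le> \<kappa>"
  shows "prob {\<omega>\<in>space M. \<exists>a\<in>D. \<exists>b\<in>D. a < b \<and> \<omega> \<in> B a \<and> dist (X b \<omega>) x < r} \<le> \<kappa> * prob (\<Union>a\<in>D. B a)"
proof (cases "D = {}")
  case False
  define F where "F n = from_nat_into D ` {..n}" for n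
  have F: "finite (F n)" "F n \<subseteq> D" for n
    using from_nat_into[OF False] by (auto simp: F_def)
  have UF: "(\<Union>n. F n) = D"
    unfolding F_def image_UN[symmetric] UN_atMost_UNIV by (rule range_from_nat_into[OF False D(1)])
  have F_mono: "F m \<subseteq> F n" if "m \<le> n" for m n using that by (auto simp: F_def)
  define W where "W n = {\<omega>\<in>space M. \<exists>a\<in>F n. \<exists>b\<in>F n. a < b \<and> \<omega> \<in> B a \<and> dist (X b \<omega>) x < r}" for n
  have W: "W n \<in> events" for n
  proof -
    have "Measurable.pred M (\<lambda>\<omega>. \<exists>a\<in>F n. \<exists>b\<in>F n. a < b \<and> \<omega> \<in> B a \<and> dist (X b \<omega>) x < r)"
    proof (intro pred_Bex_countable)
      fix a b assume ab: "a \<in> F n" "b \<in> F n"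
      then have "0 \<le> b" "a \<in> D" using F(2)[of n] D by auto
      note [measurable] = X_measurable[OF this(1)] history_events[OF B[OF this(2)]]
      show "Measurable.pred M (\<lambda>\<omega>. a < b \<and> \<omega> \<in> B a \<and> dist (X b \<omega>) x < r)" by measurable
    qed (use F(1) in \<open>auto intro: countable_finite\<close>)
    then show ?thesis by (simp add: W_def)
  qed
  have "incseq W"
    unfolding incseq_def
  proof (intro allI impI)
    fix m n :: nat assume "m \<le> n"
    from F_mono[OF this] show "W m \<subseteq> W n" unfolding W_def by blast
  qed
  then have "(\<lambda>n. prob (W n)) \<longlonglongrightarrow> prob (\<Union>n. W n)"
    using W by (intro finite_Lim_measure_incseq) auto
  moreover have "prob (W n) \<le> \<kappa> * prob (\<Union>a\<in>D. B a)" for n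
  proof -
    have "prob (W n) \<le> \<kappa> * prob (\<Union>a\<in>F n. B a)"
      unfolding W_def using F(2)[of n] D
      by (intro prob_return_finite[OF F(1) _ D(3) B far near]) auto
    also have "\<dots> \<le> \<kappa> * prob (\<Union>a\<in>D. B a)"
      using F(2)[of n] D(1) history_events[OF B] \<kappa>(1)
      by (intro mult_left_mono finite_measure_mono sets.countable_UN') auto
    finally show ?thesis .
  qed
  moreover have "(\<Union>n. W n) = {\<omega>\<in>space M. \<exists>a\<in>D. \<exists>b\<in>D. a < b \<and> \<omega> \<in> B a \<and> dist (X b \<omega>) x < r}"
  proof safe
    fix \<omega> a b assume \<omega>: "\<omega> \<in> space M" and ab: "a \<in> D" "b \<in> D" "a < b" "\<omega> \<in> B a" "dist (X b \<omega>) x < r"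
    obtain i j where "a \<in> F i" "b \<in> F j" using ab UF by blast
    then have "a \<in> F (max i j)" "b \<in> F (max i j)" using F_mono[of i "max i j"] F_mono[of j "max i j"] by auto
    then show "\<omega> \<in> (\<Union>n. W n)" using \<omega> ab by (auto simp: W_def)
  qed (use F(2) in \<open>auto simp: W_def\<close>)
  ultimately show ?thesis
    by (intro LIMSEQ_le_const2[of "\<lambda>n. prob (W n)"]) auto
qed simp

text \<open>If \<open>X h = z\<close> had probability at least \<open>e\<close> for infinitely many \<open>h\<close>, then infinitely many of these
  visits would occur with positive probability; in between the path leaves \<open>z\<close>, so each visit is
  followed by another one with conditional probability at most \<open>\<kappa>\<close>.\<close>

lemma finite_atom_times:
  assumes "0 \<le> c" "0 < e"
  shows "finite {h\<in>{c..<c + \<theta>}. e \<le> prob {\<omega>\<in>space M. X h \<omega> = z}}"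
proof (rule ccontr)
  assume "infinite {h\<in>{c..<c + \<theta>}. e \<le> prob {\<omega>\<in>space M. X h \<omega> = z}}"
  then obtain h :: "nat \<Rightarrow> real" where h: "inj h" "range h \<subseteq> {h\<in>{c..<c + \<theta>}. e \<le> prob {\<omega>\<in>space M. X h \<omega> = z}}"
    using infinite_countable_subset by blast
  have h_range: "h n \<in> {c..<c + \<theta>}" "e \<le> prob {\<omega>\<in>space M. X (h n) \<omega> = z}" "0 \<le> h n" for n
  proof -
    have "h n \<in> {h\<in>{c..<c + \<theta>}. e \<le> prob {\<omega>\<in>space M. X h \<omega> = z}}" using h(2) by blast
    then show "h n \<in> {c..<c + \<theta>}" "e \<le> prob {\<omega>\<in>space M. X (h n) \<omega> = z}" "0 \<le> h n"
      using \<open>0 \<le> c\<close> by auto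
  qed
  note [measurable] = X_measurable[OF h_range(3)]
  define E where "E N = {\<omega>\<in>space M. \<exists>n\<in>{N..}. X (h n) \<omega> = z}" for N
  have E[measurable]: "E N \<in> events" for N unfolding E_def by measurable
  define R where "R = (\<Inter>N. E N)"
  have R[measurable]: "R \<in> events" unfolding R_def by measurable
  have "decseq E" unfolding decseq_def E_def by fastforce
  then have lim: "(\<lambda>N. prob (E N)) \<longlonglongrightarrow> prob R"
    unfolding R_def by (intro finite_Lim_measure_decseq) auto
  have "e \<le> prob (E N)" for N
  proof -
    have "prob {\<omega>\<in>space M. X (h N) \<omega> = z} \<le> prob (E N)"
      by (intro finite_measure_mono) (auto simp: E_def)
    then show ?thesis using h_range(2)[of N] by simp
  qed
  then have "e \<le> prob R" using lim by (intro LIMSEQ_le_const) auto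
  \<comment> \<open>The rationals are added because the excursion away from \<open>z\<close> between
    two visits has to be observed at some time of \<open>D\<close>.\<close>
  define D where "D = range h \<union> \<rat> \<inter> {c..<c + \<theta>}"
  have D: "countable D" "D \<subseteq> {c..<c + \<theta>}" "D \<subseteq> {0..}"
    using h_range assms(1) by (auto simp: D_def intro: countable_rat)
  have "prob R \<le> \<kappa> * prob (E N)" for N
  proof -
    define u where "u j = inverse (real (Suc j))" for j
    \<comment> \<open>A visit with index at least \<open>N\<close> has happened before
      \<open>a\<close>, so these events lie in \<open>E N\<close>. The distance at \<open>a\<close>
      is discretised because the radius from \<open>near_le\<close> depends on it.\<close>
    define B where "B j a = {\<omega>\<in>space M. (\<exists>n\<in>{n. N \<le> n \<and> h n < a}. X (h n) \<omega> = z) \<and> u j \<le> dist (X a \<omega>) z}" for j a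
    have B: "B j a \<in> sets (history a)" if "a \<in> D" for j a
    proof -
      have "0 \<le> a" using that D(3) by auto
      then have [measurable]: "X a \<in> borel_measurable (history a)" by (intro X_history) auto
      have "Measurable.pred (history a) (\<lambda>\<omega>. \<exists>n\<in>{n. N \<le> n \<and> h n < a}. X (h n) \<omega> = z)"
      proof (rule pred_Bex_countable)
        fix n assume "n \<in> {n. N \<le> n \<and> h n < a}"
        then have [measurable]: "X (h n) \<in> borel_measurable (history a)"
          using h_range(3)[of n] by (intro X_history) auto
        show "Measurable.pred (history a) (\<lambda>\<omega>. X (h n) \<omega> = z)" by measurable
      qed simp
      moreover have "Measurable.pred (history a) (\<lambda>\<omega>. u j \<le> dist (X a \<omega>) z)"
        by measurable
      ultimately have "Measurable.pred (history a) (\<lambda>\<omega>. (\<exists>n\<in>{n. N \<le> n \<and> h n < a}. X (h n) \<omega> = z) \<and> u j \<le> dist (X a \<omega>) z)"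
        by (rule pred_intros_logic(3))
      then show ?thesis unfolding B_def pred_def space_vimage_algebra .
    qed
    define V where "V j = {\<omega>\<in>space M. \<exists>a\<in>D. \<exists>b\<in>D. a < b \<and> \<omega> \<in> B j a \<and> X b \<omega> = z}" for j
    have V: "V j \<in> events" for j
    proof -
      have "Measurable.pred M (\<lambda>\<omega>. \<exists>a\<in>D. \<exists>b\<in>D. a < b \<and> \<omega> \<in> B j a \<and> X b \<omega> = z)"
      proof (intro pred_Bex_countable D(1))
        fix a b assume ab: "a \<in> D" "b \<in> D"
        then have "0 \<le> b" using D(3) by auto
        note [measurable] = X_measurable[OF this] history_events[OF B[OF ab(1)]]
        show "Measurable.pred M (\<lambda>\<omega>. a < b \<and> \<omega> \<in> B j a \<and> X b \<omega> = z)" by measurable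
      qed
      then show ?thesis by (simp add: V_def)
    qed
    have V_le: "prob (V j) \<le> \<kappa> * prob (E N)" for j
    proof -
      have "0 < u j" by (simp add: u_def)
      then obtain r where r: "0 < r" "\<And>w. u j \<le> norm w \<Longrightarrow> prob (near \<theta> w r) \<le> \<kappa>"
        using near_le by blast
      let ?W = "{\<omega>\<in>space M. \<exists>a\<in>D. \<exists>b\<in>D. a < b \<and> \<omega> \<in> B j a \<and> dist (X b \<omega>) z < r}"
      have W: "?W \<in> events"
      proof -
        have "Measurable.pred M (\<lambda>\<omega>. \<exists>a\<in>D. \<exists>b\<in>D. a < b \<and> \<omega> \<in> B j a \<and> dist (X b \<omega>) z < r)"
        proof (intro pred_Bex_countable D(1))
          fix a b assume ab: "a \<in> D" "b \<in> D"
          then have "0 \<le> b" using D(3) by auto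
          note [measurable] = X_measurable[OF this] history_events[OF B[OF ab(1)]]
          show "Measurable.pred M (\<lambda>\<omega>. a < b \<and> \<omega> \<in> B j a \<and> dist (X b \<omega>) z < r)" by measurable
        qed
        then show ?thesis by simp
      qed
      have "V j \<subseteq> ?W" using r(1) unfolding V_def by fastforce
      then have "prob (V j) \<le> prob ?W" by (rule finite_measure_mono[OF _ W])
      also have "\<dots> \<le> \<kappa> * prob (\<Union>a\<in>D. B j a)"
        by (rule prob_return[OF D(1,2) \<open>0 \<le> c\<close> B _ r(2)]) (auto simp: B_def)
      also have "(\<Union>a\<in>D. B j a) \<subseteq> E N" by (auto simp: B_def E_def)
      then have "\<kappa> * prob (\<Union>a\<in>D. B j a) \<le> \<kappa> * prob (E N)"
        using \<kappa>(1) by (intro mult_left_mono finite_measure_mono) auto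
      finally show ?thesis .
    qed
    have "u j \<le> u i" if "i \<le> j" for i j
      using that by (simp add: u_def field_simps)
    then have B_mono: "B i a \<subseteq> B j a" if "i \<le> j" for i j a
      using that unfolding B_def by (blast intro: order_trans)
    have "incseq V"
      unfolding incseq_def
    proof (intro allI impI subsetI)
      fix i j \<omega> assume "i \<le> j" "\<omega> \<in> V i"
      then obtain a b where "\<omega> \<in> space M" "a \<in> D" "b \<in> D" "a < b" "\<omega> \<in> B i a" "X b \<omega> = z"
        unfolding V_def by blast
      with B_mono[OF \<open>i \<le> j\<close>, of a] show "\<omega> \<in> V j" unfolding V_def by blast
    qed
    then have "(\<lambda>j. prob (V j)) \<longlonglongrightarrow> prob (\<Union>j. V j)"
      using V by (intro finite_Lim_measure_incseq) auto
    then have "prob (\<Union>j. V j) \<le> \<kappa> * prob (E N)"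
      using V_le by (intro LIMSEQ_le_const2[of "\<lambda>j. prob (V j)"]) auto
    moreover have "prob R \<le> prob (\<Union>j. V j)"
    proof (rule finite_measure_mono_AE)
      show "AE \<omega> in M. \<omega> \<in> R \<longrightarrow> \<omega> \<in> (\<Union>j. V j)"
        using not_constant AE_space
      proof eventually_elim
        case (elim \<omega>)
        show ?case
        proof
          assume "\<omega> \<in> R"
          then have visit: "\<exists>n\<ge>N'. X (h n) \<omega> = z" for N' by (auto simp: R_def E_def)
          obtain n where n: "N \<le> n" "X (h n) \<omega> = z" using visit by blast
          obtain m where m: "Suc n \<le> m" "X (h m) \<omega> = z" using visit by blast
          have "h n \<noteq> h m" using h(1) m(1) by (auto dest: injD)
          \<comment> \<open>The sequence \<open>h\<close> need not be monotone, so the two visits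
            are renamed in the order of time.\<close>
          then obtain k l where kl: "N \<le> k" "h k < h l" "X (h k) \<omega> = z" "X (h l) \<omega> = z"
            using n m by (metis Suc_leD linorder_neqE_linordered_idom order.trans)
          obtain a where a: "a \<in> \<rat>" "h k < a" "a < h l" "X a \<omega> \<noteq> z"
            using elim(1) kl(2) h_range(3)[of k] by blast
          obtain j where "inverse (real (Suc j)) < dist (X a \<omega>) z"
            using reals_Archimedean[of "dist (X a \<omega>) z"] a(4) by auto
          then have "\<omega> \<in> B j a"
            using kl a(2) elim(2) by (auto simp: B_def u_def)
          moreover have "a \<in> D" "h l \<in> D"
            using a h_range(1)[of k] h_range(1)[of l] by (auto simp: D_def)
          ultimately have "\<omega> \<in> V j" using a(3) kl(4) elim(2) by (auto simp: V_def)
          then show "\<omega> \<in> (\<Union>j. V j)" by blast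
        qed
      qed
    qed (use V in auto)
    ultimately show ?thesis by simp
  qed
  \<comment> \<open>The bound holds for every \<open>N\<close> and \<open>prob (E N)\<close> tends
    to \<open>prob R\<close>, so the same event appears on both sides.\<close>
  then have "prob R \<le> \<kappa> * prob R"
    by (intro LIMSEQ_le_const[OF tendsto_mult_left[OF lim]]) auto
  moreover have "\<kappa> * prob R < prob R"
    using \<kappa>(2) \<open>e \<le> prob R\<close> \<open>0 < e\<close> by simp
  ultimately show False by simp
qed

text \<open>Windows of length \<theta> cover the half-line, and each holds finitely many times for
  every threshold.\<close>

lemma countable_atom_times: "countable {h. 0 \<le> h \<and> prob {\<omega>\<in>space M. X h \<omega> = z} \<noteq> 0}"
proof -
  have "{h. 0 \<le> h \<and> prob {\<omega>\<in>space M. X h \<omega> = z} \<noteq> 0} \<subseteq>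
    (\<Union>m i. {h\<in>{real m * \<theta>..<real m * \<theta> + \<theta>}. inverse (real (Suc i)) \<le> prob {\<omega>\<in>space M. X h \<omega> = z}})"
  proof
    fix h assume "h \<in> {h. 0 \<le> h \<and> prob {\<omega>\<in>space M. X h \<omega> = z} \<noteq> 0}"
    then have h: "0 \<le> h" "0 < prob {\<omega>\<in>space M. X h \<omega> = z}" by (auto simp: zero_less_measure_iff)
    obtain i where i: "inverse (real (Suc i)) < prob {\<omega>\<in>space M. X h \<omega> = z}"
      using reals_Archimedean[OF h(2)] by blast
    define m where "m = nat \<lfloor>h / \<theta>\<rfloor>"
    have "real m = of_int \<lfloor>h / \<theta>\<rfloor>" using h(1) \<theta> by (simp add: m_def)
    then have "real m \<le> h / \<theta>" "h / \<theta> < real m + 1" by linarith+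
    then have "h \<in> {real m * \<theta>..<real m * \<theta> + \<theta>}" using \<theta> by (simp add: field_simps)
    then show "h \<in> (\<Union>m i. {h\<in>{real m * \<theta>..<real m * \<theta> + \<theta>}. inverse (real (Suc i)) \<le> prob {\<omega>\<in>space M. X h \<omega> = z}})"
      using i by (auto intro!: less_imp_le)
  qed
  moreover have "countable (\<Union>m i. {h\<in>{real m * \<theta>..<real m * \<theta> + \<theta>}. inverse (real (Suc i)) \<le> prob {\<omega>\<in>space M. X h \<omega> = z}})"
    using \<theta> by (intro countable_UN countableI_type countable_finite finite_atom_times) auto
  ultimately show ?thesis by (rule countable_subset)
qed

text \<open>\<open>G i\<close> says that the path comes \<open>1 / Suc i\<close>-close to \<open>x\<close> without being there. Once it does, it comes
  arbitrarily close again with conditional probability at most \<open>\<kappa>\<close>; but on \<open>\<Inter>i. G i\<close> it always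
  does, since it cannot reach \<open>x\<close> by a jump.\<close>

lemma AE_not_hit_after:
  assumes h: "0 \<le> h" and h_null: "prob {\<omega>\<in>space M. X h \<omega> = x} = 0"
    and jump_null: "\<And>c. c \<in> jump_points \<Longrightarrow> prob {\<omega>\<in>space M. X h \<omega> = x - c} = 0"
  shows "AE \<omega> in M. \<forall>t. h < t \<longrightarrow> t < h + \<theta> \<longrightarrow> X t \<omega> \<noteq> x"
proof -
  define D where "D = (+) h ` (\<rat> \<inter> {0..<\<theta>})"
  have D: "countable D" "D \<subseteq> {h..<h + \<theta>}" by (auto simp: D_def intro: countable_rat)
  have D_pos: "0 \<le> a" if "a \<in> D" for a using D(2) h that by auto
  have D_dense: "\<exists>p\<in>D. a < p \<and> p < b" if ab: "h \<le> a" "a < b" "b \<le> h + \<theta>" for a b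
  proof -
    obtain p where "p \<in> \<rat>" "a - h < p" "p < b - h"
      using Rats_dense_in_real[of "a - h" "b - h"] ab by auto
    then have "h + p \<in> D" "a < h + p" "h + p < b"
      unfolding D_def using ab by (intro imageI, auto)
    then show ?thesis by blast
  qed
  define \<eta> where "\<eta> i = inverse (real (Suc i))" for i
  have \<eta>: "0 < \<eta> i" "i \<le> j \<Longrightarrow> \<eta> j \<le> \<eta> i" for i j by (auto simp: \<eta>_def field_simps)
  have small: "\<exists>i. \<eta> i < e" if "0 < e" for e using reals_Archimedean[OF that] by (simp add: \<eta>_def)
  define G where "G i = {\<omega>\<in>space M. \<exists>a\<in>D. 0 < dist (X a \<omega>) x \<and> dist (X a \<omega>) x < \<eta> i}" for i
  define B where "B i j a = {\<omega>\<in>space M. \<eta> j \<le> dist (X a \<omega>) x \<and> dist (X a \<omega>) x < \<eta> i}" for i j a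
  \<comment> \<open>The clause over all \<open>k\<close> puts \<open>V i j\<close> into the return
    event of \<open>prob_return\<close> for every radius, whichever \<open>near_le\<close> assigns
    to the distance \<open>\<eta> j\<close>.\<close>
  define V where "V i j = {\<omega>\<in>space M. \<exists>a\<in>D. \<omega> \<in> B i j a \<and> (\<forall>k. \<exists>b\<in>D. a < b \<and> dist (X b \<omega>) x < \<eta> k)}" for i j
  have B: "B i j a \<in> sets (history a)" if "a \<in> D" for i j a
  proof -
    have [measurable]: "X a \<in> borel_measurable (history a)" using D_pos[OF that] by (intro X_history) auto
    have "Measurable.pred (history a) (\<lambda>\<omega>. \<eta> j \<le> dist (X a \<omega>) x \<and> dist (X a \<omega>) x < \<eta> i)" by measurable
    then show ?thesis by (simp add: B_def pred_def)
  qed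
  have G[measurable]: "G i \<in> events" for i
  proof -
    have "Measurable.pred M (\<lambda>\<omega>. \<exists>a\<in>D. 0 < dist (X a \<omega>) x \<and> dist (X a \<omega>) x < \<eta> i)"
    proof (rule pred_Bex_countable[OF D(1)])
      fix a assume "a \<in> D"
      note [measurable] = X_measurable[OF D_pos[OF this]]
      show "Measurable.pred M (\<lambda>\<omega>. 0 < dist (X a \<omega>) x \<and> dist (X a \<omega>) x < \<eta> i)" by measurable
    qed
    then show ?thesis by (simp add: G_def)
  qed
  have V[measurable]: "V i j \<in> events" for i j
  proof -
    have "Measurable.pred M (\<lambda>\<omega>. \<exists>a\<in>D. \<omega> \<in> B i j a \<and> (\<forall>k. \<exists>b\<in>D. a < b \<and> dist (X b \<omega>) x < \<eta> k))"
    proof (rule pred_Bex_countable[OF D(1)])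
      fix a assume "a \<in> D"
      note [measurable] = history_events[OF B[OF this]]
      have [measurable]: "Measurable.pred M (\<lambda>\<omega>. \<forall>k. \<exists>b\<in>D. a < b \<and> dist (X b \<omega>) x < \<eta> k)"
      proof (intro pred_intros_countable pred_Bex_countable D(1))
        fix k b assume "b \<in> D"
        note [measurable] = X_measurable[OF D_pos[OF this]]
        show "Measurable.pred M (\<lambda>\<omega>. a < b \<and> dist (X b \<omega>) x < \<eta> k)" by measurable
      qed
      show "Measurable.pred M (\<lambda>\<omega>. \<omega> \<in> B i j a \<and> (\<forall>k. \<exists>b\<in>D. a < b \<and> dist (X b \<omega>) x < \<eta> k))" by measurable
    qed
    then show ?thesis by (simp add: V_def)
  qed
  have V_le: "prob (V i j) \<le> \<kappa> * prob (G i)" for i j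
  proof -
    obtain r where r: "0 < r" "\<And>w. \<eta> j \<le> norm w \<Longrightarrow> prob (near \<theta> w r) \<le> \<kappa>"
      using near_le[OF \<eta>(1)[of j]] by blast
    obtain k where k: "\<eta> k < r" using small[OF r(1)] by blast
    let ?W = "{\<omega>\<in>space M. \<exists>a\<in>D. \<exists>b\<in>D. a < b \<and> \<omega> \<in> B i j a \<and> dist (X b \<omega>) x < r}"
    have W: "?W \<in> events"
    proof -
      have "Measurable.pred M (\<lambda>\<omega>. \<exists>a\<in>D. \<exists>b\<in>D. a < b \<and> \<omega> \<in> B i j a \<and> dist (X b \<omega>) x < r)"
      proof (intro pred_Bex_countable D(1))
        fix a b assume ab: "a \<in> D" "b \<in> D"
        note [measurable] = X_measurable[OF D_pos[OF ab(2)]] history_events[OF B[OF ab(1)]]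
        show "Measurable.pred M (\<lambda>\<omega>. a < b \<and> \<omega> \<in> B i j a \<and> dist (X b \<omega>) x < r)" by measurable
      qed
      then show ?thesis by simp
    qed
    have "V i j \<subseteq> ?W" using k unfolding V_def by (fastforce intro: less_trans)
    then have "prob (V i j) \<le> prob ?W" by (rule finite_measure_mono[OF _ W])
    also have "\<dots> \<le> \<kappa> * prob (\<Union>a\<in>D. B i j a)"
      by (rule prob_return[OF D(1,2) h B _ r(2)]) (auto simp: B_def)
    also have "(\<Union>a\<in>D. B i j a) \<subseteq> G i"
      using \<eta>(1)[of j] unfolding B_def G_def by (blast intro: less_le_trans)
    then have "\<kappa> * prob (\<Union>a\<in>D. B i j a) \<le> \<kappa> * prob (G i)"
      using \<kappa>(1) by (intro mult_left_mono finite_measure_mono) auto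
    finally show ?thesis .
  qed
  have UV_le: "prob (\<Union>j. V i j) \<le> \<kappa> * prob (G i)" for i
  proof -
    have B_mono: "B i j a \<subseteq> B i j' a" if "j \<le> j'" for j j' a
      using \<eta>(2)[OF that] by (auto simp: B_def)
    have "incseq (V i)"
      unfolding incseq_def
    proof (intro allI impI subsetI)
      fix j j' \<omega> assume "j \<le> j'" "\<omega> \<in> V i j"
      then obtain a where a: "\<omega> \<in> space M" "a \<in> D" "\<omega> \<in> B i j a" "\<forall>k. \<exists>b\<in>D. a < b \<and> dist (X b \<omega>) x < \<eta> k"
        unfolding V_def by blast
      with B_mono[OF \<open>j \<le> j'\<close>, of a] show "\<omega> \<in> V i j'" unfolding V_def by blast
    qed
    then have "(\<lambda>j. prob (V i j)) \<longlonglongrightarrow> prob (\<Union>j. V i j)"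
      by (intro finite_Lim_measure_incseq) auto
    then show ?thesis
      using V_le by (intro LIMSEQ_le_const2[of "\<lambda>j. prob (V i j)"]) auto
  qed
  have AE_h: "AE \<omega> in M. X h \<omega> \<noteq> x"
  proof -
    note [measurable] = X_measurable[OF h]
    show ?thesis using h_null by (subst (asm) prob_eq_0) auto
  qed
  have no_jump: "AE \<omega> in M. \<forall>s l. h < s \<longrightarrow> ((\<lambda>t. X t \<omega>) \<longlongrightarrow> l) (at_left s) \<longrightarrow> x = l \<or> x = X s \<omega> \<longrightarrow> l = X s \<omega>"
    by (rule AE_no_jump_touch[OF h]) (rule jump_null)
  have G_V: "AE \<omega> in M. (\<forall>i. \<omega> \<in> G i) \<longrightarrow> (\<forall>i. \<omega> \<in> (\<Union>j. V i j))"
    using AE_cadlag AE_h no_jump not_constant AE_space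
  proof eventually_elim
    case (elim \<omega>)
    show ?case
    proof (intro impI allI)
      fix i assume G: "\<forall>i. \<omega> \<in> G i"
      define f where "f v = X (h + v) \<omega>" for v
      have f: "cadlag f"
        unfolding f_def[abs_def] using elim(1) h by (rule cadlag_shift)
      have acc: "\<exists>v. 0 \<le> v \<and> v \<le> \<theta> \<and> dist (f v) x < e" if e: "0 < e" for e
      proof -
        obtain k where "\<eta> k < e" using small[OF e] by blast
        moreover obtain v where "v \<in> \<rat> \<inter> {0..<\<theta>}" "dist (X (h + v) \<omega>) x < \<eta> k"
          using G[rule_format, of k] by (auto simp: G_def D_def)
        ultimately show ?thesis by (intro exI[of _ v]) (auto simp: f_def)
      qed
      obtain v where v: "v \<in> {0..\<theta>}" "x = f v \<or> 0 < v \<and> (f \<longlongrightarrow> x) (at_left v)"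
        using acc by (rule cadlag_accumulation[OF f])
      have "0 < v"
        using v elim(2) by (cases "v = 0") (auto simp: f_def)
      define s where "s = h + v"
      have s: "h < s" "s \<le> h + \<theta>" using \<open>0 < v\<close> v(1) by (auto simp: s_def)
      \<comment> \<open>If \<open>x\<close> is the value at \<open>s\<close>, \<open>no_jump\<close>
        makes it the left limit too. Approaching \<open>x\<close> from the left provides times
        before \<open>s\<close> at every small distance from \<open>x\<close>.\<close>
      have "((\<lambda>t. X t \<omega>) \<longlongrightarrow> x) (at_left s)"
      proof (cases "x = f v")
        case True
        obtain l where l: "((\<lambda>t. X t \<omega>) \<longlongrightarrow> l) (at_left s)"
          using elim(1) h s(1) unfolding cadlag_def by (meson order.strict_trans1)
        have "x = X s \<omega>" using True by (simp add: f_def s_def)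
        then have "l = X s \<omega>" using elim(3) s(1) l by blast
        then show ?thesis using l \<open>x = X s \<omega>\<close> by simp
      next
        case False
        then have "(f \<longlongrightarrow> x) (at_left v)" using v(2) by blast
        then show ?thesis by (simp add: s_def f_def[abs_def] at_left_shift filterlim_filtermap)
      qed
      then have left: "\<exists>c<s. \<forall>t. c < t \<longrightarrow> t < s \<longrightarrow> dist (X t \<omega>) x < e" if "0 < e" for e
        using tendstoD[OF _ that, of "\<lambda>t. X t \<omega>" x "at_left s"] unfolding eventually_at_left_field by auto
      obtain c where c: "c < s" "\<And>t. c < t \<Longrightarrow> t < s \<Longrightarrow> dist (X t \<omega>) x < \<eta> i"
        using left[OF \<eta>(1)] by blast
      \<comment> \<open>The path might sit at \<open>x\<close> just before \<open>s\<close>; since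
        it is not constant there, some time shows a positive distance, and right-continuity moves it
        into \<open>D\<close>.\<close>
      have max: "0 \<le> max c h" "max c h < s" using h c(1) s(1) by auto
      then obtain a' where a': "max c h < a'" "a' < s" "X a' \<omega> \<noteq> x" using elim(4) by blast
      have "\<exists>a\<in>D. a' < a \<and> a < s \<and> X a \<omega> \<in> - {x}"
        using a' h s(2) D_dense by (intro cadlag_right_dense[OF elim(1)]) auto
      then obtain a where a: "a \<in> D" "a' < a" "a < s" "X a \<omega> \<noteq> x" by auto
      obtain j where j: "\<eta> j < dist (X a \<omega>) x" using small[of "dist (X a \<omega>) x"] a(4) by auto
      have "\<omega> \<in> B i j a"
        using j c(2)[of a] a a' elim(5) by (simp add: B_def)
      moreover have "\<exists>b\<in>D. a < b \<and> dist (X b \<omega>) x < \<eta> k" for k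
      proof -
        obtain c where c: "c < s" "\<And>t. c < t \<Longrightarrow> t < s \<Longrightarrow> dist (X t \<omega>) x < \<eta> k"
          using left[OF \<eta>(1)] by blast
        have "h \<le> max a c" using subsetD[OF D(2) a(1)] by (simp add: le_max_iff_disj)
        then obtain b where "b \<in> D" "max a c < b" "b < s"
          using D_dense[of "max a c" s] a(3) c(1) s(2) by auto
        then show ?thesis using c(2)[of b] by auto
      qed
      ultimately have "\<omega> \<in> V i j" using a(1) elim(5) by (auto simp: V_def)
      then show "\<omega> \<in> (\<Union>j. V i j)" by blast
    qed
  qed
  have "prob (\<Inter>i. G i) \<le> \<kappa> * prob (G i)" for i
  proof -
    have "prob (\<Inter>i. G i) \<le> prob (\<Union>j. V i j)"
      using G_V by (intro finite_measure_mono_AE) auto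
    then show ?thesis using UV_le[of i] by simp
  qed
  moreover have "(\<lambda>i. prob (G i)) \<longlonglongrightarrow> prob (\<Inter>i. G i)"
  proof (rule finite_Lim_measure_decseq)
    show "decseq G" unfolding decseq_def G_def using \<eta>(2) by (fastforce intro: less_le_trans)
  qed auto
  ultimately have "prob (\<Inter>i. G i) \<le> \<kappa> * prob (\<Inter>i. G i)"
    by (intro LIMSEQ_le_const[OF tendsto_mult_left]) auto
  then have "prob (\<Inter>i. G i) = 0"
    using \<kappa>(2) measure_nonneg[of M "\<Inter>i. G i"] by (smt (verit) mult_le_cancel_right1)
  then have "AE \<omega> in M. \<omega> \<notin> (\<Inter>i. G i)"
    by (subst (asm) prob_eq_0) auto
  then show ?thesis
    using AE_cadlag not_constant AE_space
  proof eventually_elim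
    case (elim \<omega>)
    show ?case
    proof (intro allI impI notI)
      fix t assume t: "h < t" "t < h + \<theta>" "X t \<omega> = x"
      \<comment> \<open>Just after a visit at \<open>t\<close> the path is close to \<open>x\<close>
        but not constantly there, so visiting \<open>x\<close> entails every
        \<open>G i\<close>.\<close>
      have "\<omega> \<in> G i" for i
      proof -
        obtain d where d: "0 < d" "\<And>v. t \<le> v \<Longrightarrow> v < t + d \<Longrightarrow> dist (X v \<omega>) (X t \<omega>) < \<eta> i"
          using cadlag_right[OF elim(2) _ \<eta>(1), of t i] t h by auto
        have "0 \<le> t" "t < min (t + d) (h + \<theta>)" using t h d(1) by auto
        then obtain a' where a': "t < a'" "a' < min (t + d) (h + \<theta>)" "X a' \<omega> \<noteq> x" using elim(3) by blast
        have "\<exists>a\<in>D. a' < a \<and> a < min (t + d) (h + \<theta>) \<and> X a \<omega> \<in> - {x}"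
          using a' h t D_dense by (intro cadlag_right_dense[OF elim(2)]) auto
        then obtain a where a: "a \<in> D" "a' < a" "a < t + d" "X a \<omega> \<noteq> x" by auto
        then show ?thesis
          using d(2)[of a] a'(1) t(3) elim(4) by (auto simp: G_def intro!: bexI[of _ a])
      qed
      then show False using elim(1) by blast
    qed
  qed
qed

text \<open>The times at which \<open>X h\<close> charges \<open>x\<close> or a point
  \<open>x - c\<close> with \<open>c\<close> in \<open>jump_points\<close> are countable, so every
  rational interval contains an admissible \<open>h\<close>; the windows of length \<theta> after
  these cover all positive times.\<close>

lemma AE_not_hit: "AE \<omega> in M. \<forall>t>0. X t \<omega> \<noteq> x"
proof -
  define bad where "bad = {h. 0 \<le> h \<and> prob {\<omega>\<in>space M. X h \<omega> = x} \<noteq> 0} \<union>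
    (\<Union>c\<in>jump_points. {h. 0 \<le> h \<and> prob {\<omega>\<in>space M. X h \<omega> = x - c} \<noteq> 0})"
  have "countable bad"
    unfolding bad_def by (intro countable_Un countable_UN countable_jump_points countable_atom_times)
  then have "\<not> {a<..<b} \<subseteq> bad" if "a < b" for a b
    using uncountable_open_interval[of a b] that countable_subset by blast
  then have "\<exists>h. a < h \<and> h < b \<and> h \<notin> bad" if "a < b" for a b
    using that by (metis greaterThanLessThan_iff subsetI)
  then obtain g where g: "\<And>a b. a < b \<Longrightarrow> a < g a b \<and> g a b < b \<and> g a b \<notin> bad" by metis
  have "AE \<omega> in M. \<forall>a\<in>\<rat>. \<forall>b\<in>\<rat>. 0 \<le> a \<longrightarrow> a < b \<longrightarrow> (\<forall>t. g a b < t \<longrightarrow> t < g a b + \<theta> \<longrightarrow> X t \<omega> \<noteq> x)"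
  proof (intro AE_ball_countable[THEN iffD2] countable_rat ballI AE_impI)
    fix a b :: real assume ab: "0 \<le> a" "a < b"
    have "0 \<le> g a b" "g a b \<notin> bad" using g[OF ab(2)] ab by auto
    then show "AE \<omega> in M. \<forall>t. g a b < t \<longrightarrow> t < g a b + \<theta> \<longrightarrow> X t \<omega> \<noteq> x"
      by (intro AE_not_hit_after) (auto simp: bad_def)
  qed
  then show ?thesis
  proof eventually_elim
    case (elim \<omega>)
    show ?case
    proof (intro allI impI)
      fix t :: real assume t: "0 < t"
      \<comment> \<open>With \<open>a > t - \<theta>\<close> the good time between \<open>a\<close>
        and \<open>b < t\<close> lies less than \<theta> before \<open>t\<close>.\<close>
      obtain a where a: "a \<in> \<rat>" "max 0 (t - \<theta>) < a" "a < t"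
        using Rats_dense_in_real[of "max 0 (t - \<theta>)" t] t \<theta> by auto
      obtain b where b: "b \<in> \<rat>" "a < b" "b < t" using Rats_dense_in_real[OF a(3)] by blast
      have "g a b < t" "t < g a b + \<theta>" using g[OF b(2)] a b by auto
      then show "X t \<omega> \<noteq> x" using elim a b by auto
    qed
  qed
qed

end

theorem proposition1p4:
  fixes M :: "'w measure" and X :: "real \<Rightarrow> 'w \<Rightarrow> real ^ 'd" and q :: real
  assumes "levy_process M X" and "q > 0"
  shows "(h1 (kill_space q M) (kill_path (levy_path X)) < 1 \<and>
          h2 (kill_space q M) (kill_path (levy_path X)) < 1 \<and>
          h3 (kill_space q M) (kill_path (levy_path X)) < 1)
     \<longleftrightarrow> polar M (levy_path X) {0}"
proof -
  interpret killed_levy M X q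
    by unfold_locales (use assms in auto)
  show ?thesis
  proof
    assume "h1 (kill_space q M) (kill_path (levy_path X)) < 1 \<and>
          h2 (kill_space q M) (kill_path (levy_path X)) < 1 \<and>
          h3 (kill_space q M) (kill_path (levy_path X)) < 1"
    then have h1: "h1 (kill_space q M) killed < 1" and h3: "h3 (kill_space q M) killed < 1" by auto
    obtain \<theta> \<kappa> where "0 < \<theta>" "0 \<le> \<kappa>" "\<kappa> < 1"
      "\<And>u. 0 < u \<Longrightarrow> \<exists>r>0. \<forall>w. u \<le> norm w \<longrightarrow> prob (near \<theta> w r) \<le> \<kappa>"
      using near_bound[OF h3] by blast
    then interpret avoiding_levy M X \<theta> \<kappa>
      by unfold_locales (use AE_not_constant[OF h1] in auto)
    show "polar M (levy_path X) {0}"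
      unfolding polar_iff using AE_not_hit by blast
  next
    assume "polar M (levy_path X) {0}"
    then have avoid: "AE \<omega> in M. \<forall>t>0. X t \<omega> \<noteq> y" for y by (simp add: polar_iff)
    have "AE \<omega> in M. X t \<omega> \<noteq> 0" if "0 < t" for t
      using avoid[of 0] by eventually_elim (use that in auto)
    then show "h1 (kill_space q M) (kill_path (levy_path X)) < 1 \<and>
          h2 (kill_space q M) (kill_path (levy_path X)) < 1 \<and>
          h3 (kill_space q M) (kill_path (levy_path X)) < 1"
      using h1_less_1 h2_less_1 h3_less_1[OF avoid] by blast
  qed
qed

end
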